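(* Let $n\ge 1$, and let the operators $\overline{\widetilde{\pi}}_w$, $\overline{\widetilde{\theta}}_w$ ($w\in\mathfrak{S}_n$) on $\mathbb{Z}[\beta][x_1,\dots,x_n]$ and the polynomials $\overline{F}_a$, $\overline{\mathfrak{F}}_a$, $\overline{\mathfrak{P}}_a$ be as defined in the context. (1) For every strong composition $a=a_1\dots a_\ell$ of length $\ell\le n$, with $x^a=x_1^{a_1}\cdots x_\ell^{a_\ell}$ and $w_0$ the longest permutation in $\mathfrak{S}_n$, $$\overline{\widetilde{\pi}}_{w_0}(x^a)=\overline{F}_a(x_1,\dots,x_n).$$ (2) For every weak composition $a=a_1\dots a_n$ of length $n$, with $w_a\in\mathfrak{S}_n$ the minimal length permutation turning $a$ into $\mathrm{flat}(a)$ (padded on the right with zeros to length $n$), $$\overline{\widetilde{\pi}}_{w_a^{-1}}(x^{\mathrm{flat}(a)})=\overline{\mathfrak{F}}_a(x_1,\dots,x_n).$$ (3) For every weak composition $a=a_1\dots a_n$ of length $n$, with $w_a$ as in (2), $$\overline{\widetilde{\theta}}_{w_a^{-1}}(x^{\mathrm{flat}(a)})=\overline{\mathfrak{P}}_a(x_1,\dots,x_n).$$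
   Context: **Operators.** Work in $\mathbb{Z}[\beta][x_1,\dots,x_n]$, with all operators $\mathbb{Z}[\beta]$-linear. For $1\le i\le n-1$, let $s_i$ swap the variables $x_i$ and $x_{i+1}$, and let $\widetilde{s}_i$ be the linear operator given on monomials $x^a=x_1^{a_1}\cdots x_n^{a_n}$ by $\widetilde{s}_i(x^a)=s_i(x^a)$ if $a_i=0$ or $a_{i+1}=0$, and $\widetilde{s}_i(x^a)=x^a$ otherwise. Define $$\overline{\widetilde{\pi}}_i(f)=\frac{x_i f-x_{i+1}\widetilde{s}_i(f)+\beta x_ix_{i+1}(f-\widetilde{s}_i(f))}{x_i-x_{i+1}},\qquad \overline{\widetilde{\theta}}_i(f)=\overline{\widetilde{\pi}}_i(f)-f=x_{i+1}(1+\beta x_i)\frac{f-\widetilde{s}_i(f)}{x_i-x_{i+1}}.$$ These map polynomials to polynomials. For $w\in\mathfrak{S}_n$ with reduced word $w=\sigma_{i_1}\cdots\sigma_{i_r}$, where $\sigma_i=(i\ \,i+1)$, set $\overline{\widetilde{\pi}}_w=\overline{\widetilde{\pi}}_{i_1}\cdots\overline{\widetilde{\pi}}_{i_r}$ and $\overline{\widetilde{\theta}}_w=\overline{\widetilde{\theta}}_{i_1}\cdots\overline{\widetilde{\theta}}_{i_r}$ (compositions of operators, rightmost applied first). These are independent of the choice of reduced word, because the $\overline{\widetilde{\pi}}_i$ and the $\overline{\widetilde{\theta}}_i$ satisfy the braid and commutation relations. **Compositions.** A strong composition is a finite sequence of positive integers. A weak composition is a finite sequence of nonnegative integers. For a strong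 composition $a=a_1\dots a_\ell$, $|a|=a_1+\dots+a_\ell$ and $\mathrm{set}(a)=\{a_1,a_1+a_2,\dots,a_1+\dots+a_{\ell-1}\}$. For a weak composition $a$, $\mathrm{flat}(a)$ is the strong composition obtained by deleting all zeros from $a$. $x^b=x_1^{b_1}x_2^{b_2}\cdots$ for any composition $b$. Permutations act on sequences of length $n$ on the left, with $\sigma_i$ swapping the entries in positions $i$ and $i+1$; so $(wa)_{w(j)}=a_j$. Thus $w_a$ is the (unique) shortest $w\in\mathfrak{S}_n$ such that $wa$ is $\mathrm{flat}(a)$ followed by zeros. For example, for $a=012$, $w_a=\sigma_2\sigma_1$ and $w_a^{-1}=\sigma_1\sigma_2$. **Multifundamental $\overline{F}_a$.** For nonempty finite sets $S,T$ of integers, $S\le T$ means $\max S\le\min T$, and $S<T$ means $\max S<\min T$. For a strong composition $a$, $$\overline{F}_a(x_1,\dots,x_n)=\sum \beta^{|S_1|+\dots+|S_{|a|}|-|a|}\prod_{i=1}^{|a|}\prod_{j\in S_i}x_j,$$ summed over all sequences of nonempty subsets $S_1\le S_2\le\dots\le S_{|a|}$ of $\{1,\dots,n\}$ with $S_b<S_{b+1}$ for all $b\in\mathrm{set}(a)$. **Fundamental glide $\overline{\mathfrak{F}}_a$.** A weak komposition is a weak composition each of whose nonzero entries is colored black or red; its excess $\mathrm{ex}(b)$ is the number of red entries. Let $a=a_1\dots a_n$ be a weak composition with nonzero entries exactly at positions $n_1<\dots<n_\ell$. A weak komposition $b=b_1\dots b_n$ is a glide of $a$ if there are integers $0=i_0<i_1<\dots<i_\ell$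 such that $b_m=0$ for all $m>i_\ell$ and, for each $1\le j\le\ell$, the $j$th block $b_{i_{j-1}+1},\dots,b_{i_j}$ satisfies: (i) its first nonzero entry is black; (ii) the sum of its entries minus its number of red entries equals $a_{n_j}$; (iii) $i_j\le n_j$. Then $\overline{\mathfrak{F}}_a(x_1,\dots,x_n)=\sum_{b}\beta^{\mathrm{ex}(b)}x^b$, summed over all glides $b$ of $a$ (each colored sequence $b$ counted once). **Kaon $\overline{\mathfrak{P}}_a$.** A glide $b$ of $a$ is mesonic if the blocks can be chosen with $i_j=n_j$ for all $j$ and $b_{n_j}\ne 0$ for all $j$. Then $\overline{\mathfrak{P}}_a(x_1,\dots,x_n)=\sum_b\beta^{\mathrm{ex}(b)}x^b$, summed over all mesonic glides $b$ of $a$. *)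

theory Defs
  imports
    "HOL-Library.Poly_Mapping"
    "HOL-Computational_Algebra.Polynomial"
    "HOL-Combinatorics.Permutations"
begin

section \<open>The ring and the operators\<close>

text \<open>
  The coefficient ring \<open>\<int>[\<beta>]\<close> is \<^typ>\<open>int poly\<close>; a monomial is its finitely supported exponent
  function.  The variables are all \<open>x\<^sub>i\<close> with \<open>i\<close> a natural number; the ring
  \<open>\<int>[\<beta>][x\<^sub>1, \<dots>, x\<^sub>n]\<close> is the subring of polynomials involving only \<open>x\<^sub>1, \<dots>, x\<^sub>n\<close>, and it is
  preserved by the operators with index \<open>1 \<le> i < n\<close> below.
\<close>

type_synonym monomial = "nat \<Rightarrow>\<^sub>0 nat"
type_synonym mpol = "monomial \<Rightarrow>\<^sub>0 int poly"

definition beta :: mpol where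
  "beta = Poly_Mapping.single 0 [:0, 1:]"

definition X :: "nat \<Rightarrow> mpol" where
  "X i = Poly_Mapping.single (Poly_Mapping.single i 1) 1"

definition swap_mon :: "nat \<Rightarrow> monomial \<Rightarrow> monomial" where
  "swap_mon i m = Poly_Mapping.map_key (transpose i (Suc i)) m"

definition tswap_mon :: "nat \<Rightarrow> monomial \<Rightarrow> monomial" where
  "tswap_mon i m =
     (if Poly_Mapping.lookup m i = 0 \<or> Poly_Mapping.lookup m (Suc i) = 0 then swap_mon i m else m)"

definition tswap :: "nat \<Rightarrow> mpol \<Rightarrow> mpol" where
  "tswap i f = (\<Sum>m\<in>Poly_Mapping.keys f. Poly_Mapping.single (tswap_mon i m) (Poly_Mapping.lookup f m))"

text \<open>
  The quotient of \<open>p\<close> by \<open>q\<close> when \<open>q\<close> is nonzero and divides \<open>p\<close>; it is unique, since the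
  polynomials form an integral domain.  Divisibility in the case at hand is the lemma
  \<open>diff_X_dvd_tpi_numerator\<close> below.
\<close>

definition exact_quot :: "mpol \<Rightarrow> mpol \<Rightarrow> mpol" where
  "exact_quot p q = (THE g. q * g = p)"

definition tpi :: "nat \<Rightarrow> mpol \<Rightarrow> mpol" where
  "tpi i f = exact_quot
     (X i * f - X (Suc i) * tswap i f + beta * X i * X (Suc i) * (f - tswap i f))
     (X i - X (Suc i))"

definition ttheta :: "nat \<Rightarrow> mpol \<Rightarrow> mpol" where
  "ttheta i f = tpi i f - f"


section \<open>Permutations and reduced words\<close>

text \<open>
  Elements of \<open>S\<^sub>n\<close> are functions \<^term>\<open>w :: nat \<Rightarrow> nat\<close> with \<^prop>\<open>w permutes {1..n}\<close>.
  A word \<open>[i\<^sub>1, \<dots>, i\<^sub>r]\<close> stands for \<open>\<sigma>\<^bsub>i\<^sub>1\<^esub> \<cdots> \<sigma>\<^bsub>i\<^sub>r\<^esub>\<close>.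
\<close>

definition word_perm :: "nat list \<Rightarrow> nat \<Rightarrow> nat" where
  "word_perm is = foldr (\<lambda>i w. transpose i (Suc i) \<circ> w) is id"

definition is_word_of :: "nat \<Rightarrow> (nat \<Rightarrow> nat) \<Rightarrow> nat list \<Rightarrow> bool" where
  "is_word_of n w is \<longleftrightarrow> set is \<subseteq> {1..<n} \<and> word_perm is = w"

definition perm_length :: "nat \<Rightarrow> (nat \<Rightarrow> nat) \<Rightarrow> nat" where
  "perm_length n w = (LEAST k. \<exists>is. is_word_of n w is \<and> length is = k)"

definition reduced_word :: "nat \<Rightarrow> (nat \<Rightarrow> nat) \<Rightarrow> nat list \<Rightarrow> bool" where
  "reduced_word n w is \<longleftrightarrow> is_word_of n w is \<and> length is = perm_length n w"

text \<open>
  The operators attached to a permutation.  By the braid and commutation relations the result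
  does not depend on the reduced word chosen.
\<close>

definition op_perm :: "(nat \<Rightarrow> mpol \<Rightarrow> mpol) \<Rightarrow> nat \<Rightarrow> (nat \<Rightarrow> nat) \<Rightarrow> mpol \<Rightarrow> mpol" where
  "op_perm T n w = foldr T (SOME is. reduced_word n w is)"

definition tpi_perm :: "nat \<Rightarrow> (nat \<Rightarrow> nat) \<Rightarrow> mpol \<Rightarrow> mpol" where
  "tpi_perm = op_perm tpi"

definition ttheta_perm :: "nat \<Rightarrow> (nat \<Rightarrow> nat) \<Rightarrow> mpol \<Rightarrow> mpol" where
  "ttheta_perm = op_perm ttheta"

definition longest_perm :: "nat \<Rightarrow> nat \<Rightarrow> nat" where
  "longest_perm n = arg_max (perm_length n) (\<lambda>w. w permutes {1..n})"


section \<open>Compositions\<close>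

text \<open>
  A weak composition is a \<^typ>\<open>nat list\<close>.  Entries are numbered from 1.
\<close>

definition entry :: "nat list \<Rightarrow> nat \<Rightarrow> nat" where
  "entry a i = a ! (i - 1)"

definition strong_composition :: "nat list \<Rightarrow> bool" where
  "strong_composition a \<longleftrightarrow> (\<forall>k\<in>set a. k > 0)"

definition comp_set :: "nat list \<Rightarrow> nat set" where
  "comp_set a = {sum_list (take k a) | k. 1 \<le> k \<and> k < length a}"

definition flat :: "nat list \<Rightarrow> nat list" where
  "flat a = filter (\<lambda>k. k \<noteq> 0) a"

definition xpow :: "nat list \<Rightarrow> mpol" where
  "xpow b = (\<Prod>i = 1..length b. X i ^ entry b i)"

text \<open>The left action, \<open>(w a)\<^bsub>w(j)\<^esub> = a\<^sub>j\<close>.\<close>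

definition perm_act :: "(nat \<Rightarrow> nat) \<Rightarrow> nat list \<Rightarrow> nat list" where
  "perm_act w a = map (\<lambda>i. entry a (inv w i)) [1..<Suc (length a)]"

text \<open>The permutation \<open>w\<^sub>a\<close>.\<close>

definition flat_perm :: "nat list \<Rightarrow> nat \<Rightarrow> nat" where
  "flat_perm a = arg_min (perm_length (length a))
     (\<lambda>w. w permutes {1..length a} \<and>
          perm_act w a = flat a @ replicate (length a - length (flat a)) 0)"


section \<open>Multifundamental polynomials\<close>

definition multifund_seqs :: "nat list \<Rightarrow> nat \<Rightarrow> nat set list set" where
  "multifund_seqs a n =
     {S. length S = sum_list a \<and>
         (\<forall>T\<in>set S. T \<noteq> {} \<and> T \<subseteq> {1..n}) \<and>
         (\<forall>b\<in>{1..<sum_list a}. Max (S ! (b - 1)) \<le> Min (S ! b)) \<and>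
         (\<forall>b\<in>comp_set a. Max (S ! (b - 1)) < Min (S ! b))}"

definition multifund :: "nat list \<Rightarrow> nat \<Rightarrow> mpol" where
  "multifund a n =
     (\<Sum>S\<in>multifund_seqs a n.
        beta ^ ((\<Sum>i<sum_list a. card (S ! i)) - sum_list a) *
        (\<Prod>i<sum_list a. \<Prod>j\<in>S ! i. X j))"


section \<open>Fundamental glides and kaons\<close>

text \<open>
  A weak komposition is a pair \<open>(b, R)\<close> of a weak composition and the set of positions of its
  red entries, all other nonzero entries being black.  Zero entries carry no colour.
\<close>

definition weak_komposition :: "nat list \<times> nat set \<Rightarrow> bool" where
  "weak_komposition = (\<lambda>(b, R). R \<subseteq> {i\<in>{1..length b}. entry b i \<noteq> 0})"

definition excess :: "nat list \<times> nat set \<Rightarrow> nat" where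
  "excess = (\<lambda>(b, R). card R)"

text \<open>The list \<open>[n\<^sub>1, \<dots>, n\<^sub>\<ell>]\<close> of the positions of the nonzero entries, in increasing order;
  thus \<open>n\<^sub>j\<close> is \<^term>\<open>entry (nzpos a) j\<close>.\<close>

definition nzpos :: "nat list \<Rightarrow> nat list" where
  "nzpos a = filter (\<lambda>i. entry a i \<noteq> 0) [1..<Suc (length a)]"

text \<open>\<open>I j\<close> is the last position \<open>i\<^sub>j\<close> of the \<open>j\<close>th block.\<close>

definition glide_blocks :: "nat list \<Rightarrow> nat list \<times> nat set \<Rightarrow> (nat \<Rightarrow> nat) \<Rightarrow> bool" where
  "glide_blocks a = (\<lambda>(b, R) I.
     (let l = length (nzpos a) in
        I 0 = 0 \<and>
        (\<forall>j\<in>{1..l}. I (j - 1) < I j) \<and>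
        (\<forall>m. I l < m \<and> m \<le> length b \<longrightarrow> entry b m = 0) \<and>
        (\<forall>j\<in>{1..l}.
           (let B = {I (j - 1)<..I j}; nj = entry (nzpos a) j in
              (\<exists>m\<in>B. entry b m \<noteq> 0 \<and> (\<forall>k\<in>B. k < m \<longrightarrow> entry b k = 0) \<and> m \<notin> R) \<and>
              int (\<Sum>m\<in>B. entry b m) - int (card (R \<inter> B)) = int (entry a nj) \<and>
              I j \<le> nj))))"

definition glides :: "nat list \<Rightarrow> (nat list \<times> nat set) set" where
  "glides a = {c. length (fst c) = length a \<and> weak_komposition c \<and> (\<exists>I. glide_blocks a c I)}"

definition mesonic_glides :: "nat list \<Rightarrow> (nat list \<times> nat set) set" where
  "mesonic_glides a =
     {c. length (fst c) = length a \<and> weak_komposition c \<and>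
         (\<exists>I. glide_blocks a c I \<and>
              (\<forall>j\<in>{1..length (nzpos a)}.
                 I j = entry (nzpos a) j \<and> entry (fst c) (entry (nzpos a) j) \<noteq> 0))}"

definition fund_glide :: "nat list \<Rightarrow> mpol" where
  "fund_glide a = (\<Sum>c\<in>glides a. beta ^ excess c * xpow (fst c))"

definition kaon :: "nat list \<Rightarrow> mpol" where
  "kaon a = (\<Sum>c\<in>mesonic_glides a. beta ^ excess c * xpow (fst c))"


section \<open>Well-definedness of the operators\<close>

lemma X_neq: "X i - X (Suc i) \<noteq> 0"
proof
  assume "X i - X (Suc i) = 0"
  then have "Poly_Mapping.lookup (X i) (Poly_Mapping.single i 1) = Poly_Mapping.lookup (X (Suc i)) (Poly_Mapping.single i 1)"
    by simp
  moreover have "Poly_Mapping.single (Suc i) (1::nat) \<noteq> Poly_Mapping.single i 1"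
  proof
    assume "Poly_Mapping.single (Suc i) (1::nat) = Poly_Mapping.single i 1"
    then have "Poly_Mapping.lookup (Poly_Mapping.single (Suc i) (1::nat)) i = Poly_Mapping.lookup (Poly_Mapping.single i 1) i"
      by simp
    then show False by (simp add: lookup_single when_def)
  qed
  ultimately show False
    by (simp add: X_def lookup_single when_def)
qed

lemma X_power: "X i ^ k = Poly_Mapping.single (Poly_Mapping.single i k) 1"
  by (induction k) (simp_all add: X_def mult_single single_add [symmetric])

lemma diff_X_dvd_mon:
  "X i - X (Suc i) dvd Poly_Mapping.single m c - Poly_Mapping.single (tswap_mon i m) c"
proof (cases "Poly_Mapping.lookup m i = 0 \<or> Poly_Mapping.lookup m (Suc i) = 0")
  case False
  then show ?thesis by (simp add: tswap_mon_def)
next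
  case True
  define p q where "p = Poly_Mapping.lookup m i" and "q = Poly_Mapping.lookup m (Suc i)"
  define r where "r = m - Poly_Mapping.single i p - Poly_Mapping.single (Suc i) q"
  have m: "m = r + Poly_Mapping.single i p + Poly_Mapping.single (Suc i) q"
    by (rule poly_mapping_eqI)
       (simp add: r_def lookup_add lookup_minus lookup_single when_def p_def q_def)
  have s: "swap_mon i m = r + Poly_Mapping.single i q + Poly_Mapping.single (Suc i) p"
    by (rule poly_mapping_eqI)
       (auto simp: r_def swap_mon_def map_key.rep_eq lookup_add lookup_minus lookup_single
          when_def p_def q_def transpose_def)
  have e1: "Poly_Mapping.single m c = Poly_Mapping.single r c * (X i ^ p * X (Suc i) ^ q)"
    by (simp add: m X_power mult_single add.assoc)
  have e2: "Poly_Mapping.single (tswap_mon i m) c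
      = Poly_Mapping.single r c * (X i ^ q * X (Suc i) ^ p)"
    using True by (simp add: tswap_mon_def s X_power mult_single add.assoc)
  have d: "X i - X (Suc i) dvd X i ^ k - X (Suc i) ^ k" for k
    by (metis dvd_triv_left power_diff_sumr2)
  have "X i - X (Suc i) dvd X i ^ p * X (Suc i) ^ q - X i ^ q * X (Suc i) ^ p"
  proof (cases "p = 0")
    case True
    have "X i - X (Suc i) dvd - (X i ^ q - X (Suc i) ^ q)"
      using d dvd_minus_iff by blast
    then show ?thesis using True by simp
  next
    case False
    then have "q = 0" using True by (simp add: p_def q_def)
    then show ?thesis using d by simp
  qed
  then have "X i - X (Suc i) dvd
      Poly_Mapping.single r c * (X i ^ p * X (Suc i) ^ q - X i ^ q * X (Suc i) ^ p)"
    by (rule dvd_mult)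
  then show ?thesis by (simp add: e1 e2 right_diff_distrib)
qed

lemma sum_monomials: "f = (\<Sum>m\<in>Poly_Mapping.keys f. Poly_Mapping.single m (Poly_Mapping.lookup f m))"
  for f :: mpol
proof (rule poly_mapping_eqI)
  fix k
  have "(\<Sum>m\<in>Poly_Mapping.keys f. Poly_Mapping.lookup (Poly_Mapping.single m (Poly_Mapping.lookup f m)) k)
      = (\<Sum>m\<in>Poly_Mapping.keys f. if m = k then Poly_Mapping.lookup f k else 0)"
    by (rule sum.cong) (auto simp: lookup_single when_def)
  also have "\<dots> = Poly_Mapping.lookup f k"
    by (simp add: in_keys_iff)
  finally show "Poly_Mapping.lookup f k
      = Poly_Mapping.lookup (\<Sum>m\<in>Poly_Mapping.keys f. Poly_Mapping.single m (Poly_Mapping.lookup f m)) k"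
    by (simp add: lookup_sum)
qed

lemma diff_X_dvd_tswap: "X i - X (Suc i) dvd f - tswap i f"
proof -
  have "f - tswap i f = (\<Sum>m\<in>Poly_Mapping.keys f.
      Poly_Mapping.single m (Poly_Mapping.lookup f m) - Poly_Mapping.single (tswap_mon i m) (Poly_Mapping.lookup f m))"
    by (subst (1) sum_monomials [of f]) (simp add: tswap_def sum_subtractf)
  then show ?thesis by (simp add: dvd_sum diff_X_dvd_mon)
qed

lemma diff_X_dvd_tpi_numerator:
  "X i - X (Suc i) dvd
     X i * f - X (Suc i) * tswap i f + beta * X i * X (Suc i) * (f - tswap i f)"
proof -
  have "X i * f - X (Suc i) * tswap i f + beta * X i * X (Suc i) * (f - tswap i f)
      = (X i - X (Suc i)) * f + X (Suc i) * (1 + beta * X i) * (f - tswap i f)"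
    by (simp add: algebra_simps)
  then show ?thesis
    using diff_X_dvd_tswap by (simp add: dvd_add)
qed

lemma exact_quot_mult: "q \<noteq> 0 \<Longrightarrow> q dvd p \<Longrightarrow> q * exact_quot p q = p"
  unfolding exact_quot_def by (rule theI') (metis dvdE mult_left_cancel)

lemma tpi_mult:
  "(X i - X (Suc i)) * tpi i f =
     X i * f - X (Suc i) * tswap i f + beta * X i * X (Suc i) * (f - tswap i f)"
  unfolding tpi_def by (rule exact_quot_mult [OF X_neq diff_X_dvd_tpi_numerator])

lemma ttheta_eq:
  "ttheta i f = X (Suc i) * (1 + beta * X i) * exact_quot (f - tswap i f) (X i - X (Suc i))"
proof -
  have "(X i - X (Suc i)) * ttheta i f = X (Suc i) * (1 + beta * X i) * (f - tswap i f)"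
    by (simp add: ttheta_def right_diff_distrib tpi_mult) (simp add: algebra_simps)
  also have "\<dots> = X (Suc i) * (1 + beta * X i)
      * ((X i - X (Suc i)) * exact_quot (f - tswap i f) (X i - X (Suc i)))"
    by (simp add: exact_quot_mult [OF X_neq diff_X_dvd_tswap])
  finally have "(X i - X (Suc i)) * ttheta i f = (X i - X (Suc i)) *
      (X (Suc i) * (1 + beta * X i) * exact_quot (f - tswap i f) (X i - X (Suc i)))"
    by (simp only: ac_simps)
  then show ?thesis using X_neq by simp
qed


section \<open>Finiteness of the index sets\<close>

lemma finite_multifund_seqs: "finite (multifund_seqs a n)"
proof (rule finite_subset)
  show "multifund_seqs a n \<subseteq> {S. set S \<subseteq> Pow {1..n} \<and> length S = sum_list a}"
    by (auto simp: multifund_seqs_def)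
  show "finite {S. set S \<subseteq> Pow {1..n} \<and> length S = sum_list a}"
    by (rule finite_lists_length_eq) simp
qed

lemma glide_blocks_entry_le:
  assumes g: "glide_blocks a (b, R) I" and m: "1 \<le> m" "m \<le> length b"
    and R: "R \<subseteq> {1..length b}"
  shows "entry b m \<le> sum_list a + length b"
proof (cases "I (length (nzpos a)) < m")
  case True
  then show ?thesis using g m by (simp add: glide_blocks_def Let_def)
next
  case False
  let ?l = "length (nzpos a)"
  have I0: "I 0 = 0" using g by (simp add: glide_blocks_def Let_def)
  define j where "j = (LEAST j. m \<le> I j)"
  have ml: "m \<le> I ?l" using False by simp
  have mj: "m \<le> I j" unfolding j_def by (rule LeastI [of "\<lambda>j. m \<le> I j", OF ml])
  have jl: "j \<le> ?l" unfolding j_def by (rule Least_le [of "\<lambda>j. m \<le> I j", OF ml])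
  have j1: "1 \<le> j" using mj m I0 by (cases j) auto
  have "\<not> m \<le> I (j - 1)"
    using not_less_Least [of "j - 1" "\<lambda>j. m \<le> I j"] j1 unfolding j_def by fastforce
  then have mB: "m \<in> {I (j - 1)<..I j}" using mj by simp
  define B where "B = {I (j - 1)<..I j}"
  have sum: "int (\<Sum>m\<in>B. entry b m) - int (card (R \<inter> B))
      = int (entry a (entry (nzpos a) j))"
    using g j1 jl by (simp add: glide_blocks_def Let_def B_def)
  have "entry b m \<le> (\<Sum>m\<in>B. entry b m)"
    using mB by (intro member_le_sum) (auto simp: B_def)
  moreover have "card (R \<inter> B) \<le> length b"
  proof -
    have "card (R \<inter> B) \<le> card {1..length b}" using R by (intro card_mono) auto
    then show ?thesis by simp
  qed
  moreover have "entry a (entry (nzpos a) j) \<le> sum_list a"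
  proof -
    have "nzpos a ! (j - 1) \<in> set (nzpos a)" using j1 jl by (intro nth_mem) simp
    moreover have "set (nzpos a) \<subseteq> {1..length a}" by (auto simp: nzpos_def)
    ultimately have "nzpos a ! (j - 1) \<in> {1..length a}" by blast
    then have "entry (nzpos a) j - 1 < length a"
      unfolding entry_def [of "nzpos a"] atLeastAtMost_iff by linarith
    then have "a ! (entry (nzpos a) j - 1) \<in> set a" by (rule nth_mem)
    then show ?thesis unfolding entry_def [of a] by (rule member_le_sum_list) simp
  qed
  ultimately show ?thesis using sum by linarith
qed

lemma finite_glides: "finite (glides a)"
proof (rule finite_subset)
  let ?U = "{b. set b \<subseteq> {0..sum_list a + length a} \<and> length b = length a} \<times> Pow {1..length a}"
  show "glides a \<subseteq> ?U"
  proof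
    fix c assume c: "c \<in> glides a"
    obtain b R where bR: "c = (b, R)" by (cases c)
    have len: "length b = length a" and "weak_komposition (b, R)"
      and "\<exists>I. glide_blocks a (b, R) I"
      using c by (simp_all add: glides_def bR)
    then obtain I where I: "glide_blocks a (b, R) I" by blast
    have R: "R \<subseteq> {1..length b}"
      using \<open>weak_komposition (b, R)\<close> by (auto simp: weak_komposition_def)
    have "k \<le> sum_list a + length a" if k: "k \<in> set b" for k
    proof -
      obtain i where i: "i < length b" "k = b ! i" using k by (auto simp: in_set_conv_nth)
      then show ?thesis
        using glide_blocks_entry_le [OF I, of "Suc i"] R len by (simp add: entry_def)
    qed
    then show "c \<in> ?U" using len R by (auto simp: bR)
  qed
  show "finite ?U"
    by (intro finite_cartesian_product finite_lists_length_eq) auto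
qed

lemma finite_mesonic_glides: "finite (mesonic_glides a)"
  by (rule finite_subset [OF _ finite_glides [of a]]) (auto simp: mesonic_glides_def glides_def)

end

theory Submission
  imports Defs
begin

text \<open>
  Read a weak komposition from left to right and let its state after position \<open>m\<close> be the sum of the
  entries so far minus the number of red ones.  A colored sequence is a glide of \<open>a\<close> iff each of its
  nonzero entries changes the state without crossing a partial sum of \<open>flat a\<close> (and is black when a
  block is opened) and lands in a block that may still be used at that position.  These
  conditions are local, so glides, kaons and multifundamental sequences are all generating functions
  of paths, that is, products of one transfer matrix per variable; the positions of the nonzero
  entries of \<open>a\<close> enter only through the condition on where a nonzero entry may land.

  The operators with index \<open>i\<close> see only the two consecutive matrices for \<open>x\<^sub>i\<close> and \<open>x\<^bsub>i+1\<^esub>\<close>.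
  Since the operator \<open>\<theta>\<^sub>i\<close> kills \<open>x\<^sub>i\<^sup>p x\<^bsub>i+1\<^esub>\<^sup>q\<close> for \<open>p, q > 0\<close>
  and changes sign under exchanging \<open>x\<^sub>i\<^sup>k\<close> and \<open>x\<^bsub>i+1\<^esub>\<^sup>k\<close>, everything reduces to its value on the
  weight of a single step.  Thus \<open>\<pi>\<^sub>i\<close> moves a nonzero entry of \<open>a\<close> from \<open>i\<close> to an empty position
  \<open>i+1\<close> and fixes the polynomial if both or neither of the positions are occupied.

  No braid relation is needed.  For a set \<open>D\<close> of pairs \<open>p < q\<close>, prefixing a letter to a word
  adds at most one inversion in \<open>D\<close>, and if it does add one then the pair in question lies in \<open>D\<close>.
  Any reduced word of \<open>w\<^sub>0\<close> has as many letters as there are pairs, and any reduced word of \<open>w\<^sub>a\<^sup>-\<^sup>1\<close> as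
  many as there are inversions between nonzero and zero entries, so the effect of every letter is known.
\<close>

section \<open>The operators on monomials\<close>

lemma tswap_superset:
  assumes "finite K" "Poly_Mapping.keys f \<subseteq> K"
  shows "tswap i f = (\<Sum>m\<in>K. Poly_Mapping.single (tswap_mon i m) (Poly_Mapping.lookup f m))"
  unfolding tswap_def
  by (rule sum.mono_neutral_left) (use assms in \<open>auto simp: in_keys_iff\<close>)

lemma tswap_single [simp]: "tswap i (Poly_Mapping.single m c) = Poly_Mapping.single (tswap_mon i m) c"
  by (subst tswap_superset [where K = "{m}"]) auto

lemma tswap_0 [simp]: "tswap i 0 = 0"
  by (simp add: tswap_def)

text \<open>The three defining sums run over different supports; all are extended to the union of
  the supports of the summands, where the added coefficients are zero.\<close>

lemma tswap_add: "tswap i (f + g) = tswap i f + tswap i g"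
proof -
  let ?K = "Poly_Mapping.keys f \<union> Poly_Mapping.keys g"
  have "tswap i h = (\<Sum>m\<in>?K. Poly_Mapping.single (tswap_mon i m) (Poly_Mapping.lookup h m))"
    if "Poly_Mapping.keys h \<subseteq> ?K" for h
    by (rule tswap_superset [OF _ that]) simp
  from this [of f] this [of g] this [of "f + g"] show ?thesis
    using Poly_Mapping.keys_add [of f g] by (simp add: lookup_add single_add sum.distrib)
qed

lemma tswap_sum: "tswap i (\<Sum>a\<in>A. f a) = (\<Sum>a\<in>A. tswap i (f a))"
  by (induction A rule: infinite_finite_induct) (simp_all add: tswap_add)

text \<open>A stand-in for being free of x_i and x_{i+1}. In this form it passes to sums and
  products at once, and it is exactly what moving a factor out of theta_i requires.\<close>

definition tindep :: "nat \<Rightarrow> mpol \<Rightarrow> bool" where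
  "tindep i g \<longleftrightarrow> (\<forall>f. tswap i (g * f) = g * tswap i f)"

lemma tindep_0 [simp]: "tindep i 0" and tindep_1 [simp]: "tindep i 1"
  by (simp_all add: tindep_def)

lemma tindep_add: "tindep i f \<Longrightarrow> tindep i g \<Longrightarrow> tindep i (f + g)"
  by (simp add: tindep_def distrib_right tswap_add)

lemma tindep_mult: "tindep i f \<Longrightarrow> tindep i g \<Longrightarrow> tindep i (f * g)"
  by (simp add: tindep_def mult.assoc)

lemma tindep_power: "tindep i f \<Longrightarrow> tindep i (f ^ k)"
  by (induction k) (simp_all add: tindep_mult)

lemma tindep_sum: "(\<And>a. a \<in> A \<Longrightarrow> tindep i (f a)) \<Longrightarrow> tindep i (\<Sum>a\<in>A. f a)"
  by (induction A rule: infinite_finite_induct) (simp_all add: tindep_add)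

lemma tswap_mon_add:
  assumes "Poly_Mapping.lookup q i = 0" "Poly_Mapping.lookup q (Suc i) = 0"
  shows "tswap_mon i (q + m) = q + tswap_mon i m"
proof -
  have "swap_mon i (q + m) = q + swap_mon i m"
    by (rule poly_mapping_eqI)
      (use assms in \<open>auto simp: swap_mon_def map_key.rep_eq lookup_add transpose_def\<close>)
  then show ?thesis
    using assms by (simp add: tswap_mon_def lookup_add)
qed

lemma tindep_single:
  assumes "Poly_Mapping.lookup q i = 0" "Poly_Mapping.lookup q (Suc i) = 0"
  shows "tindep i (Poly_Mapping.single q c)"
  unfolding tindep_def
proof
  fix f :: mpol
  let ?S = "\<lambda>m. Poly_Mapping.single m (Poly_Mapping.lookup f m)"
  have "tswap i (Poly_Mapping.single q c * (\<Sum>m\<in>Poly_Mapping.keys f. ?S m))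
      = Poly_Mapping.single q c * tswap i (\<Sum>m\<in>Poly_Mapping.keys f. ?S m)"
    by (simp add: sum_distrib_left tswap_sum mult_single tswap_mon_add assms)
  then show "tswap i (Poly_Mapping.single q c * f) = Poly_Mapping.single q c * tswap i f"
    by (simp flip: sum_monomials)
qed

lemma tindep_beta: "tindep i beta"
  unfolding beta_def by (rule tindep_single) simp_all

lemma tindep_X: "j \<noteq> i \<Longrightarrow> j \<noteq> Suc i \<Longrightarrow> tindep i (X j)"
  unfolding X_def by (rule tindep_single) (simp_all add: lookup_single when_def)

section \<open>Pure and mixed powers of two neighboring variables\<close>

lemma X_power_mult:
  "X i ^ p * X j ^ q = Poly_Mapping.single (Poly_Mapping.single i p + Poly_Mapping.single j q) 1"
  by (simp add: X_power mult_single)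

lemma swap_mon_two:
  "swap_mon i (Poly_Mapping.single i p + Poly_Mapping.single (Suc i) q)
    = Poly_Mapping.single i q + Poly_Mapping.single (Suc i) p"
  by (rule poly_mapping_eqI)
    (auto simp: swap_mon_def map_key.rep_eq lookup_add lookup_single when_def transpose_def)

lemma tswap_X_power_mult:
  "tswap i (X i ^ p * X (Suc i) ^ q)
    = (if p = 0 \<or> q = 0 then X i ^ q * X (Suc i) ^ p else X i ^ p * X (Suc i) ^ q)"
  unfolding X_power_mult tswap_single tswap_mon_def swap_mon_two
  by (simp add: lookup_add lookup_single when_def)

lemma ttheta_mult:
  "(X i - X (Suc i)) * ttheta i f = X (Suc i) * (1 + beta * X i) * (f - tswap i f)"
  by (simp add: ttheta_def right_diff_distrib tpi_mult) (simp add: algebra_simps)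

text \<open>The ring is an integral domain, so a candidate value is checked after multiplying by x_i
  - x_{i+1}, and no quotient has to be computed.\<close>

lemma ttheta_eqI:
  assumes "(X i - X (Suc i)) * g = X (Suc i) * (1 + beta * X i) * (f - tswap i f)"
  shows "ttheta i f = g"
  using assms X_neq [of i] by (simp flip: ttheta_mult)

lemma ttheta_0 [simp]: "ttheta i 0 = 0"
  by (rule ttheta_eqI) simp

lemma ttheta_add: "ttheta i (f + g) = ttheta i f + ttheta i g"
  by (rule ttheta_eqI) (simp add: distrib_left ttheta_mult tswap_add, simp add: algebra_simps)

lemma ttheta_sum: "ttheta i (\<Sum>a\<in>A. f a) = (\<Sum>a\<in>A. ttheta i (f a))"
  by (induction A rule: infinite_finite_induct) (simp_all add: ttheta_add)

lemma ttheta_indep_mult: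
  assumes "tindep i g" shows "ttheta i (g * f) = g * ttheta i f"
proof (rule ttheta_eqI)
  have "tswap i (g * f) = g * tswap i f" using assms by (simp add: tindep_def)
  then have "(X i - X (Suc i)) * (g * ttheta i f) = g * ((X i - X (Suc i)) * ttheta i f)"
    "X (Suc i) * (1 + beta * X i) * (g * f - tswap i (g * f)) =
     g * (X (Suc i) * (1 + beta * X i) * (f - tswap i f))"
    by (simp_all add: algebra_simps)
  then show "(X i - X (Suc i)) * (g * ttheta i f)
      = X (Suc i) * (1 + beta * X i) * (g * f - tswap i (g * f))"
    by (simp only: ttheta_mult)
qed

lemma ttheta_indep: "tindep i g \<Longrightarrow> ttheta i g = 0"
proof -
  assume g: "tindep i g"
  have "ttheta i 1 = 0"
    using tswap_X_power_mult [of i 0 0] by (intro ttheta_eqI) simp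
  then show ?thesis using ttheta_indep_mult [OF g, of 1] by simp
qed

lemma ttheta_mixed: "p > 0 \<Longrightarrow> q > 0 \<Longrightarrow> ttheta i (X i ^ p * X (Suc i) ^ q) = 0"
  by (rule ttheta_eqI) (simp add: tswap_X_power_mult)

lemma ttheta_X_power:
  "ttheta i (X i ^ k) = X (Suc i) * (1 + beta * X i) * (\<Sum>r<k. X i ^ r * X (Suc i) ^ (k - Suc r))"
proof (rule ttheta_eqI)
  have "tswap i (X i ^ k) = X (Suc i) ^ k" using tswap_X_power_mult [of i k 0] by simp
  then show "(X i - X (Suc i)) * (X (Suc i) * (1 + beta * X i)
        * (\<Sum>r<k. X i ^ r * X (Suc i) ^ (k - Suc r)))
      = X (Suc i) * (1 + beta * X i) * (X i ^ k - tswap i (X i ^ k))"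
    using power_diff_sumr2 [of "X i" k "X (Suc i)"]
    by (simp add: mult_ac)
qed

text \<open>A pure power has an exponent 0, so the modified swap really exchanges the two powers and
  the numerator changes sign.\<close>

lemma ttheta_X_Suc_power: "ttheta i (X (Suc i) ^ k) = - ttheta i (X i ^ k)"
proof (rule ttheta_eqI)
  have "tswap i (X i ^ k) = X (Suc i) ^ k" "tswap i (X (Suc i) ^ k) = X i ^ k"
    using tswap_X_power_mult [of i k 0] tswap_X_power_mult [of i 0 k] by simp_all
  then show "(X i - X (Suc i)) * - ttheta i (X i ^ k) =
    X (Suc i) * (1 + beta * X i) * (X (Suc i) ^ k - tswap i (X (Suc i) ^ k))"
    using ttheta_mult [of i "X i ^ k"] by (simp add: algebra_simps)
qed

section \<open>Steps and path polynomials\<close>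

text \<open>
  States are natural numbers and \<open>B\<close> contains those at which one block ends and the next one
  begins.  A black entry \<open>t - s\<close> or a red entry \<open>t - s + 1\<close> leads from \<open>s\<close> to \<open>t\<close>; only
  a black entry may open a block.
\<close>

definition black_step :: "nat set \<Rightarrow> nat \<Rightarrow> nat \<Rightarrow> bool" where
  "black_step B s t \<longleftrightarrow> s < t \<and> (\<forall>b\<in>B. \<not> (s < b \<and> b < t))"

definition red_step :: "nat set \<Rightarrow> nat \<Rightarrow> nat \<Rightarrow> bool" where
  "red_step B s t \<longleftrightarrow> 0 < s \<and> s \<le> t \<and> (\<forall>b\<in>B. \<not> (s \<le> b \<and> b < t))"

definition step_weight :: "nat set \<Rightarrow> nat \<Rightarrow> nat \<Rightarrow> mpol \<Rightarrow> mpol" where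
  "step_weight B s t v = (if black_step B s t then v ^ (t - s) else 0) +
     (if red_step B s t then beta * v ^ (Suc t - s) else 0)"

lemma step_weight_eq_0:
  assumes "b \<in> B" "s < b" "b < t" shows "step_weight B s t v = 0"
  using assms by (auto simp: step_weight_def black_step_def red_step_def)

lemma step_weight_less: "t < s \<Longrightarrow> step_weight B s t v = 0"
  by (simp add: step_weight_def black_step_def red_step_def)

lemma step_weight_boundary:
  assumes "\<forall>b\<in>B. \<not> (s < b \<and> b < t)" "s < t" "s \<in> B"
  shows "step_weight B s t v = v ^ (t - s)"
  using assms by (auto simp: step_weight_def black_step_def red_step_def)

lemma step_weight_interior:
  assumes "\<forall>b\<in>B. \<not> (s \<le> b \<and> b < t)" "0 < s" "s \<le> t"
  shows "step_weight B s t v = (if s < t then v ^ (t - s) else 0) + beta * v ^ (Suc t - s)"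
  using assms by (auto simp: step_weight_def black_step_def red_step_def)

section \<open>Action of theta_i on the weights of single steps\<close>

lemma ttheta_beta_mult: "ttheta i (beta * f) = beta * ttheta i f"
  by (rule ttheta_indep_mult [OF tindep_beta])

lemma ttheta_step_weight_Suc:
  "ttheta i (step_weight B s t (X (Suc i))) = - ttheta i (step_weight B s t (X i))"
  by (simp add: step_weight_def ttheta_add ttheta_beta_mult ttheta_X_Suc_power)

text \<open>Nonzero entries of either color have positive exponents, so the product is a combination
  of monomials containing both variables.\<close>

lemma ttheta_step_weight_mult:
  "ttheta i (step_weight B s t (X i) * step_weight B t r (X (Suc i))) = 0"
proof -
  have P: "ttheta i (X i ^ p * X (Suc i) ^ q) = 0" if "p > 0" "q > 0" for p q
    using that by (rule ttheta_mixed)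
  \<comment> \<open>The coefficients 1 and \<beta> will cover the four combinations of
    colors.\<close>
  have "ttheta i ((c * X i ^ p) * (d * X (Suc i) ^ q)) = 0"
    if "p > 0" "q > 0" "tindep i c" "tindep i d" for p q c d
    using ttheta_indep_mult [OF tindep_mult, OF that(3,4), of "X i ^ p * X (Suc i) ^ q"] P
      [OF that(1,2)]
    by (simp add: mult_ac)
  note Q = this
  from Q [of _ _ 1 1] Q [of _ _ 1 beta] Q [of _ _ beta 1] Q [of _ _ beta beta]
  show ?thesis
    by (auto simp: step_weight_def black_step_def red_step_def distrib_left distrib_right ttheta_add
      tindep_beta)
qed

text \<open>\<open>H\<close> is the quotient that theta_i produces on x^k, and \<open>Q\<close>
  collects the monomials of degree k containing both variables. Expressing everything by
  \<open>Q\<close> and pure powers reduces \<open>ttheta_step_weight\<close> to ring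
  arithmetic.\<close>

lemma power_sum_split:
  fixes x y b :: "'a :: comm_ring_1"
  assumes k: "k > 0"
  defines "H \<equiv> \<Sum>r<k. x ^ r * y ^ (k - Suc r)"
    and "Q \<equiv> \<Sum>r\<in>{1..<k}. x ^ r * y ^ (k - r)"
  shows "y * H = y ^ k + Q" "x * H = Q + x ^ k"
    and "(\<Sum>r<k. x ^ r * y ^ (k - r)) = y ^ k + Q"
proof -
  have yH: "y * H = (\<Sum>r\<in>{..<k}. x ^ r * y ^ (k - r))"
    unfolding H_def sum_distrib_left
  proof (rule sum.cong)
    fix r assume "r \<in> {..<k}"
    then have "k - r = Suc (k - Suc r)" by auto
    then show "y * (x ^ r * y ^ (k - Suc r)) = x ^ r * y ^ (k - r)"
      by (simp add: mult_ac)
  qed simp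
  have s: "{..<k} = insert 0 {1..<k}" using k by auto
  show yHQ: "y * H = y ^ k + Q" unfolding yH Q_def s by (subst sum.insert) auto
  have "x * H = (\<Sum>r<k. x ^ Suc r * y ^ (k - Suc r))"
    unfolding H_def sum_distrib_left by (simp add: mult_ac)
  also have "\<dots> = (\<Sum>r\<in>{1..<Suc k}. x ^ r * y ^ (k - r))"
    by (rule sum.reindex_bij_witness [of _ "\<lambda>r. r - 1" Suc]) auto
  also have "\<dots> = Q + x ^ k" unfolding Q_def using k by simp
  finally show "x * H = Q + x ^ k" .
  show "(\<Sum>r<k. x ^ r * y ^ (k - r)) = y ^ k + Q"
    using yHQ by (simp add: yH)
qed

text \<open>With \<open>s\<close> the start of the block that \<open>t\<close> belongs to, the right
  side lists the ways from \<open>r\<close> to \<open>t\<close> with a nonzero entry at i + 1,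
  either directly or through some \<open>q\<close> of the block reached at i. This is what moving a
  position from i to i + 1 adds. The cases differ by the colors available at
  \<open>r\<close>.\<close>

lemma ttheta_step_weight:
  assumes s: "s \<in> B" and st: "s < t" and B: "\<forall>b\<in>B. \<not> (s < b \<and> b < t)"
  shows "ttheta i (step_weight B r t (X i)) = step_weight B r t (X (Suc i)) +
    (\<Sum>q\<in>{s<..t}. step_weight B r q (X i) * step_weight B q t (X (Suc i)))"
proof -
  let ?x = "X i" and ?y = "X (Suc i)"
  have int: "step_weight B q t v = (if q < t then v ^ (t - q) else 0) + beta * v ^ (Suc t - q)"
    if "s < q" "q \<le> t" for q v
    using that B by (intro step_weight_interior) auto
  consider "r < s" | "r = s" | "t < r" | "r = t" | "s < r" "r < t" by linarith
  then show ?thesis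
  proof cases
    \<comment> \<open>Every step occurring here from \<open>r\<close> jumps over the boundary
      \<open>s\<close>, so both sides vanish.\<close>
    case 1
    then show ?thesis using s st by (auto simp: step_weight_eq_0 [OF s] intro!: sum.neutral)
  next
    case 3
    then have "step_weight B r q ?x = 0" if "q \<in> {s<..t}" for q
      using that by (intro step_weight_less) auto
    then show ?thesis using 3 by (simp add: step_weight_less)
  next
    \<comment> \<open>Only a red 1 keeps the state. It is allowed even if \<open>t\<close> is a
      boundary, where it belongs to the block just completed.\<close>
    case 4
    have "(\<Sum>q\<in>{s<..t}. step_weight B r q ?x * step_weight B q t ?y)
      = (\<Sum>q\<in>{t}. step_weight B r q ?x * step_weight B q t ?y)"
      by (rule sum.mono_neutral_right) (use 4 st in \<open>auto simp: step_weight_less\<close>)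
    then show ?thesis using 4 st ttheta_X_power [of i 1]
      by (simp add: int ttheta_beta_mult) (simp add: algebra_simps)
  next
    \<comment> \<open>The first entry opens the block and is black. From \<open>q > s\<close> both
      colors are possible, except that at \<open>q = t\<close> only a red 1 remains.\<close>
    case 2
    define k where "k = t - s"
    have k: "k > 0" and t: "t = s + k" using st by (simp_all add: k_def)
    have bd: "step_weight B r q v = v ^ (q - s)" if "q \<in> {s<..t}" for q v
      unfolding \<open>r = s\<close> by (rule step_weight_boundary) (use that B s in auto)
    define Q where "Q = (\<Sum>r\<in>{1..<k}. ?x ^ r * ?y ^ (k - r))"
    note I = power_sum_split [OF k, where x = ?x and y = ?y, folded Q_def]
    have "(\<Sum>q\<in>{s<..t}. step_weight B r q ?x * step_weight B q t ?y)
       = (\<Sum>q\<in>{s<..t}. ?x ^ (q - s) * ((if q < t then ?y ^ (t - q) else 0) + beta * ?y ^ (Suc t - q)))"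
      by (rule sum.cong) (auto simp: bd int)
    also have "\<dots> = (\<Sum>r\<in>{1..<Suc k}. ?x ^ r * ((if r < k then ?y ^ (k - r) else 0) + beta
      * ?y ^ (Suc k - r)))"
      by (rule sum.reindex_bij_witness [of _ "\<lambda>r. s + r" "\<lambda>q. q - s"])
        (auto simp: t Suc_diff_le add.commute)
    also have "\<dots> = (\<Sum>r\<in>{1..<k}. ?x ^ r * (?y ^ (k - r) + beta * (?y * ?y ^ (k - r)))) + ?x ^ k
      * (beta * ?y)"
      using k by (simp add: Suc_diff_le)
    also have "\<dots> = Q + beta * ?y * Q + ?x ^ k * (beta * ?y)"
      by (simp add: Q_def sum_distrib_left distrib_left sum.distrib mult_ac)
    finally have R: "(\<Sum>q\<in>{s<..t}. step_weight B r q ?x * step_weight B q t ?y) = Q + beta * ?y * Q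
      + ?x ^ k * (beta * ?y)" .
    define H where "H = (\<Sum>r<k. ?x ^ r * ?y ^ (k - Suc r))"
    have "ttheta i (step_weight B r t ?x) = ?y * H + beta * ?y * (?x * H)"
      using bd [of t] st by (simp add: ttheta_X_power H_def [symmetric] k_def [symmetric])
        (simp add: algebra_simps)
    then show ?thesis unfolding R using bd [of t] st I(1,2) [folded H_def]
      by (simp add: k_def [symmetric]) (simp add: algebra_simps)
  next
    \<comment> \<open>Both entries may have either color, hence the factors 1 + \<beta> x and 1 +
      \<beta> y. The end values \<open>q = r\<close> and \<open>q = t\<close> force a red 1 and are
      split off.\<close>
    case 5
    define k where "k = t - r"
    have k: "k > 0" and t: "t = r + k" using 5 by (simp_all add: k_def)
    have bd: "step_weight B r q v = (if r < q then v ^ (q - r) else 0) + beta * v ^ (Suc q - r)"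
      if "r \<le> q" "q \<le> t" for q v
      using that B 5 by (intro step_weight_interior) auto
    define Q where "Q = (\<Sum>r\<in>{1..<k}. ?x ^ r * ?y ^ (k - r))"
    define H where "H = (\<Sum>r<k. ?x ^ r * ?y ^ (k - Suc r))"
    have "(\<Sum>q\<in>{s<..t}. step_weight B r q ?x * step_weight B q t ?y)
       = (\<Sum>q\<in>{r..t}. step_weight B r q ?x * step_weight B q t ?y)"
      by (rule sum.mono_neutral_right) (use 5 in \<open>auto simp: step_weight_less\<close>)
    also have "\<dots> = (\<Sum>q\<in>{r..t}. ((if r < q then ?x ^ (q - r) else 0) + beta * ?x ^ (Suc q - r))
      * ((if q < t then ?y ^ (t - q) else 0) + beta * ?y ^ (Suc t - q)))"
      by (rule sum.cong) (use 5 in \<open>auto simp: bd int\<close>)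
    also have "\<dots> = (\<Sum>q\<in>{0..<Suc k}. ((if 0 < q then ?x ^ q else 0) + beta * ?x ^ Suc q)
      * ((if q < k then ?y ^ (k - q) else 0) + beta * ?y ^ (Suc k - q)))"
      by (rule sum.reindex_bij_witness [of _ "\<lambda>q. r + q" "\<lambda>q. q - r"])
        (auto simp: t Suc_diff_le add.commute)
    also have "\<dots> = (\<Sum>q\<in>{1..<k}. (?x ^ q + beta * (?x * ?x ^ q))
      * (?y ^ (k - q) + beta * (?y * ?y ^ (k - q))))
        + beta * ?x * (?y ^ k + beta * ?y ^ Suc k) + (?x ^ k + beta * ?x ^ Suc k) * (beta * ?y)"
      using k by (simp add: sum.atLeast_Suc_lessThan Suc_diff_le)
    also have "(\<Sum>q\<in>{1..<k}. (?x ^ q + beta * (?x * ?x ^ q))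
      * (?y ^ (k - q) + beta * (?y * ?y ^ (k - q))))
      = (1 + beta * ?x) * (1 + beta * ?y) * Q"
      unfolding Q_def sum_distrib_left by (rule sum.cong) (auto simp: algebra_simps)
    finally have R: "(\<Sum>q\<in>{s<..t}. step_weight B r q ?x * step_weight B q t ?y) =
       (1 + beta * ?x) * (1 + beta * ?y) * Q + beta * ?x * (?y ^ k + beta * ?y ^ Suc k)
        + (?x ^ k + beta * ?x ^ Suc k) * (beta * ?y)" .
    note I = power_sum_split [OF k, where x = ?x and y = ?y, folded Q_def, folded H_def]
    \<comment> \<open>The red part has degree k + 1; its sum is rewritten by the third identity of
      \<open>power_sum_split\<close>.\<close>
    have "ttheta i (step_weight B r t ?x) = (1 + beta * ?x)
      * (?y * H + beta * ?y * (?y ^ k + Q + ?x ^ k))"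
      using 5 by (simp add: bd ttheta_add ttheta_beta_mult Suc_diff_le k_def [symmetric]
        ttheta_X_power I(3) H_def [symmetric] del: power_Suc) (simp add: algebra_simps)
    also have "\<dots> = (1 + beta * ?x) * (?y ^ k + Q + beta * ?y * (?y ^ k + Q + ?x ^ k))"
      by (simp only: I(1))
    finally have L: "ttheta i (step_weight B r t ?x) = (1 + beta * ?x)
      * (?y ^ k + Q + beta * ?y * (?y ^ k + Q + ?x ^ k))" .
    show ?thesis unfolding R L using 5 by (simp add: bd Suc_diff_le k_def [symmetric])
      (simp add: algebra_simps)
  qed
qed

text \<open>
  At position \<open>m\<close> the entry may be zero if \<open>z m\<close>, and a nonzero entry may lead to state \<open>t\<close> if \<open>c m t\<close>.
\<close>

primrec path_poly :: "nat set \<Rightarrow> (nat \<Rightarrow> bool) \<Rightarrow> (nat \<Rightarrow> nat \<Rightarrow> bool) \<Rightarrow> nat \<Rightarrow> nat \<Rightarrow> mpol" where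
  "path_poly B z c 0 t = (if t = 0 then 1 else 0)"
| "path_poly B z c (Suc m) t = (if z (Suc m) then path_poly B z c m t else 0) +
     (if c (Suc m) t then \<Sum>s\<le>t. path_poly B z c m s * step_weight B s t (X (Suc m)) else 0)"

section \<open>Action of theta_i on path polynomials\<close>

lemma path_poly_cong:
  assumes "\<And>k. 1 \<le> k \<Longrightarrow> k \<le> m \<Longrightarrow> z k = z' k" "\<And>k. 1 \<le> k \<Longrightarrow> k \<le> m \<Longrightarrow> c k = c' k"
  shows "path_poly B z c m t = path_poly B z' c' m t"
  using assms by (induction m arbitrary: t) simp_all

lemma tindep_step_weight: "tindep i v \<Longrightarrow> tindep i (step_weight B s t v)"
  by (simp add: step_weight_def tindep_add tindep_mult tindep_power tindep_beta)

lemma tindep_path_poly: "m < i \<Longrightarrow> tindep i (path_poly B z c m t)"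
  by (induction m arbitrary: t)
    (auto intro!: tindep_add tindep_sum tindep_mult tindep_step_weight tindep_X)

text \<open>Paths with zeros at i and i + 1 are free of both variables and those with two nonzero
  entries are mixed, so theta_i kills them. A single nonzero entry at i + 1 contributes the negative
  of the same entry at i.\<close>

lemma ttheta_path_poly_base:
  fixes z :: "nat \<Rightarrow> bool" and c :: "nat \<Rightarrow> nat \<Rightarrow> bool" and B :: "nat set"
  assumes "i \<ge> 1"
  defines "E \<equiv> path_poly B z c (i - 1)"
  shows "ttheta i (path_poly B z c (Suc i) t) =
    (if z (Suc i) \<and> c i t then \<Sum>s\<le>t. E s * ttheta i (step_weight B s t (X i)) else 0) -
    (if z i \<and> c (Suc i) t then \<Sum>s\<le>t. E s * ttheta i (step_weight B s t (X i)) else 0)"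
proof -
  obtain j where j: "i = Suc j" using assms by (cases i) auto
  have E: "tindep i (E s)" for s unfolding E_def j by (rule tindep_path_poly) simp
  have G: "path_poly B z c i t = (if z i then E t else 0)
    + (if c i t then \<Sum>s\<le>t. E s * step_weight B s t (X i) else 0)" for t
    unfolding j E_def by simp
  have 1: "ttheta i (path_poly B z c i t) = (if c i t then \<Sum>s\<le>t. E s
    * ttheta i (step_weight B s t (X i)) else 0)" for t
    unfolding G by (simp add: ttheta_add ttheta_sum ttheta_indep E ttheta_indep_mult)
  have 2: "ttheta i (path_poly B z c i s * step_weight B s t (X (Suc i))) =
     (if z i then - (E s * ttheta i (step_weight B s t (X i))) else 0)" for s
    unfolding G
    by (simp add: distrib_right sum_distrib_right ttheta_add ttheta_sum ttheta_indep_mult E mult.assoc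
      ttheta_step_weight_Suc ttheta_step_weight_mult)
  show ?thesis
    by (simp add: ttheta_add ttheta_sum 1 2 sum_negf)
qed

text \<open>The paths are sorted by which of the two positions carry nonzero entries. The last
  summand keeps the intermediate state \<open>q\<close>, for comparison with
  \<open>ttheta_step_weight\<close>.\<close>

lemma path_poly_two_steps:
  fixes z :: "nat \<Rightarrow> bool" and c :: "nat \<Rightarrow> nat \<Rightarrow> bool" and B :: "nat set"
  assumes "i \<ge> 1"
  defines "E \<equiv> path_poly B z c (i - 1)"
  shows "path_poly B z c (Suc i) t =
    (if z i \<and> z (Suc i) then E t else 0)
    + (if z (Suc i) \<and> c i t then \<Sum>s\<le>t. E s * step_weight B s t (X i) else 0)
    + (if z i \<and> c (Suc i) t then \<Sum>s\<le>t. E s * step_weight B s t (X (Suc i)) else 0)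
    + (if c (Suc i) t then \<Sum>s\<le>t. E s * (\<Sum>q\<in>{q. q \<le> t \<and> c i q}. step_weight B s q (X i)
      * step_weight B q t (X (Suc i))) else 0)"
proof -
  obtain j where j: "i = Suc j" using assms by (cases i) auto
  let ?w = "\<lambda>s q. step_weight B s q (X i)" and ?v = "\<lambda>s q. step_weight B s q (X (Suc i))"
  have G: "path_poly B z c i t = (if z i then E t else 0)
    + (if c i t then \<Sum>s\<le>t. E s * ?w s t else 0)" for t
    unfolding j E_def by simp
  \<comment> \<open>A range independent of \<open>q\<close> allows the two sums to be
    exchanged.\<close>
  have ext: "(\<Sum>s\<le>q. E s * ?w s q) = (\<Sum>s\<le>t. E s * ?w s q)" if "q \<le> t" for q
    by (rule sum.mono_neutral_left) (use that in \<open>auto simp: step_weight_less\<close>)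
  have "(\<Sum>q\<le>t. path_poly B z c i q * ?v q t)
     = (\<Sum>q\<le>t. (if z i then E q * ?v q t else 0))
       + (\<Sum>q\<le>t. if c i q then (\<Sum>s\<le>t. E s * ?w s q * ?v q t) else 0)"
    unfolding sum.distrib [symmetric]
    by (rule sum.cong) (auto simp: G ext distrib_right sum_distrib_right)
  also have "(\<Sum>q\<le>t. if c i q then (\<Sum>s\<le>t. E s * ?w s q * ?v q t) else 0)
     = (\<Sum>q\<in>{q. q \<le> t \<and> c i q}. \<Sum>s\<le>t. E s * ?w s q * ?v q t)"
    by (rule sum.mono_neutral_cong_right) auto
  also have "\<dots> = (\<Sum>s\<le>t. E s * (\<Sum>q\<in>{q. q \<le> t \<and> c i q}. ?w s q * ?v q t))"
    by (subst sum.swap) (simp add: sum_distrib_left mult.assoc)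
  finally have S: "(\<Sum>q\<le>t. path_poly B z c i q * ?v q t) = (if z i then \<Sum>q\<le>t. E q * ?v q t else 0)
     + (\<Sum>s\<le>t. E s * (\<Sum>q\<in>{q. q \<le> t \<and> c i q}. ?w s q * ?v q t))" by simp
  show ?thesis unfolding path_poly.simps(2) [of B z c i] S by (simp add: G)
qed

lemma ttheta_path_poly_step:
  assumes "i < m" "i \<ge> 1"
  shows "ttheta i (path_poly B z c (Suc m) t) = (if z (Suc m) then ttheta i (path_poly B z c m t)
    else 0) +
     (if c (Suc m) t then \<Sum>s\<le>t. ttheta i (path_poly B z c m s) * step_weight B s t (X (Suc m)) else 0)"
proof -
  have "tindep i (step_weight B s t (X (Suc m)))" for s
    using assms by (intro tindep_step_weight tindep_X) auto
  then have "ttheta i (path_poly B z c m s * step_weight B s t (X (Suc m))) =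
     ttheta i (path_poly B z c m s) * step_weight B s t (X (Suc m))" for s
    by (metis ttheta_indep_mult mult.commute)
  then show ?thesis by (simp add: ttheta_add ttheta_sum)
qed

section \<open>Moving a nonzero position\<close>

definition psum :: "nat list \<Rightarrow> nat \<Rightarrow> nat" where
  "psum a j = sum_list (take j a)"

definition bounds :: "nat list \<Rightarrow> nat set" where
  "bounds a = psum a ` {..length a}"

lemma psum_0 [simp]: "psum a 0 = 0"
  by (simp add: psum_def)

lemma psum_length [simp]: "psum a (length a) = sum_list a"
  by (simp add: psum_def)

lemma psum_Suc: "j < length a \<Longrightarrow> psum a (Suc j) = psum a j + a ! j"
  by (simp add: psum_def take_Suc_conv_app_nth)

lemma psum_mono: "j \<le> k \<Longrightarrow> psum a j \<le> psum a k"
proof -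
  assume "j \<le> k"
  then have "take k a = take j a @ take (k - j) (drop j a)"
    by (metis le_add_diff_inverse take_add)
  then show ?thesis by (simp add: psum_def)
qed

lemma psum_le_sum_list: "psum a j \<le> sum_list a"
  unfolding psum_def by (metis append_take_drop_id le_add1 sum_list_append)

lemma psum_less:
  assumes "strong_composition a" "j < k" "k \<le> length a"
  shows "psum a j < psum a k"
proof -
  have "j < length a" using assms by simp
  then have "psum a j < psum a (Suc j)"
    using assms(1) by (simp add: psum_Suc strong_composition_def)
  also have "\<dots> \<le> psum a k" using assms by (intro psum_mono) simp
  finally show ?thesis .
qed

lemma psum_in_bounds: "j \<le> length a \<Longrightarrow> psum a j \<in> bounds a"
  by (simp add: bounds_def)

lemma no_bounds_between:
  assumes "t \<le> psum a (Suc j)"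
  shows "\<forall>b\<in>bounds a. \<not> (psum a j < b \<and> b < t)"
proof (intro ballI notI)
  fix b assume "b \<in> bounds a" and b: "psum a j < b \<and> b < t"
  then obtain k where k: "b = psum a k" by (auto simp: bounds_def)
  show False
    using psum_mono [of k j a] psum_mono [of "Suc j" k a] b k assms by (cases "k \<le> j") auto
qed

definition nbefore :: "nat set \<Rightarrow> nat \<Rightarrow> nat" where
  "nbefore P m = card {p\<in>P. p < m}"

lemma nbefore_Suc:
  assumes "finite P"
  shows "nbefore P (Suc m) = nbefore P m + (if m \<in> P then 1 else 0)"
proof -
  have "{p\<in>P. p < Suc m} = (if m \<in> P then insert m {p\<in>P. p < m} else {p\<in>P. p < m})"
    by (auto simp: less_Suc_eq)
  then show ?thesis using assms by (simp add: nbefore_def)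
qed

lemma nbefore_le_card: "finite P \<Longrightarrow> nbefore P m \<le> card P"
  unfolding nbefore_def by (rule card_mono) auto

lemma nbefore_less_card: "finite P \<Longrightarrow> p \<in> P \<Longrightarrow> nbefore P p < card P"
  using nbefore_Suc [of P p] nbefore_le_card [of P "Suc p"] by simp

lemma transpose_image:
  "i \<in> P \<Longrightarrow> Suc i \<notin> P \<Longrightarrow> transpose i (Suc i) ` P = insert (Suc i) (P - {i})"
  by (auto simp: transpose_def image_iff)

text \<open>Up to i neither place is counted, beyond i + 1 exactly one of them is; only the count at
  i + 1 notices the move.\<close>

lemma nbefore_transpose:
  assumes "finite P" "i \<in> P" "Suc i \<notin> P"
  shows "nbefore (transpose i (Suc i) ` P) m = (if m = Suc i then nbefore P i else nbefore P m)"
proof -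
  let ?Q = "transpose i (Suc i) ` P"
  have Q: "?Q = insert (Suc i) (P - {i})" by (rule transpose_image [OF assms(2,3)])
  have le: "{p\<in>?Q. p < k} = {p\<in>P. p < k}" if "k \<le> i" for k using that unfolding Q by auto
  have a: "nbefore ?Q m = nbefore P m" if "m \<le> i" for m using le [OF that] by (simp add: nbefore_def)
  have fin: "finite ?Q" using assms by simp
  have b: "nbefore ?Q (Suc i) = nbefore P i"
    using a [of i] nbefore_Suc [OF fin, of i] unfolding Q by simp
  have c: "nbefore ?Q (Suc (Suc i)) = nbefore P (Suc (Suc i))"
    using nbefore_Suc [OF fin, of "Suc i"] nbefore_Suc [OF assms(1), of i] nbefore_Suc
      [OF assms(1), of "Suc i"]
      b assms by (simp add: Q)
  have d: "nbefore ?Q m = nbefore P m" if "Suc (Suc i) \<le> m" for m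
    using that
  proof (induction m rule: dec_induct)
    case base show ?case by (rule c)
  next
    case (step m)
    have "m \<in> ?Q \<longleftrightarrow> m \<in> P" using step(1) unfolding Q by auto
    then show ?case using step by (simp add: nbefore_Suc fin assms)
  qed
  show ?thesis using a b d by (cases "m \<le> i") (auto simp: not_le Suc_le_eq not_less_eq)
qed

text \<open>
  The entry at position \<open>m\<close> may belong to block \<open>j\<close> iff \<open>m \<le> n\<^sub>j\<close>, that is, iff fewer than \<open>j\<close> elements
  of \<open>P\<close> lie before \<open>m\<close>.
\<close>

definition glide_path :: "nat list \<Rightarrow> nat set \<Rightarrow> nat \<Rightarrow> nat \<Rightarrow> mpol" where
  "glide_path a P = path_poly (bounds a) (\<lambda>_. True) (\<lambda>m t. psum a (nbefore P m) < t)"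

text \<open>This encodes the mesonic condition: an element \<open>m\<close> of \<open>P\<close> is
  the last place of its block, so its entry is nonzero and leads to the block's end. The
  \<open>Suc\<close> counts \<open>m\<close> itself.\<close>

definition kaon_path :: "nat list \<Rightarrow> nat set \<Rightarrow> nat \<Rightarrow> nat \<Rightarrow> mpol" where
  "kaon_path a P = path_poly (bounds a) (\<lambda>m. m \<notin> P)
     (\<lambda>m t. if m \<in> P then t = psum a (Suc (nbefore P m)) else psum a (nbefore P m) < t)"

text \<open>Later positions have the same matrices in both systems, free of x_i and x_{i+1}, so an
  identity at i + 1 propagates by linearity. The scalar \<open>r\<close> is 1 for glides and 0 for
  kaons.\<close>

lemma ttheta_transfer_above:
  assumes "i \<ge> 1" "Suc i \<le> m"
    and base: "\<And>t. ttheta i (path_poly B z c (Suc i) t) = path_poly B z' c' (Suc i) t - r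
      * path_poly B z c (Suc i) t"
    and zc: "\<And>k. Suc i < k \<Longrightarrow> z k = z' k" "\<And>k. Suc i < k \<Longrightarrow> c k = c' k"
  shows "ttheta i (path_poly B z c m t) = path_poly B z' c' m t - r * path_poly B z c m t"
  using assms(2)
proof (induction m arbitrary: t rule: dec_induct)
  case base show ?case by (rule assms(3))
next
  case (step m)
  have "ttheta i (path_poly B z c (Suc m) t) = (if z' (Suc m) then ttheta i (path_poly B z c m t)
    else 0) +
     (if c' (Suc m) t then \<Sum>s\<le>t. ttheta i (path_poly B z c m s) * step_weight B s t (X (Suc m)) else 0)"
    using zc [of "Suc m"] step(1) assms(1) by (subst ttheta_path_poly_step) auto
  then show ?case using zc [of "Suc m"] step(1)
    by (simp add: step.IH left_diff_distrib right_diff_distrib sum_subtractf sum_distrib_left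
      distrib_left mult.assoc)
qed

text \<open>The move lowers only the gate at i + 1, from the end of one block to its start. The
  paths gained land in this block at i + 1, and \<open>ttheta_step_weight\<close> shows that theta_i
  produces exactly these.\<close>

lemma ttheta_glide_path:
  assumes "i \<ge> 1" "finite P" "card P = length a" "i \<in> P" "Suc i \<notin> P" "Suc i \<le> m"
  shows "ttheta i (glide_path a P m t) = glide_path a (transpose i (Suc i) ` P) m t - glide_path a P
    m t"
proof -
  let ?Q = "transpose i (Suc i) ` P" and ?T = "\<lambda>_. True"
  let ?c = "\<lambda>P m t. psum a (nbefore P m) < t"
  let ?G = "\<lambda>P. path_poly (bounds a) ?T (?c P)"
  note nb = nbefore_transpose [OF assms(2,4,5)]
  define j where "j = nbefore P i"
  have j: "j < length a" using nbefore_less_card [OF assms(2,4)] assms(3) by (simp add: j_def)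
  have E: "?G P (i - 1) = ?G ?Q (i - 1)"
    by (intro ext path_poly_cong) (use assms(1) in \<open>auto simp: nb\<close>)
  have nS: "nbefore P (Suc i) = Suc j" using nbefore_Suc [OF assms(2), of i] assms(4)
    by (simp add: j_def)
  have "ttheta i (?G P m t) = ?G ?Q m t - 1 * ?G P m t"
  proof (rule ttheta_transfer_above [OF assms(1,6)])
    fix t
    let ?E = "?G P (i - 1)" and ?w = "\<lambda>s t. step_weight (bounds a) s t (X i)" and ?v
      = "\<lambda>s t. step_weight (bounds a) s t (X (Suc i))"
    have le: "psum a j \<le> psum a (Suc j)" by (rule psum_mono) simp
    \<comment> \<open>Beyond the block both gates are open and the contributions of i and i + 1
      cancel.\<close>
    have T: "ttheta i (?G P (Suc i) t) = (if psum a j < t \<and> t \<le> psum a (Suc j) then \<Sum>s\<le>t. ?E s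
      * ttheta i (?w s t) else 0)"
      unfolding ttheta_path_poly_base [OF assms(1)] using le by (simp add: nS flip: j_def)
    have D: "?G ?Q (Suc i) t - ?G P (Suc i) t = (if psum a j < t \<and> t \<le> psum a (Suc j)
        then (\<Sum>s\<le>t. ?E s * ?v s t) + (\<Sum>s\<le>t. ?E s * (\<Sum>q\<in>{q. q \<le> t \<and> psum a j < q}. ?w s q * ?v q t))
          else 0)"
      unfolding path_poly_two_steps [OF assms(1)] E [symmetric] using le
        by (simp add: nb nS flip: j_def)
    show "ttheta i (?G P (Suc i) t) = ?G ?Q (Suc i) t - 1 * ?G P (Suc i) t"
    proof (cases "psum a j < t \<and> t \<le> psum a (Suc j)")
      case True
      have s: "{q. q \<le> t \<and> psum a j < q} = {psum a j<..t}" by auto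
      have W: "ttheta i (?w s t) = ?v s t + (\<Sum>q\<in>{psum a j<..t}. ?w s q * ?v q t)" for s
        by (rule ttheta_step_weight) (use True j no_bounds_between [of t a j] in \<open>auto intro:
          psum_in_bounds\<close>)
      then show ?thesis using T D True by (simp add: s distrib_left sum.distrib)
    qed (use T D in auto)
  qed (auto simp: nb)
  then show ?thesis by (simp add: glide_path_def)
qed

text \<open>The entry at i must be nonzero, so no cancelling contribution from i + 1 arises, and it
  must complete its block. After the move the entry at i + 1 has to do so while i is free;
  \<open>ttheta_step_weight\<close> lists these possibilities.\<close>

lemma ttheta_kaon_path:
  assumes "i \<ge> 1" "finite P" "card P = length a" "i \<in> P" "Suc i \<notin> P" "Suc i \<le> m" "strong_composition a"
  shows "ttheta i (kaon_path a P m t) = kaon_path a (transpose i (Suc i) ` P) m t"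
proof -
  let ?Q = "transpose i (Suc i) ` P" and ?z = "\<lambda>P m. m \<notin> P"
  let ?c = "\<lambda>P m t. if m \<in> P then t = psum a (Suc (nbefore P m)) else psum a (nbefore P m) < t"
  let ?G = "\<lambda>P. path_poly (bounds a) (?z P) (?c P)"
  note nb = nbefore_transpose [OF assms(2,4,5)] and Q = transpose_image [OF assms(4,5)]
  have Qm: "m \<in> ?Q \<longleftrightarrow> m = Suc i \<or> m \<noteq> i \<and> m \<in> P" for m unfolding Q by auto
  define j where "j = nbefore P i"
  have j: "j < length a" using nbefore_less_card [OF assms(2,4)] assms(3) by (simp add: j_def)
  have E: "?G P (i - 1) = ?G ?Q (i - 1)"
    by (intro ext path_poly_cong) (use assms(1) in \<open>auto simp: nb Qm\<close>)
  have nS: "nbefore P (Suc i) = Suc j" using nbefore_Suc [OF assms(2), of i] assms(4)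
    by (simp add: j_def)
  have less: "psum a j < psum a (Suc j)" using assms(7) j by (intro psum_less) auto
  have "ttheta i (?G P m t) = ?G ?Q m t - 0 * ?G P m t"
  proof (rule ttheta_transfer_above [OF assms(1,6)])
    fix t
    let ?E = "?G P (i - 1)" and ?w = "\<lambda>s t. step_weight (bounds a) s t (X i)" and ?v
      = "\<lambda>s t. step_weight (bounds a) s t (X (Suc i))"
    have T: "ttheta i (?G P (Suc i) t) = (if t = psum a (Suc j) then \<Sum>s\<le>t. ?E s * ttheta i (?w s t)
      else 0)"
      unfolding ttheta_path_poly_base [OF assms(1)] using assms(4,5) by (simp add: nS flip: j_def)
    have D: "?G ?Q (Suc i) t = (if t = psum a (Suc j)
        then (\<Sum>s\<le>t. ?E s * ?v s t) + (\<Sum>s\<le>t. ?E s * (\<Sum>q\<in>{q. q \<le> t \<and> psum a j < q}. ?w s q * ?v q t))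
          else 0)"
      unfolding path_poly_two_steps [OF assms(1)] E [symmetric] using assms(4,5)
        by (simp add: nb nS Qm flip: j_def)
    show "ttheta i (?G P (Suc i) t) = ?G ?Q (Suc i) t - 0 * ?G P (Suc i) t"
    proof (cases "t = psum a (Suc j)")
      case True
      have s: "{q. q \<le> t \<and> psum a j < q} = {psum a j<..t}" by auto
      have W: "ttheta i (?w s t) = ?v s t + (\<Sum>q\<in>{psum a j<..t}. ?w s q * ?v q t)" for s
        by (rule ttheta_step_weight) (use True j less no_bounds_between [of t a j] in \<open>auto intro:
          psum_in_bounds\<close>)
      show ?thesis unfolding T D if_P [OF True] s by (simp add: W distrib_left sum.distrib)
    qed (use T D in auto)
  qed (auto simp: nb Qm fun_eq_iff)
  then show ?thesis by (simp add: kaon_path_def)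
qed

text \<open>With neither position in \<open>P\<close> the gates at i and i + 1 agree, so the two
  contributions cancel.\<close>

lemma ttheta_glide_path_out:
  assumes "i \<ge> 1" "finite P" "i \<notin> P" "Suc i \<notin> P" "Suc i \<le> m"
  shows "ttheta i (glide_path a P m t) = 0"
proof -
  let ?G = "path_poly (bounds a) (\<lambda>_. True) (\<lambda>m t. psum a (nbefore P m) < t)"
  \<comment> \<open>The transfer lemma is used with the same system on both sides, so its right side
    is 0.\<close>
  have "ttheta i (?G m t) = ?G m t - 1 * ?G m t"
  proof (rule ttheta_transfer_above [OF assms(1,5)])
    have "nbefore P (Suc i) = nbefore P i" using assms by (simp add: nbefore_Suc)
    then show "ttheta i (?G (Suc i) t) = ?G (Suc i) t - 1 * ?G (Suc i) t" for t
      using ttheta_path_poly_base [OF assms(1), of "bounds a" "\<lambda>_. True"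
        "\<lambda>m t. psum a (nbefore P m) < t" t]
      by simp
  qed auto
  then show ?thesis by (simp add: glide_path_def)
qed

text \<open>
  The bound on \<open>t\<close> discards the paths that are still in a block which is closed from
  position \<open>i + 2\<close> on.
\<close>

lemma ttheta_glide_path_in:
  assumes "i \<ge> 1" "finite P" "card P = length a" "strong_composition a" "i \<in> P" "Suc i \<in> P" "Suc i \<le> m"
    "psum a (nbefore P (Suc (Suc i))) \<le> t"
  shows "ttheta i (glide_path a P m t) = 0"
  unfolding glide_path_def using assms(7,8)
proof (induction m arbitrary: t rule: dec_induct)
  case base
  have S: "nbefore P (Suc i) = Suc (nbefore P i)" "nbefore P (Suc (Suc i)) = Suc (Suc (nbefore P i))"
    using assms by (simp_all add: nbefore_Suc)
  have "Suc (Suc (nbefore P i)) \<le> length a"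
    using nbefore_le_card [OF assms(2), of "Suc (Suc i)"] S(2) assms(3) by simp
  then have "psum a (nbefore P i) < psum a (nbefore P (Suc i))"
    "psum a (nbefore P (Suc i)) < psum a (nbefore P (Suc (Suc i)))"
    unfolding S using assms(4) by (auto intro!: psum_less)
  then show ?case
    using base ttheta_path_poly_base [OF assms(1), of "bounds a" "\<lambda>_. True"
      "\<lambda>m t. psum a (nbefore P m) < t" t]
    by simp
next
  case (step m)
  let ?G = "path_poly (bounds a) (\<lambda>_. True) (\<lambda>m t. psum a (nbefore P m) < t)"
  let ?b = "psum a (nbefore P (Suc (Suc i)))"
  have "?b \<le> psum a (nbefore P (Suc m))"
    by (rule psum_mono) (use step(1) assms(2) in \<open>auto simp: nbefore_def intro!: card_mono\<close>)
  moreover have bb: "?b \<in> bounds a"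
    using nbefore_le_card [OF assms(2), of "Suc (Suc i)"] assms(3) by (intro psum_in_bounds) simp
  \<comment> \<open>A step from below \<open>?b\<close> to beyond it has weight 0; from
    \<open>?b\<close> on the induction hypothesis applies.\<close>
  ultimately have "ttheta i (?G m s) * step_weight (bounds a) s t (X (Suc m)) = 0"
    if "psum a (nbefore P (Suc m)) < t" for s
    using step.IH [of s] step_weight_eq_0 [OF bb, of s t "X (Suc m)"] that by (cases "s < ?b") auto
  then show ?case
    using step ttheta_path_poly_step [of i m "bounds a" "\<lambda>_. True" "\<lambda>m t. psum a (nbefore P m) < t"
      t] assms(1) by (auto intro!: sum.neutral)
qed

section \<open>Initial and final positions\<close>

text \<open>A step never crosses a boundary, so each position completes at most one block.\<close>

lemma path_poly_above:
  assumes "strong_composition a" "m \<le> length a" "psum a m < t"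
  shows "path_poly (bounds a) z c m t = 0"
  using assms(2,3)
proof (induction m arbitrary: t)
  case (Suc m)
  have l: "psum a m < psum a (Suc m)" using Suc.prems by (intro psum_less assms) auto
  have "path_poly (bounds a) z c m s * step_weight (bounds a) s t (X (Suc m)) = 0" for s
  proof (cases "psum a m < s")
    case False
    then show ?thesis
      using l Suc.prems step_weight_eq_0 [OF psum_in_bounds [OF Suc.prems(1)], of s t] by simp
  qed (use Suc in simp)
  then show ?case using Suc l by (auto intro: sum.neutral)
qed simp

text \<open>The state is the largest one reachable after \<open>m\<close> positions, which forces
  each position to fill a whole block with one black entry.\<close>

lemma path_poly_diagonal:
  assumes "strong_composition a" "m \<le> length a" and c: "\<And>k. 1 \<le> k \<Longrightarrow> k \<le> m \<Longrightarrow> c k (psum a k)"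
  shows "path_poly (bounds a) z c m (psum a m) = (\<Prod>k = 1..m. X k ^ entry a k)"
  using assms(2,3)
proof (induction m)
  case (Suc m)
  let ?f = "\<lambda>s. path_poly (bounds a) z c m s * step_weight (bounds a) s (psum a (Suc m)) (X (Suc m))"
  have l: "psum a m < psum a (Suc m)" using Suc.prems by (intro psum_less assms) auto
  have b: "psum a m \<in> bounds a" using Suc.prems by (intro psum_in_bounds) simp
  have "(\<Sum>s\<le>psum a (Suc m). ?f s) = (\<Sum>s\<in>{psum a m}. ?f s)"
  proof (rule sum.mono_neutral_right)
    show "\<forall>s\<in>{..psum a (Suc m)} - {psum a m}. ?f s = 0"
    proof
      fix s assume "s \<in> {..psum a (Suc m)} - {psum a m}"
      then consider "s < psum a m" | "psum a m < s" by fastforce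
      then show "?f s = 0"
        using step_weight_eq_0 [OF b _ l] path_poly_above [OF assms(1)] Suc.prems by cases simp_all
    qed
  qed (use l in auto)
  moreover have "step_weight (bounds a) (psum a m) (psum a (Suc m)) (X (Suc m))
    = X (Suc m) ^ entry a (Suc m)"
    using step_weight_boundary [OF no_bounds_between [OF order_refl] l b] Suc.prems
    by (simp add: psum_Suc entry_def)
  moreover have "path_poly (bounds a) z c m (psum a (Suc m)) = 0"
    using Suc.prems l by (intro path_poly_above assms) auto
  ultimately show ?case using Suc by simp
qed simp

text \<open>Once all blocks are filled, the gates are closed to the total, so only zeros
  follow.\<close>

lemma path_poly_xpow:
  assumes "strong_composition a" "length a \<le> m" and c: "\<And>k. 1 \<le> k \<Longrightarrow> k \<le> length a \<Longrightarrow> c k (psum a k)"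
    and "\<And>k. length a < k \<Longrightarrow> z k" "\<And>k. length a < k \<Longrightarrow> \<not> c k (sum_list a)"
  shows "path_poly (bounds a) z c m (sum_list a) = xpow a"
  using assms(2)
proof (induction m rule: dec_induct)
  case base
  then show ?case using path_poly_diagonal [where m = "length a" and c
    = c, OF assms(1) order_refl c] by (simp add: xpow_def)
next
  case (step m) then show ?case using assms(4,5) [of "Suc m"] by simp
qed

section \<open>The first and the last places as position sets\<close>

lemma nbefore_initial: "nbefore {1..l} m = (if m \<le> l then m - 1 else l)"
proof -
  have "{p\<in>{1..l}. p < m} = {1..if m \<le> l then m - 1 else l}" by auto
  then show ?thesis by (simp add: nbefore_def)
qed

lemma glide_path_initial:
  assumes "strong_composition a" "length a \<le> n"
  shows "glide_path a {1..length a} n (sum_list a) = xpow a"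
  unfolding glide_path_def nbefore_initial
  by (rule path_poly_xpow) (use assms in \<open>auto intro!: psum_less\<close>)

lemma kaon_path_initial:
  assumes "strong_composition a" "length a \<le> n"
  shows "kaon_path a {1..length a} n (sum_list a) = xpow a"
  unfolding kaon_path_def nbefore_initial
  by (rule path_poly_xpow) (use assms in \<open>auto\<close>)

lemma nbefore_final:
  assumes "m \<le> Suc n" "l \<le> n"
  shows "nbefore {n - l<..n} m = m - 1 - (n - l)"
proof -
  have "{p\<in>{n - l<..n}. p < m} = {n - l<..m - 1}" using assms by auto
  then show ?thesis by (simp add: nbefore_def)
qed

lemma step_weight_0_0 [simp]: "step_weight B s 0 v = 0"
  by (auto simp: step_weight_def black_step_def red_step_def)

text \<open>The gates at the last places exclude only states from which the total is out of reach,
  because each remaining position completes at most one block.\<close>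

lemma glide_path_final:
  assumes "strong_composition a" "length a \<le> n"
  shows "glide_path a {n - length a<..n} n (sum_list a)
    = path_poly (bounds a) (\<lambda>_. True) (\<lambda>_ _. True) n (sum_list a)"
proof -
  let ?k = "n - length a"
  let ?G = "path_poly (bounds a) (\<lambda>_. True) (\<lambda>m t. psum a (nbefore {?k<..n} m) < t)"
  let ?F = "path_poly (bounds a) (\<lambda>_. True) (\<lambda>_ _. True)"
  have "m \<le> n \<Longrightarrow> psum a (m - ?k) \<le> t \<Longrightarrow> ?G m t = ?F m t" for m t
  proof (induction m arbitrary: t)
    case (Suc m)
    have nb: "nbefore {?k<..n} (Suc m) = m - ?k" using Suc.prems assms by (simp add: nbefore_final)
    have ml: "m - ?k \<le> length a" using Suc.prems by simp
    have le: "psum a (m - ?k) \<le> psum a (Suc m - ?k)" by (rule psum_mono) simp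
    \<comment> \<open>At \<open>t = 0\<close> the gate makes no difference, since no step of nonzero
      weight leads to 0.\<close>
    have gate: "t = 0 \<or> psum a (m - ?k) < t"
    proof (cases "m < ?k")
      case False
      then have "psum a (m - ?k) < psum a (Suc m - ?k)" using Suc.prems assms by (intro psum_less) auto
      then show ?thesis using Suc.prems by simp
    qed auto
    have "?G m s * step_weight (bounds a) s t (X (Suc m)) = ?F m s
      * step_weight (bounds a) s t (X (Suc m))"
      if "psum a (m - ?k) < t" for s
      using Suc.IH [of s] Suc.prems step_weight_eq_0 [OF psum_in_bounds [OF ml] _ that]
      by (cases "s < psum a (m - ?k)") auto
    then show ?case using gate Suc le by (auto simp: nb intro!: sum.cong)
  qed simp
  then show ?thesis using assms by (simp add: glide_path_def)
qed

section \<open>Inversions and reduced words\<close>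

definition inversions_in :: "(nat \<times> nat) set \<Rightarrow> (nat \<Rightarrow> nat) \<Rightarrow> nat" where
  "inversions_in D u = card {(p, q)\<in>D. u q < u p}"

lemma word_perm_Nil [simp]: "word_perm [] = id"
  and word_perm_Cons [simp]: "word_perm (i # is) = transpose i (Suc i) \<circ> word_perm is"
  by (simp_all add: word_perm_def)

lemma word_perm_permutes: "set is \<subseteq> {1..<n} \<Longrightarrow> word_perm is permutes {1..n}"
proof (induction "is")
  case (Cons i "is")
  then have "transpose i (Suc i) permutes {1..n}" by (intro permutes_swap_id) auto
  then show ?case unfolding word_perm_Cons by (intro permutes_compose) (use Cons in auto)
qed (simp add: permutes_id)

lemma word_perm_append: "word_perm (is @ js) = word_perm is \<circ> word_perm js"
  by (induction "is") (simp_all add: comp_assoc)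

lemma word_perm_rev: "word_perm (rev is) \<circ> word_perm is = id"
  by (induction "is") (auto simp: word_perm_append fun_eq_iff transpose_involutory)

lemma inv_word_perm: "inv (word_perm is) = word_perm (rev is)"
  by (rule inv_unique_comp) (use word_perm_rev [of "is"] word_perm_rev [of "rev is"] in simp_all)

lemma transpose_less_iff:
  assumes "x < y" "transpose i (Suc i) y < transpose i (Suc i) x"
  shows "x = i" "y = Suc i"
  using assms by (auto simp: transpose_def split: if_splits)

text \<open>Composing on the left reverses only the values i and i + 1, so only the pair of places
  holding them can become an inversion.\<close>

lemma inversions_in_transpose:
  assumes u: "u permutes {1..n}" and D: "finite D" "\<And>p q. (p, q) \<in> D \<Longrightarrow> p < q"
  shows "inversions_in D (transpose i (Suc i) \<circ> u) \<le> Suc (inversions_in D u)"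
    and "inversions_in D u < inversions_in D (transpose i (Suc i) \<circ> u) \<Longrightarrow> (inv u i, inv u (Suc i)) \<in> D"
proof -
  let ?t = "transpose i (Suc i)"
  let ?I = "{(p, q)\<in>D. u q < u p}" and ?J = "{(p, q)\<in>D. (?t \<circ> u) q < (?t \<circ> u) p}"
  have J: "?J \<subseteq> insert (inv u i, inv u (Suc i)) ?I"
  proof (clarsimp simp del: not_less)
    fix p q assume pq: "(p, q) \<in> D" "?t (u q) < ?t (u p)"
    show "u q < u p" if n: "p = inv u i \<longrightarrow> q \<noteq> inv u (Suc i)"
    proof (rule ccontr)
      assume "\<not> u q < u p"
      moreover have "u p \<noteq> u q" using pq by auto
      ultimately have "u p < u q" by simp
      from transpose_less_iff [OF this pq(2)] have "u p = i" "u q = Suc i" .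
      then show False using u n by (metis permutes_inverses(2))
    qed
  qed
  have fI: "finite ?I" by (rule finite_subset [OF _ D(1)]) auto
  have "card ?J \<le> card (insert (inv u i, inv u (Suc i)) ?I)" using J fI by (intro card_mono) auto
  also have "\<dots> \<le> Suc (card ?I)" using fI by (simp add: card_insert_if)
  finally show "inversions_in D (?t \<circ> u) \<le> Suc (inversions_in D u)" by (simp add: inversions_in_def)
  assume *: "inversions_in D u < inversions_in D (?t \<circ> u)"
  show "(inv u i, inv u (Suc i)) \<in> D"
  proof (rule ccontr)
    assume "(inv u i, inv u (Suc i)) \<notin> D"
    then have "?J \<subseteq> ?I" using J by auto
    then have "card ?J \<le> card ?I" by (rule card_mono [OF fI])
    then show False using * by (simp add: inversions_in_def)
  qed
qed

lemma inversions_in_le_length: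
  assumes "finite D" "\<And>p q. (p, q) \<in> D \<Longrightarrow> p < q" "set is \<subseteq> {1..<n}"
  shows "inversions_in D (word_perm is) \<le> length is"
  using assms(3)
proof (induction "is")
  case Nil
  have "{(p, q)\<in>D. id q < id p} = {}" using assms(2) by (auto dest: order.asym)
  then show ?case by (simp only: inversions_in_def word_perm_Nil card.empty)
next
  case (Cons i "is")
  then show ?case
    using inversions_in_transpose(1) [OF word_perm_permutes [of "is" n] assms(1,2), of i]
    by (simp add: comp_def)
qed

text \<open>The bound of \<open>inversions_in_le_length\<close> is attained only if every letter
  adds an inversion in \<open>D\<close>. The shorter word inherits this, so the argument can be
  repeated letter by letter.\<close>

lemma inversions_in_word_step:
  assumes "finite D" "\<And>p q. (p, q) \<in> D \<Longrightarrow> p < q" "set (i # is) \<subseteq> {1..<n}"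
    and "length (i # is) = inversions_in D (word_perm (i # is))"
  shows "length is = inversions_in D (word_perm is)"
    "(inv (word_perm is) i, inv (word_perm is) (Suc i)) \<in> D"
proof -
  have "word_perm is permutes {1..n}" using assms(3) by (intro word_perm_permutes) auto
  note T = inversions_in_transpose [OF this assms(1,2), of i]
  have "inversions_in D (word_perm is) \<le> length is"
    using assms by (intro inversions_in_le_length) auto
  then show "length is = inversions_in D (word_perm is)"
    "(inv (word_perm is) i, inv (word_perm is) (Suc i)) \<in> D"
    using T assms(4) by auto
qed

section \<open>Length and number of inversions\<close>

definition upper_pairs :: "nat \<Rightarrow> (nat \<times> nat) set" where
  "upper_pairs n = {(p, q). 1 \<le> p \<and> p < q \<and> q \<le> n}"

lemma finite_upper_pairs: "finite (upper_pairs n)"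
  by (rule finite_subset [of _ "{1..n} \<times> {1..n}"]) (auto simp: upper_pairs_def)

lemma increasing_permutes_id:
  fixes v :: "nat \<Rightarrow> nat"
  assumes v: "v permutes {1..n}" and inc: "\<And>i. i \<in> {1..<n} \<Longrightarrow> v i < v (Suc i)"
  shows "v = id"
proof -
  have "k \<le> n \<longrightarrow> k \<le> v k" for k
  proof (induction k)
    case (Suc k)
    show ?case
    proof (cases "k = 0")
      case True
      then show ?thesis using permutes_in_image [OF v, of 1] by auto
    next
      case False
      then show ?thesis using inc [of k] Suc by fastforce
    qed
  qed simp
  then show ?thesis using permutes_natset_ge [OF v] by auto
qed

text \<open>As long as some values i and i + 1 stand in the wrong order, exchanging them lowers the
  number of inversions. When none are left, the inverse is increasing, hence the identity.\<close>

lemma ex_word_le_inversions: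
  assumes "w permutes {1..n}"
  shows "\<exists>is. is_word_of n w is \<and> length is \<le> inversions_in (upper_pairs n) w"
  using assms
proof (induction "inversions_in (upper_pairs n) w" arbitrary: w rule: less_induct)
  case less
  show ?case
  proof (cases "\<exists>i\<in>{1..<n}. inv w (Suc i) < inv w i")
    case False
    have vi: "inv w permutes {1..n}" using less.prems by (rule permutes_inv)
    have "inv w = id"
    proof (rule increasing_permutes_id [OF vi])
      fix i assume "i \<in> {1..<n}"
      moreover have "inv w i \<noteq> inv w (Suc i)" using permutes_inj [OF vi] by (metis injD n_not_Suc_n)
      ultimately show "inv w i < inv w (Suc i)" using False by (meson linorder_neqE_nat)
    qed
    then have "w = id" using less.prems by (metis inv_id permutes_inv_inv)
    then have "is_word_of n w []" by (simp add: is_word_of_def)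
    then show ?thesis by fastforce
  next
    case True
    then obtain i where i: "i \<in> {1..<n}" "inv w (Suc i) < inv w i" by auto
    let ?t = "transpose i (Suc i)"
    let ?I = "{(p, q)\<in>upper_pairs n. w q < w p}" and ?J
      = "{(p, q)\<in>upper_pairs n. (?t \<circ> w) q < (?t \<circ> w) p}"
    have tp: "?t permutes {1..n}" using i by (intro permutes_swap_id) auto
    have inv_in: "inv w k \<in> {1..n}" if "k \<in> {1..n}" for k
      using permutes_in_image [OF permutes_inv [OF less.prems]] that by simp
    have ww: "w (inv w k) = k" for k using less.prems by (simp add: permutes_inverses)
    have "(inv w (Suc i), inv w i) \<in> ?I - ?J"
      using i inv_in [of i] inv_in [of "Suc i"] by (auto simp: upper_pairs_def ww)
    moreover have "?J \<subseteq> ?I"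
    proof clarsimp
      fix p q assume pq: "(p, q) \<in> upper_pairs n" "?t (w q) < ?t (w p)"
      show "w q < w p"
      proof (rule ccontr)
        assume n: "\<not> w q < w p"
        have "w p \<noteq> w q" using pq by auto
        then have "w p < w q" using n by simp
        from transpose_less_iff [OF this pq(2)] have "w p = i" "w q = Suc i" .
        then have "p = inv w i" "q = inv w (Suc i)" using less.prems by (metis permutes_inverses(2))+
        then show False using pq i by (simp add: upper_pairs_def)
      qed
    qed
    ultimately have "?J \<subset> ?I" by blast
    moreover have "finite ?I" by (rule finite_subset [OF _ finite_upper_pairs [of n]]) auto
    ultimately have lt: "inversions_in (upper_pairs n) (?t \<circ> w) < inversions_in (upper_pairs n) w"
      unfolding inversions_in_def by (rule psubset_card_mono [rotated])
    from less.hyps [OF lt permutes_compose [OF less.prems tp]]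
    obtain "is" where w: "is_word_of n (?t \<circ> w) is"
      "length is \<le> inversions_in (upper_pairs n) (?t \<circ> w)" by blast
    then have "is_word_of n w (i # is)"
      using i by (auto simp: is_word_of_def fun_eq_iff)
    then show ?thesis using w lt by (intro exI [of _ "i # is"]) simp
  qed
qed

lemma perm_length_le: "is_word_of n w is \<Longrightarrow> perm_length n w \<le> length is"
  unfolding perm_length_def by (rule Least_le) blast

lemma ex_reduced_word:
  assumes "w permutes {1..n}" shows "\<exists>is. reduced_word n w is"
  using ex_word_le_inversions [OF assms] LeastI_ex [of "\<lambda>k. \<exists>is. is_word_of n w is \<and> length is = k"]
  unfolding reduced_word_def perm_length_def by blast

lemma perm_length_inv:
  assumes "w permutes {1..n}"
  shows "perm_length n (inv w) \<le> perm_length n w"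
proof -
  obtain "is" where "reduced_word n w is" using ex_reduced_word [OF assms] by blast
  then have "is_word_of n (inv w) (rev is)" "length is = perm_length n w"
    by (auto simp: reduced_word_def is_word_of_def inv_word_perm)
  then show ?thesis using perm_length_le by fastforce
qed

lemma perm_length_ge:
  assumes "finite D" "\<And>p q. (p, q) \<in> D \<Longrightarrow> p < q" "w permutes {1..n}"
  shows "inversions_in D w \<le> perm_length n w"
proof -
  obtain "is" where "reduced_word n w is" using ex_reduced_word [OF assms(3)] by blast
  then show ?thesis
    using inversions_in_le_length [OF assms(1,2), of "is" n]
      by (auto simp: reduced_word_def is_word_of_def)
qed

lemma op_perm_reduced_word:
  assumes "w permutes {1..n}"
  obtains "is" where "reduced_word n w is" "op_perm T n w = foldr T is"
  using someI_ex [OF ex_reduced_word [OF assms]] unfolding op_perm_def by blast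

text \<open>The length is at most the number of pairs, and the reversal \<open>r\<close> attains
  this; a permutation of maximal length therefore inverts every pair.\<close>

lemma longest_perm:
  "longest_perm n permutes {1..n}"
  "reduced_word n (longest_perm n) is \<Longrightarrow> length is = inversions_in (upper_pairs n) (longest_perm n)"
  "p \<in> {1..n} \<Longrightarrow> q \<in> {1..n} \<Longrightarrow> p < q \<Longrightarrow> longest_perm n q < longest_perm n p"
proof -
  let ?D = "upper_pairs n" and ?w = "longest_perm n"
  have D: "\<And>p q. (p, q) \<in> ?D \<Longrightarrow> p < q" by (simp add: upper_pairs_def)
  have bound: "inversions_in ?D w \<le> card ?D" for w
    unfolding inversions_in_def by (rule card_mono [OF finite_upper_pairs]) auto
  have len: "perm_length n w \<le> inversions_in ?D w" if "w permutes {1..n}" for w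
    using ex_word_le_inversions [OF that] perm_length_le by fastforce
  define r where "r = (\<lambda>i. if i \<in> {1..n} then n + 1 - i else i)"
  have r: "r permutes {1..n}"
    by (rule bij_imp_permutes)
      (auto simp: r_def intro!: bij_betw_byWitness [where f' = "\<lambda>i. n + 1 - i"])
  have "{(p, q)\<in>?D. r q < r p} = ?D" by (auto simp: upper_pairs_def r_def)
  then have "card ?D \<le> perm_length n r"
    using perm_length_ge [where D = ?D, OF finite_upper_pairs D r] by (simp add: inversions_in_def)
  moreover have w: "?w permutes {1..n} \<and> (\<forall>v. v permutes {1..n} \<longrightarrow> perm_length n v \<le> perm_length n ?w)"
    unfolding longest_perm_def
  proof (rule arg_max_nat_lemma [where P = "\<lambda>w. w permutes {1..n}", OF r])
    have "perm_length n v < Suc (card ?D)" if "v permutes {1..n}" for v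
      using len [OF that] bound [of v] by simp
    then show "\<forall>v. v permutes {1..n} \<longrightarrow> perm_length n v < Suc (card ?D)" by blast
  qed
  ultimately have "card ?D \<le> perm_length n ?w" using r by (meson order_trans)
  moreover show wp: "?w permutes {1..n}" using w by blast
  ultimately have *: "perm_length n ?w = inversions_in ?D ?w" "card ?D = inversions_in ?D ?w"
    using len [OF wp] bound [of ?w] by simp_all
  show "length is = inversions_in ?D ?w" if "reduced_word n ?w is"
    using that * by (simp add: reduced_word_def)
  have "{(p, q)\<in>?D. ?w q < ?w p} = ?D"
    by (rule card_subset_eq [OF finite_upper_pairs]) (use *(2) in \<open>auto simp: inversions_in_def\<close>)
  then show "?w q < ?w p" if "p \<in> {1..n}" "q \<in> {1..n}" "p < q"
    using that unfolding upper_pairs_def by auto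
qed

section \<open>Multifundamental sequences as paths\<close>

text \<open>The Boolean component tells whether the entry is red.\<close>

definition steps :: "nat set \<Rightarrow> bool \<Rightarrow> bool \<Rightarrow> nat \<Rightarrow> (nat \<times> bool) set" where
  "steps B z c t = {(s, r). if r then c \<and> red_step B s t else z \<and> s = t \<or> c \<and> black_step B s t}"

section \<open>The recursion of path polynomials by the last step\<close>

lemma steps_le: "(s, r) \<in> steps B z c t \<Longrightarrow> s \<le> t"
  by (auto simp: steps_def black_step_def red_step_def split: if_splits)

text \<open>A red entry belongs to a block opened before, so it cannot occur in state 0. For
  \<open>extend_seq\<close> this ensures that a preceding set exists.\<close>

lemma steps_pos: "(s, True) \<in> steps B z c t \<Longrightarrow> 0 < s"
  by (auto simp: steps_def red_step_def)

text \<open>A zero entry is the non-red case \<open>s = t\<close>, of weight 1. It does not clash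
  with a black entry, which raises the state.\<close>

lemma path_poly_Suc_steps:
  "path_poly B z c (Suc m) t = (\<Sum>(s, r)\<in>steps B (z (Suc m)) (c (Suc m) t) t.
     path_poly B z c m s * (beta ^ of_bool r * X (Suc m) ^ (t - s + of_bool r)))"
proof -
  let ?S = "steps B (z (Suc m)) (c (Suc m) t) t"
  let ?G = "path_poly B z c m"
  let ?f = "\<lambda>(s, r). ?G s * (beta ^ of_bool r * X (Suc m) ^ (t - s + of_bool r))"
  have "sum ?f ?S = (\<Sum>p\<in>{..t} \<times> UNIV. if p \<in> ?S then ?f p else 0)"
    by (rule sum.mono_neutral_cong_left) (auto dest: steps_le)
  also have "\<dots> = (\<Sum>s\<le>t. \<Sum>r\<in>UNIV. if (s, r) \<in> ?S then ?f (s, r) else 0)"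
    by (simp add: sum.cartesian_product)
  also have "\<dots> = (\<Sum>s\<le>t. (if z (Suc m) \<and> s = t then ?G t else 0) +
      (if c (Suc m) t then ?G s * step_weight B s t (X (Suc m)) else 0))"
  proof (rule sum.cong)
    fix s assume "s \<in> {..t}"
    then have "Suc t - s = Suc (t - s)" by auto
    then show "(\<Sum>r\<in>UNIV. if (s, r) \<in> ?S then ?f (s, r) else 0)
      = (if z (Suc m) \<and> s = t then ?G t else 0) +
      (if c (Suc m) t then ?G s * step_weight B s t (X (Suc m)) else 0)"
      by (auto simp: UNIV_bool steps_def step_weight_def black_step_def distrib_left)
  qed simp
  also have "\<dots> = path_poly B z c (Suc m) t"
    by (simp add: sum.distrib sum.delta if_distrib [of "\<lambda>x. sum x _"] cong: conj_cong if_cong)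
  finally show ?thesis by (simp add: case_prod_unfold)
qed

text \<open>Objects built uniquely by one step per position, with multiplicative weights, satisfy
  the recursion of path polynomials. The objects will be sequences of sets and colored
  sequences.\<close>

lemma sum_eq_path_poly:
  fixes C :: "nat \<Rightarrow> nat \<Rightarrow> 'a set" and W :: "'a \<Rightarrow> mpol"
  assumes C0: "\<And>t. C 0 t = (if t = 0 then {e} else {})" and W0: "W e = 1"
    and fin: "\<And>m t. finite (C m t)"
    and bij: "\<And>m t. bij_betw (\<lambda>((s, r), x). g m t s r x)
        (SIGMA (s, r):steps B (z (Suc m)) (c (Suc m) t) t. C m s) (C (Suc m) t)"
    and W: "\<And>m t s r x. (s, r) \<in> steps B (z (Suc m)) (c (Suc m) t) t \<Longrightarrow> x \<in> C m s \<Longrightarrow>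
        W (g m t s r x) = W x * (beta ^ of_bool r * X (Suc m) ^ (t - s + of_bool r))"
  shows "(\<Sum>x\<in>C m t. W x) = path_poly B z c m t"
proof (induction m arbitrary: t)
  case 0
  then show ?case by (simp add: C0 W0)
next
  case (Suc m)
  let ?S = "steps B (z (Suc m)) (c (Suc m) t) t"
  have finS: "finite ?S"
    by (rule finite_subset [of _ "{..t} \<times> UNIV"]) (auto dest: steps_le)
  have "(\<Sum>x\<in>C (Suc m) t. W x) = (\<Sum>p\<in>(SIGMA (s, r):?S. C m s). W ((\<lambda>((s, r), x). g m t s r x) p))"
    by (rule sum.reindex_bij_betw [OF bij, symmetric])
  also have "\<dots> = (\<Sum>q\<in>?S. \<Sum>x\<in>C m (fst q). W (g m t (fst q) (snd q) x))"
    by (subst sum.Sigma) (use finS fin in \<open>auto intro: sum.cong\<close>)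
  also have "\<dots> = (\<Sum>(s, r)\<in>?S. path_poly B z c m s
    * (beta ^ of_bool r * X (Suc m) ^ (t - s + of_bool r)))"
    by (rule sum.cong) (auto simp: W simp flip: Suc sum_distrib_right)
  finally show ?case by (simp only: path_poly_Suc_steps)
qed

section \<open>Sequences of sets, built by adding the largest value\<close>

lemma prod_list_map_eq_prod: "(\<Prod>x\<leftarrow>xs. f x) = (\<Prod>i<length xs. f (xs ! i))"
  by (induction xs rule: rev_induct) (auto simp: nth_append intro!: prod.cong)

text \<open>The state is the number of sets. Lists are numbered from 0, so the boundary
  \<open>Suc i\<close> lies between the entries \<open>i\<close> and \<open>Suc i\<close>. The
  conditions are elementwise in place of maxima and minima.\<close>

definition multi_seqs :: "nat set \<Rightarrow> nat \<Rightarrow> nat \<Rightarrow> nat set list set" where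
  "multi_seqs B m t = {S. length S = t \<and> (\<forall>i<t. S ! i \<noteq> {} \<and> S ! i \<subseteq> {1..m}) \<and>
     (\<forall>i. Suc i < t \<longrightarrow> (\<forall>x\<in>S ! i. \<forall>y\<in>S ! Suc i. x \<le> y \<and> (Suc i \<in> B \<longrightarrow> x < y)))}"

text \<open>The power of \<beta> is distributed over the sets, each receiving its own
  excess.\<close>

definition set_weight :: "nat set \<Rightarrow> mpol" where
  "set_weight T = beta ^ (card T - 1) * (\<Prod>j\<in>T. X j)"

text \<open>
  The value \<open>m + 1\<close> is put into all sets from index \<open>s\<close> on, and in the red case also into the set before
  them, which already contains smaller elements.
\<close>

definition extend_seq :: "nat \<Rightarrow> nat \<Rightarrow> nat \<Rightarrow> bool \<Rightarrow> nat set list \<Rightarrow> nat set list" where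
  "extend_seq m t s r S = map (\<lambda>i. (if i < s then S ! i else {}) \<union> (if s - of_bool r \<le> i
    then {Suc m} else {})) [0..<t]"

text \<open>The sets equal to \<open>{Suc m}\<close> form the end of the list, so the number of the
  others tells where they begin. Red means that the last of the others contains \<open>Suc m\<close>
  too.\<close>

definition restrict_seq :: "nat \<Rightarrow> nat set list \<Rightarrow> (nat \<times> bool) \<times> nat set list" where
  "restrict_seq m L = (let s = card {i. i < length L \<and> L ! i \<noteq> {Suc m}} in
     ((s, 0 < s \<and> Suc m \<in> L ! (s - 1)), map (\<lambda>T. T - {Suc m}) (take s L)))"

lemma finite_multi_seqs: "finite (multi_seqs B m t)"
proof (rule finite_subset)
  show "multi_seqs B m t \<subseteq> {S. set S \<subseteq> Pow {1..m} \<and> length S = t}"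
    unfolding multi_seqs_def by (auto simp only: in_set_conv_nth) (simp_all add: subset_iff)
  show "finite {S. set S \<subseteq> Pow {1..m} \<and> length S = t}"
    by (rule finite_lists_length_eq) simp
qed

text \<open>Nothing exceeds \<open>Suc m\<close>, so later sets can only repeat it and no strict
  inequality is possible.\<close>

lemma multi_seqs_top:
  assumes L: "L \<in> multi_seqs B (Suc m) t" and i: "Suc m \<in> L ! i"
  shows "i < j \<Longrightarrow> j < t \<Longrightarrow> L ! j = {Suc m} \<and> j \<notin> B"
proof (induction j)
  case (Suc j)
  have M: "Suc m \<in> L ! j" using Suc i by (cases "i = j") auto
  have "L ! Suc j \<noteq> {}" "L ! Suc j \<subseteq> {1..Suc m}"
    and *: "\<And>y. y \<in> L ! Suc j \<Longrightarrow> Suc m \<le> y \<and> (Suc j \<in> B \<longrightarrow> Suc m < y)"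
    using L Suc.prems M by (auto simp: multi_seqs_def)
  moreover from this have "L ! Suc j \<subseteq> {Suc m}" by fastforce
  ultimately have "L ! Suc j = {Suc m}" by blast
  then show ?case using * by auto
qed simp

lemma extend_seq_nth:
  "i < t \<Longrightarrow> extend_seq m t s r S ! i = (if i < s then S ! i else {}) \<union> (if s - of_bool r \<le> i
    then {Suc m} else {})"
  by (simp add: extend_seq_def)

lemma length_extend_seq [simp]: "length (extend_seq m t s r S) = t"
  by (simp add: extend_seq_def)

lemma extend_seq_in:
  assumes st: "(s, r) \<in> steps B True True t" and S: "S \<in> multi_seqs B m s"
  shows "extend_seq m t s r S \<in> multi_seqs B (Suc m) t"
proof -
  have s: "s \<le> t" using steps_le [OF st] .
  have S1: "S ! i \<noteq> {}" "S ! i \<subseteq> {1..m}" if "i < s" for i using S that by (auto simp: multi_seqs_def)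
  have S2: "x \<le> y \<and> (Suc i \<in> B \<longrightarrow> x < y)" if "Suc i < s" "x \<in> S ! i" "y \<in> S ! Suc i" for i x y
    using S that by (auto simp: multi_seqs_def)
  have "x \<le> y \<and> (Suc i \<in> B \<longrightarrow> x < y)"
    if i: "Suc i < t" and x: "x \<in> extend_seq m t s r S ! i"
      and y: "y \<in> extend_seq m t s r S ! Suc i" for i x y
  proof (cases "Suc i < s")
    case True
    then have x': "x \<in> S ! i" using x i by (cases r) (auto simp: extend_seq_nth split: if_splits)
    then have "x \<le> m" using S1(2) [of i] True by auto
    moreover have "y \<in> S ! Suc i \<or> y = Suc m" using y i by (auto simp: extend_seq_nth split: if_splits)
    ultimately show ?thesis using S2 [OF True x'] by auto
  next
    case False
    then have y: "y = Suc m" using y i by (auto simp: extend_seq_nth split: if_splits)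
    have x1: "x \<le> Suc m" using x i S1(2) [of i] by (auto simp: extend_seq_nth split: if_splits)
    have "x \<le> m" if b: "Suc i \<in> B"
    proof -
      \<comment> \<open>Red steps allow no boundary from \<open>s\<close> on and black steps none
        after \<open>s\<close>. The only one left is \<open>s\<close> itself in the non-red case,
        where the set before it is unchanged.\<close>
      have nr: "\<not> r" using st b False i by (auto simp: steps_def red_step_def)
      moreover have "Suc i = s" using st b False i nr by (auto simp: steps_def black_step_def)
      ultimately show ?thesis using x i S1(2) [of i] by (auto simp: extend_seq_nth split: if_splits)
    qed
    then show ?thesis using x1 y by auto
  qed
  moreover have "extend_seq m t s r S ! i \<noteq> {} \<and> extend_seq m t s r S ! i \<subseteq> {1..Suc m}" if "i < t" for i
    using S1 [of i] that by (force simp: extend_seq_nth)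
  ultimately show ?thesis by (simp add: multi_seqs_def)
qed

lemma restrict_extend_seq:
  assumes st: "(s, r) \<in> steps B True True t" and S: "S \<in> multi_seqs B m s"
  shows "restrict_seq m (extend_seq m t s r S) = ((s, r), S)"
proof -
  have s: "s \<le> t" using steps_le [OF st] .
  have S1: "S ! i \<noteq> {}" "S ! i \<subseteq> {1..m}" if "i < s" for i using S that by (auto simp: multi_seqs_def)
  have len: "length S = s" using S by (simp add: multi_seqs_def)
  have ne: "Suc m \<notin> S ! i" if "i < s" for i using S1(2) [OF that] by auto
  have "extend_seq m t s r S ! i \<noteq> {Suc m} \<longleftrightarrow> i < s" if "i < t" for i
  proof (cases "i < s")
    case True
    then obtain x where "x \<in> S ! i" "x \<noteq> Suc m" using S1(1) ne by blast
    then have "extend_seq m t s r S ! i \<noteq> {Suc m}" using that True by (auto simp: extend_seq_nth)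
    then show ?thesis using True by simp
  qed (use that in \<open>simp add: extend_seq_nth\<close>)
  then have "{i. i < t \<and> extend_seq m t s r S ! i \<noteq> {Suc m}} = {..<s}"
    using s less_le_trans by blast
  then have c: "card {i. i < t \<and> extend_seq m t s r S ! i \<noteq> {Suc m}} = s" by simp
  have r: "(0 < s \<and> Suc m \<in> extend_seq m t s r S ! (s - 1)) = r"
    using s ne [of "s - 1"] steps_pos [of s B True True t] st
      by (cases r) (auto simp: extend_seq_nth split: if_splits)
  have "map (\<lambda>T. T - {Suc m}) (take s (extend_seq m t s r S)) = S"
    by (rule nth_equalityI) (use s len ne in \<open>auto simp: extend_seq_nth\<close>)
  then show ?thesis using c r by (simp add: restrict_seq_def Let_def)
qed

lemma restrict_seq_in:
  assumes L: "L \<in> multi_seqs B (Suc m) t"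
  obtains s r S where "restrict_seq m L = ((s, r), S)" "(s, r) \<in> steps B True True t"
    "S \<in> multi_seqs B m s" "extend_seq m t s r S = L"
proof -
  note top = multi_seqs_top [OF L]
  have len: "length L = t" and L1: "\<And>i. i < t \<Longrightarrow> L ! i \<noteq> {} \<and> L ! i \<subseteq> {1..Suc m}"
    and L2: "\<And>i x y. Suc i < t \<Longrightarrow> x \<in> L ! i \<Longrightarrow> y \<in> L ! Suc i \<Longrightarrow> x \<le> y \<and> (Suc i \<in> B \<longrightarrow> x < y)"
    using L by (auto simp: multi_seqs_def)
  define A where "A = {i. i < t \<and> L ! i \<noteq> {Suc m}}"
  define s where "s = card A"
  \<comment> \<open>By \<open>multi_seqs_top\<close> the sets other than \<open>{Suc m}\<close> form
    an initial segment, so \<open>A\<close> is determined by its size.\<close>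
  have down: "i \<in> A" if "j \<in> A" "i < j" for i j
    using that top [of i j] by (auto simp: A_def)
  have finA: "finite A" by (simp add: A_def)
  have A: "A = {..<s}"
  proof (cases "A = {}")
    case False
    then have "Max A \<in> A" using finA by simp
    then have "A = {..Max A}" using down finA Max_ge [OF finA] by (auto simp: le_less)
    then have "A = {..<Suc (Max A)}" by (simp add: lessThan_Suc_atMost)
    then show ?thesis unfolding s_def by (metis card_lessThan)
  qed (simp add: s_def)
  have st: "s \<le> t"
  proof -
    have "A \<subseteq> {..<t}" by (auto simp: A_def)
    then show ?thesis unfolding A by simp
  qed
  have lo: "L ! i \<noteq> {Suc m}" if "i < s" for i using that A by (auto simp: A_def)
  have hi: "L ! i = {Suc m}" if "s \<le> i" "i < t" for i
  proof (rule ccontr)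
    assume "L ! i \<noteq> {Suc m}"
    then have "i \<in> A" using that by (simp add: A_def)
    then show False using that A by simp
  qed
  define r where "r \<longleftrightarrow> 0 < s \<and> Suc m \<in> L ! (s - 1)"
  define S where "S = map (\<lambda>T. T - {Suc m}) (take s L)"
  have eq: "restrict_seq m L = ((s, r), S)"
    by (simp add: restrict_seq_def Let_def len S_def r_def s_def A_def)
  have lenS: "length S = s" and S: "\<And>i. i < s \<Longrightarrow> S ! i = L ! i - {Suc m}"
    using len st by (simp_all add: S_def)
  have "(s, r) \<in> steps B True True t"
  proof (cases r)
    case True
    \<comment> \<open>The set with index \<open>s - 1\<close> already contains \<open>Suc m\<close>,
      which excludes \<open>s\<close> as a boundary as well.\<close>
    then have "b \<notin> B" if "s \<le> b" "b < t" for b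
      using top [of "s - 1" b] that True less_le_trans [of "s - 1" s b] by (auto simp: r_def)
    then show ?thesis using True st by (auto simp: steps_def red_step_def r_def)
  next
    case False
    have "b \<notin> B" if "s < b" "b < t" for b
      using top [of s b] hi [of s] that by auto
    then show ?thesis using False st by (auto simp: steps_def black_step_def)
  qed
  moreover have "S \<in> multi_seqs B m s"
  proof -
    have "S ! i \<noteq> {} \<and> S ! i \<subseteq> {1..m}" if "i < s" for i
      using L1 [of i] lo [OF that] that st unfolding S [OF that] by (auto simp: subset_iff le_Suc_eq)
    moreover have "x \<le> y \<and> (Suc i \<in> B \<longrightarrow> x < y)"
      if i: "Suc i < s" and "x \<in> S ! i" "y \<in> S ! Suc i" for i x y
      using that st S [of i] S [of "Suc i"] by (intro L2) auto
    ultimately show ?thesis using lenS by (simp add: multi_seqs_def)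
  qed
  moreover have "extend_seq m t s r S = L"
  proof (rule nth_equalityI)
    fix i assume "i < length (extend_seq m t s r S)"
    then have i: "i < t" by simp
    show "extend_seq m t s r S ! i = L ! i"
    proof (cases "i < s")
      case False
      then show ?thesis using hi [of i] i by (simp add: extend_seq_nth)
    next
      case True
      have "s - of_bool r \<le> i \<longleftrightarrow> Suc m \<in> L ! i"
      proof
        assume "s - of_bool r \<le> i"
        then have "r" "i = s - 1" using True by (cases r; auto)+
        then show "Suc m \<in> L ! i" by (simp add: r_def)
      next
        assume M: "Suc m \<in> L ! i"
        \<comment> \<open>An earlier occurrence would make the set with index \<open>s - 1\<close>
          equal to \<open>{Suc m}\<close>, against the choice of \<open>s\<close>.\<close>
        have "\<not> i < s - 1"
        proof
          assume *: "i < s - 1"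
          then have "s - 1 < t" "s - 1 < s" using st by linarith+
          then show False using top [OF M *] lo by blast
        qed
        then have "i = s - 1" using True by simp
        then show "s - of_bool r \<le> i" using M True by (simp add: r_def)
      qed
      then show ?thesis using i True by (auto simp: extend_seq_nth S)
    qed
  qed (simp add: len)
  ultimately show thesis using that eq by blast
qed

lemma bij_betw_extend_seq:
  "bij_betw (\<lambda>((s, r), S). extend_seq m t s r S)
     (SIGMA (s, r):steps B True True t. multi_seqs B m s) (multi_seqs B (Suc m) t)"
proof (rule bij_betw_byWitness [where f' = "restrict_seq m"])
  show "\<forall>L\<in>multi_seqs B (Suc m) t. (\<lambda>((s, r), S). extend_seq m t s r S) (restrict_seq m L) = L"
    by (auto elim: restrict_seq_in)
  show "restrict_seq m ` multi_seqs B (Suc m) t \<subseteq> (SIGMA (s, r):steps B True True t. multi_seqs B m s)"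
    by (force elim: restrict_seq_in)
qed (auto simp: restrict_extend_seq extend_seq_in)

lemma set_weight_singleton [simp]: "set_weight {j} = X j"
  by (simp add: set_weight_def)

lemma set_weight_insert:
  assumes "finite T" "T \<noteq> {}" "j \<notin> T"
  shows "set_weight (insert j T) = set_weight T * beta * X j"
proof -
  have "card T = Suc (card T - 1)" using assms by (simp add: card_gt_0_iff)
  then have "beta ^ card T = beta * beta ^ (card T - 1)" by (metis power_Suc)
  then show ?thesis using assms by (simp add: set_weight_def mult_ac)
qed

lemma set_weight_extend_seq:
  assumes st: "(s, r) \<in> steps B True True t" and S: "S \<in> multi_seqs B m s"
  shows "(\<Prod>T\<leftarrow>extend_seq m t s r S. set_weight T)
    = (\<Prod>T\<leftarrow>S. set_weight T) * (beta ^ of_bool r * X (Suc m) ^ (t - s + of_bool r))"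
proof -
  have s: "s \<le> t" using steps_le [OF st] .
  have S1: "S ! i \<noteq> {}" "finite (S ! i)" "Suc m \<notin> S ! i" if "i < s" for i
    using S that by (force simp: multi_seqs_def dest: finite_subset)+
  have len: "length S = s" using S by (simp add: multi_seqs_def)
  have sr: "of_bool r \<le> s" using st steps_pos by (cases r) (auto simp: Suc_le_eq)
  let ?k = "s - of_bool r"
  have "(\<Prod>T\<leftarrow>extend_seq m t s r S. set_weight T) = (\<Prod>i<t. set_weight (extend_seq m t s r S ! i))"
    by (simp add: prod_list_map_eq_prod)
  \<comment> \<open>The new value occurs t - s times alone and, in the red case, once more in the
    set with index \<open>s - 1\<close>, the only place that gains a factor \<beta>.\<close>
  also have "\<dots> = (\<Prod>i<t. (if i < s then set_weight (S ! i) else 1) *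
     ((if ?k \<le> i \<and> i < s then beta else 1) * (if ?k \<le> i then X (Suc m) else 1)))"
    by (rule prod.cong) (use S1 sr in \<open>auto simp: extend_seq_nth set_weight_insert mult_ac\<close>)
  also have "\<dots> = (\<Prod>i<t. if i < s then set_weight (S ! i) else 1) *
     ((\<Prod>i<t. if ?k \<le> i \<and> i < s then beta else 1) * (\<Prod>i<t. if ?k \<le> i then X (Suc m) else 1))"
    by (simp add: prod.distrib)
  also have "(\<Prod>i<t. if i < s then set_weight (S ! i) else 1) = (\<Prod>i<s. set_weight (S ! i))"
    by (rule prod.mono_neutral_cong_right) (use s in auto)
  also have "(\<Prod>i<t. if ?k \<le> i \<and> i < s then beta else 1) = (\<Prod>i\<in>{?k..<s}. beta)"
    by (rule prod.mono_neutral_cong_right) (use s in auto)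
  also have "(\<Prod>i<t. if ?k \<le> i then X (Suc m) else 1) = (\<Prod>i\<in>{?k..<t}. X (Suc m))"
    by (rule prod.mono_neutral_cong_right) (use s in auto)
  finally show ?thesis using s sr len
    by (simp add: prod_list_map_eq_prod)
qed

lemma sum_multi_seqs:
  "(\<Sum>S\<in>multi_seqs B m t. \<Prod>T\<leftarrow>S. set_weight T) = path_poly B (\<lambda>_. True) (\<lambda>_ _. True) m t"
proof (rule sum_eq_path_poly [where e = "[]" and g = extend_seq])
  show "multi_seqs B 0 t = (if t = 0 then {[]} else {})" for t
    by (auto simp: multi_seqs_def)
qed (simp_all add: finite_multi_seqs bij_betw_extend_seq set_weight_extend_seq)

text \<open>\<open>bounds\<close> has only the end points 0 and the total in addition, and these are
  outside the range of \<open>b\<close>.\<close>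

lemma comp_set_iff:
  assumes "strong_composition a" "1 \<le> b" "b < sum_list a"
  shows "b \<in> comp_set a \<longleftrightarrow> b \<in> bounds a"
proof
  assume "b \<in> bounds a"
  then obtain k where k: "b = psum a k" "k \<le> length a" by (auto simp: bounds_def)
  then have "k \<noteq> 0" "k \<noteq> length a" using assms
    by (metis psum_0 not_one_le_zero, metis psum_length nat_less_le)
  then show "b \<in> comp_set a" using k by (auto simp: comp_set_def psum_def intro!: exI [of _ k])
qed (auto simp: comp_set_def bounds_def psum_def)

lemma comp_set_range:
  assumes "strong_composition a" "b \<in> comp_set a"
  shows "1 \<le> b" "b < sum_list a"
proof -
  from assms(2) obtain k where k: "b = psum a k" "1 \<le> k" "k < length a"
    by (auto simp: comp_set_def psum_def)
  then show "1 \<le> b" "b < sum_list a"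
    using psum_less [OF assms(1), of 0 k] psum_less [OF assms(1), of k "length a"] by auto
qed

lemma multifund_seqs_eq:
  assumes a: "strong_composition a"
  shows "multifund_seqs a n = multi_seqs (bounds a) n (sum_list a)"
proof (rule set_eqI)
  fix S
  let ?N = "sum_list a"
  show "S \<in> multifund_seqs a n \<longleftrightarrow> S \<in> multi_seqs (bounds a) n ?N"
  proof (cases "length S = ?N \<and> (\<forall>i<?N. S ! i \<noteq> {} \<and> S ! i \<subseteq> {1..n})")
    case False
    then show ?thesis by (auto simp: multifund_seqs_def multi_seqs_def all_set_conv_all_nth)
  next
    case True
    then have fin: "finite (S ! i)" "S ! i \<noteq> {}" if "i < ?N" for i using that
      by (auto dest: finite_subset)
    have le: "Max (S ! i) \<le> Min (S ! Suc i) \<longleftrightarrow> (\<forall>x\<in>S ! i. \<forall>y\<in>S ! Suc i. x \<le> y)"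
      and less: "Max (S ! i) < Min (S ! Suc i) \<longleftrightarrow> (\<forall>x\<in>S ! i. \<forall>y\<in>S ! Suc i. x < y)" if "Suc i < ?N" for i
      using fin [of i] fin [of "Suc i"] that by auto
    have cs: "comp_set a = {b \<in> {1..<?N}. b \<in> bounds a}"
      using comp_set_iff [OF a] comp_set_range [OF a] by auto
    have shift: "(\<forall>b\<in>{1..<?N}. Q b) \<longleftrightarrow> (\<forall>i. Suc i < ?N \<longrightarrow> Q (Suc i))" for Q
    proof
      assume *: "\<forall>i. Suc i < ?N \<longrightarrow> Q (Suc i)"
      show "\<forall>b\<in>{1..<?N}. Q b"
      proof
        fix b assume "b \<in> {1..<?N}"
        then show "Q b" using *[rule_format, of "b - 1"] by simp
      qed
    qed simp
    have "S \<in> multifund_seqs a n \<longleftrightarrow> (\<forall>b\<in>{1..<?N}. Max (S ! (b - 1)) \<le> Min (S ! b) \<and>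
        (b \<in> bounds a \<longrightarrow> Max (S ! (b - 1)) < Min (S ! b)))"
      using True unfolding multifund_seqs_def cs by (auto simp: all_set_conv_all_nth)
    also have "\<dots> \<longleftrightarrow> S \<in> multi_seqs (bounds a) n ?N"
      using True le less unfolding shift by (auto simp: multi_seqs_def)
    finally show ?thesis .
  qed
qed

lemma multifund_eq_path_poly:
  assumes a: "strong_composition a"
  shows "multifund a n = path_poly (bounds a) (\<lambda>_. True) (\<lambda>_ _. True) n (sum_list a)"
proof -
  have "beta ^ ((\<Sum>i<sum_list a. card (S ! i)) - sum_list a) * (\<Prod>i<sum_list a. \<Prod>j\<in>S ! i. X j)
    = (\<Prod>T\<leftarrow>S. set_weight T)"
    if "S \<in> multi_seqs (bounds a) n (sum_list a)" for S
  proof -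
    have S: "length S = sum_list a" and "\<And>i. i < sum_list a \<Longrightarrow> S ! i \<noteq> {} \<and> finite (S ! i)"
      using that by (auto simp: multi_seqs_def dest: finite_subset)
    \<comment> \<open>All sets are nonempty, so the truncated subtraction may be done set by
      set.\<close>
    then have "(\<Sum>i<sum_list a. card (S ! i)) - sum_list a = (\<Sum>i<sum_list a. card (S ! i) - 1)"
      by (subst sum_subtractf_nat) (auto simp: card_gt_0_iff Suc_le_eq)
    then show ?thesis
      by (simp add: prod_list_map_eq_prod S set_weight_def prod.distrib power_sum)
  qed
  then show ?thesis unfolding multifund_def multifund_seqs_eq [OF a] sum_multi_seqs [symmetric]
    by (intro sum.cong) auto
qed

section \<open>Glides and mesonic glides as paths\<close>

text \<open>The state after position \<open>k\<close>. Truncated subtraction is harmless for a weak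
  komposition, whose red entries are positive.\<close>

definition run :: "nat list \<times> nat set \<Rightarrow> nat \<Rightarrow> nat" where
  "run c k = (\<Sum>i = 1..k. entry (fst c) i - of_bool (i \<in> snd c))"

lemma run_0 [simp]: "run c 0 = 0"
  by (simp add: run_def)

lemma run_Suc: "run c (Suc k) = run c k + (entry (fst c) (Suc k) - of_bool (Suc k \<in> snd c))"
  by (simp add: run_def)

lemma run_mono: "j \<le> k \<Longrightarrow> run c j \<le> run c k"
  unfolding run_def by (rule sum_mono2) auto

lemma run_cong:
  assumes "\<And>i. i \<in> {1..k} \<Longrightarrow> entry (fst c) i = entry (fst d) i \<and> (i \<in> snd c \<longleftrightarrow> i \<in> snd d)"
  shows "run c k = run d k"
  unfolding run_def by (rule sum.cong) (use assms in auto)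

lemma run_step:
  assumes "weak_komposition (b, R)" "1 \<le> k"
  shows "run (b, R) (k - 1) + entry b k = run (b, R) k + of_bool (k \<in> R)"
proof -
  obtain j where "k = Suc j" using assms(2) by (cases k) auto
  then show ?thesis using assms(1) by (auto simp: run_Suc weak_komposition_def)
qed

lemma run_const:
  assumes "\<And>i. lo < i \<Longrightarrow> i \<le> hi \<Longrightarrow> entry (fst c) i = 0" "lo \<le> hi"
  shows "run c hi = run c lo"
  using assms(2,1) by (induction hi rule: dec_induct) (simp_all add: run_Suc)

lemma first_nonzero:
  assumes "run (b, R) lo < run (b, R) hi"
  obtains m where "lo < m" "m \<le> hi" "entry b m \<noteq> 0" "\<And>k. lo < k \<Longrightarrow> k < m \<Longrightarrow> entry b k = 0"
    "run (b, R) (m - 1) = run (b, R) lo"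
proof -
  let ?Q = "\<lambda>m. lo < m \<and> m \<le> hi \<and> entry b m \<noteq> 0"
  have "lo \<le> hi" using assms run_mono [of hi lo "(b, R)"] by (meson leD nat_le_linear)
  then have ex: "\<exists>m. ?Q m" using run_const [of lo hi "(b, R)"] assms by fastforce
  define m where "m = (LEAST m. ?Q m)"
  have m: "?Q m" using LeastI_ex [OF ex] by (simp add: m_def)
  have z: "entry b k = 0" if "lo < k" "k < m" for k
    using not_less_Least [of k ?Q] that m by (auto simp: m_def)
  have "run (b, R) (m - 1) = run (b, R) lo" by (rule run_const) (use m z in auto)
  then show thesis using that m z by blast
qed

text \<open>This turns condition (ii) on a block into a condition on the states at its two
  ends.\<close>

lemma run_block:
  assumes "weak_komposition (b, R)" "lo \<le> hi"
  shows "int (\<Sum>m\<in>{lo<..hi}. entry b m) - int (card (R \<inter> {lo<..hi}))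
    = int (run (b, R) hi) - int (run (b, R) lo)"
  using assms(2)
proof (induction hi rule: dec_induct)
  case (step hi)
  have s: "{lo<..Suc hi} = insert (Suc hi) {lo<..hi}" using step by auto
  have "card (R \<inter> {lo<..Suc hi}) = card (R \<inter> {lo<..hi}) + of_bool (Suc hi \<in> R)"
    unfolding s by (auto simp: Int_insert_right)
  moreover have "(\<Sum>m\<in>{lo<..Suc hi}. entry b m) = entry b (Suc hi) + (\<Sum>m\<in>{lo<..hi}. entry b m)"
    unfolding s by simp
  ultimately show ?case using step.IH run_step [OF assms(1), of "Suc hi"]
    by (cases "Suc hi \<in> R") (simp_all del: of_nat_sum)
qed simp

section \<open>Colored sequences, built position by position\<close>

definition step_paths :: "nat set \<Rightarrow> (nat \<Rightarrow> bool) \<Rightarrow> (nat \<Rightarrow> nat \<Rightarrow> bool) \<Rightarrow> nat \<Rightarrow> nat \<Rightarrow>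
  (nat list \<times> nat set) set" where
  "step_paths B z c m t = {(b, R). length b = m \<and> weak_komposition (b, R) \<and> run (b, R) m = t \<and>
     (\<forall>k\<in>{1..m}. (run (b, R) (k - 1), k \<in> R) \<in> steps B (z k) (c k (run (b, R) k)) (run (b, R) k))}"

definition extend_path :: "nat \<Rightarrow> nat \<Rightarrow> nat \<Rightarrow> bool \<Rightarrow> nat list \<times> nat set \<Rightarrow> nat list \<times> nat set" where
  "extend_path m t s r = (\<lambda>(b, R). (b @ [t - s + of_bool r], if r then insert (Suc m) R else R))"

lemma entry_append: "1 \<le> i \<Longrightarrow> i \<le> length b \<Longrightarrow> entry (b @ c) i = entry b i"
  by (cases i) (auto simp: entry_def nth_append)

lemma entry_snoc: "entry (b @ [x]) (Suc (length b)) = x"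
  by (simp add: entry_def)

lemma xpow_snoc: "xpow (b @ [x]) = xpow b * X (Suc (length b)) ^ x"
proof -
  have "(\<Prod>i = 1..length b. X i ^ entry (b @ [x]) i) = (\<Prod>i = 1..length b. X i ^ entry b i)"
    by (rule prod.cong) (auto simp: entry_append)
  then show ?thesis by (simp add: xpow_def entry_snoc)
qed

lemma finite_step_paths: "finite (step_paths B z c m t)"
proof (rule finite_subset)
  let ?U = "{b. set b \<subseteq> {0..Suc t} \<and> length b = m} \<times> Pow {1..m}"
  show "step_paths B z c m t \<subseteq> ?U"
  proof
    fix x assume x: "x \<in> step_paths B z c m t"
    obtain b R where bR: "x = (b, R)" by (cases x)
    have w: "weak_komposition (b, R)" and l: "length b = m" and t: "run (b, R) m = t"
      using x by (auto simp: step_paths_def bR)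
    \<comment> \<open>A red entry exceeds the change of state by 1, hence
      \<open>Suc t\<close>.\<close>
    have "k \<le> Suc t" if "k \<in> set b" for k
    proof -
      obtain i where "i < length b" "b ! i = k" using \<open>k \<in> set b\<close> unfolding in_set_conv_nth by blast
      then have i: "i < m" "b ! i = k" using l by simp_all
      have "run (b, R) i + entry b (Suc i) = run (b, R) (Suc i) + of_bool (Suc i \<in> R)"
        using run_step [OF w, of "Suc i"] by simp
      moreover have "run (b, R) (Suc i) \<le> t" using run_mono [of "Suc i" m "(b, R)"] i t by simp
      moreover have "(of_bool (Suc i \<in> R) :: nat) \<le> 1" by simp
      moreover have "entry b (Suc i) = k" using i by (simp add: entry_def)
      ultimately show ?thesis by linarith
    qed
    then show "x \<in> ?U" using w l by (auto simp: bR weak_komposition_def)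
  qed
  show "finite ?U" by (intro finite_cartesian_product finite_lists_length_eq) auto
qed

lemma run_extend_path:
  assumes "length b = m" "weak_komposition (b, R)" "run (b, R) m = s" "s \<le> t"
  shows "k \<le> m \<Longrightarrow> run (extend_path m t s r (b, R)) k = run (b, R) k"
    and "run (extend_path m t s r (b, R)) (Suc m) = t"
proof -
  have R: "Suc m \<notin> R" using assms by (auto simp: weak_komposition_def)
  show *: "run (extend_path m t s r (b, R)) k = run (b, R) k" if "k \<le> m" for k
    by (rule run_cong) (use that assms(1) in \<open>auto simp: extend_path_def entry_append\<close>)
  show "run (extend_path m t s r (b, R)) (Suc m) = t"
    unfolding run_Suc * [OF order_refl] using assms R by (auto simp: extend_path_def entry_snoc)
qed

lemma extend_path_in:
  assumes st: "(s, r) \<in> steps B (z (Suc m)) (c (Suc m) t) t" and x: "x \<in> step_paths B z c m s"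
  shows "extend_path m t s r x \<in> step_paths B z c (Suc m) t"
    and "run (extend_path m t s r x) m = s"
proof -
  obtain b R where bR: "x = (b, R)" by (cases x)
  have l: "length b = m" and w: "weak_komposition (b, R)" and s: "run (b, R) m = s"
    and k: "\<And>k. k \<in> {1..m} \<Longrightarrow> (run (b, R) (k - 1), k \<in> R) \<in> steps B (z k) (c k (run (b, R) k))
      (run (b, R) k)"
    using x by (auto simp: step_paths_def bR)
  note run = run_extend_path [OF l w s steps_le [OF st], where r = r]
  show "run (extend_path m t s r x) m = s" using run(1) [of m] s by (simp add: bR)
  have R: "Suc m \<notin> R" using w l by (auto simp: weak_komposition_def)
  define b' where "b' = b @ [t - s + of_bool r]"
  define R' where "R' = (if r then insert (Suc m) R else R)"
  have e: "extend_path m t s r x = (b', R')" by (simp add: extend_path_def b'_def R'_def bR)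
  have run': "run (b', R') k = run (b, R) k" if "k \<le> m" for k using run(1) [OF that] e bR by simp
  have runS: "run (b', R') (Suc m) = t" using run(2) e bR by simp
  have l': "length b' = Suc m" using l by (simp add: b'_def)
  have "entry b' i \<noteq> 0" "i \<in> {1..Suc m}" if "i \<in> R'" for i
    using that w l entry_append [of i b] entry_snoc [of b]
    by (auto simp: R'_def b'_def weak_komposition_def split: if_splits)
  then have w': "weak_komposition (b', R')" by (auto simp: weak_komposition_def l')
  have "(run (b', R') (k - 1), k \<in> R') \<in> steps B (z k) (c k (run (b', R') k)) (run (b', R') k)"
    if "k \<in> {1..Suc m}" for k
  proof (cases "k = Suc m")
    case True
    then show ?thesis using st R run' [of m] runS s by (auto simp: R'_def)
  next
    case False
    then have "k \<in> {1..m}" "k \<in> R' \<longleftrightarrow> k \<in> R" "run (b', R') k = run (b, R) k" "run (b', R') (k - 1)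
      = run (b, R) (k - 1)"
      using that run' by (auto simp: R'_def)
    then show ?thesis using k by simp
  qed
  then show "extend_path m t s r x \<in> step_paths B z c (Suc m) t"
    using w' l' runS unfolding e by (simp add: step_paths_def)
qed

definition restrict_path :: "nat \<Rightarrow> nat list \<times> nat set \<Rightarrow> (nat \<times> bool) \<times> (nat list \<times> nat set)" where
  "restrict_path m y = ((run y m, Suc m \<in> snd y), (butlast (fst y), snd y - {Suc m}))"

lemma restrict_path_in:
  assumes y: "y \<in> step_paths B z c (Suc m) t"
  obtains s r x where "restrict_path m y = ((s, r), x)" "(s, r) \<in> steps B (z (Suc m)) (c (Suc m) t) t"
    "x \<in> step_paths B z c m s" "extend_path m t s r x = y"
proof -
  obtain b' R' where bR: "y = (b', R')" by (cases y)
  have l: "length b' = Suc m" and w: "weak_komposition (b', R')" and t: "run (b', R') (Suc m) = t"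
    and k: "\<And>k. k \<in> {1..Suc m} \<Longrightarrow> (run (b', R') (k - 1), k \<in> R') \<in> steps B (z k)
      (c k (run (b', R') k)) (run (b', R') k)"
    using y by (auto simp: step_paths_def bR)
  obtain b e where b: "b' = b @ [e]" using l by (cases b' rule: rev_cases) auto
  have lb: "length b = m" using l b by simp
  define R where "R = R' - {Suc m}"
  define r where "r \<longleftrightarrow> Suc m \<in> R'"
  define s where "s = run (b', R') m"
  have run': "run (b', R') k = run (b, R) k" if "k \<le> m" for k
    by (rule run_cong) (use that lb in \<open>auto simp: b R_def entry_append\<close>)
  have eq: "restrict_path m y = ((s, r), (b, R))"
    by (simp add: restrict_path_def bR s_def r_def R_def b)
  have st: "(s, r) \<in> steps B (z (Suc m)) (c (Suc m) t) t"
    using k [of "Suc m"] by (simp add: s_def r_def t)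
  have "weak_komposition (b, R)"
    using w lb entry_append [of _ b "[e]"] unfolding weak_komposition_def R_def b by fastforce
  moreover have "(run (b, R) (k - 1), k \<in> R) \<in> steps B (z k) (c k (run (b, R) k)) (run (b, R) k)"
    if "k \<in> {1..m}" for k
    using k [of k] that run' [of k] run' [of "k - 1"] by (auto simp: R_def)
  ultimately have x: "(b, R) \<in> step_paths B z c m s"
    using lb run' [of m] by (simp add: step_paths_def s_def)
  have "s + e = t + of_bool r"
    using run_step [OF w, of "Suc m"] t entry_snoc [of b e] lb by (simp add: s_def r_def b)
  then have "e = t - s + of_bool r" using steps_le [OF st] by simp
  then have "extend_path m t s r (b, R) = y" by (auto simp: extend_path_def bR b R_def r_def)
  then show thesis using that eq st x by blast
qed

lemma bij_betw_extend_path: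
  "bij_betw (\<lambda>((s, r), x). extend_path m t s r x)
     (SIGMA (s, r):steps B (z (Suc m)) (c (Suc m) t) t. step_paths B z c m s)
       (step_paths B z c (Suc m) t)"
proof (rule bij_betw_byWitness [where f' = "restrict_path m"])
  show "\<forall>y\<in>step_paths B z c (Suc m) t. (\<lambda>((s, r), x). extend_path m t s r x) (restrict_path m y) = y"
    by (auto elim: restrict_path_in)
  show "restrict_path m ` step_paths B z c (Suc m) t
    \<subseteq> (SIGMA (s, r):steps B (z (Suc m)) (c (Suc m) t) t. step_paths B z c m s)"
    by (force elim: restrict_path_in)
  have "restrict_path m (extend_path m t s r x) = ((s, r), x)"
    if "(s, r) \<in> steps B (z (Suc m)) (c (Suc m) t) t" "x \<in> step_paths B z c m s" for s r x
    using extend_path_in(2) [of s r B z m c t x] that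
    by (cases x) (auto simp: restrict_path_def, auto simp: extend_path_def step_paths_def
      weak_komposition_def split: if_splits)
  then show "\<forall>p\<in>SIGMA (s, r):steps B (z (Suc m)) (c (Suc m) t) t. step_paths B z c m s.
      restrict_path m ((\<lambda>((s, r), x). extend_path m t s r x) p) = p" by auto
qed (auto intro: extend_path_in(1))

lemma sum_step_paths:
  "(\<Sum>x\<in>step_paths B z c m t. beta ^ excess x * xpow (fst x)) = path_poly B z c m t"
proof (rule sum_eq_path_poly [where e = "([], {})" and g = extend_path])
  show "step_paths B z c 0 t = (if t = 0 then {([], {})} else {})" for t
    by (auto simp: step_paths_def weak_komposition_def)
  show "beta ^ excess (extend_path m t s r x) * xpow (fst (extend_path m t s r x))
    = beta ^ excess x * xpow (fst x) * (beta ^ of_bool r * X (Suc m) ^ (t - s + of_bool r))"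
    if "x \<in> step_paths B z c m s" for m t s r x
  proof -
    obtain b R where x: "x = (b, R)" by (cases x)
    have "length b = m" "R \<subseteq> {1..m}" using that by (auto simp: x step_paths_def weak_komposition_def)
    moreover from this have "finite R" "Suc m \<notin> R" by (auto dest: finite_subset)
    ultimately show ?thesis by (simp add: x extend_path_def excess_def xpow_snoc mult_ac)
  qed
qed (simp_all add: finite_step_paths bij_betw_extend_path xpow_def excess_def)

text \<open>A nonzero black entry changes the state and a red entry is nonzero, so the zero step is
  recognized by the vanishing of the entry.\<close>

lemma step_iff:
  assumes "weak_komposition (b, R)" "1 \<le> k"
  shows "(run (b, R) (k - 1), k \<in> R) \<in> steps B z c (run (b, R) k) \<longleftrightarrow>
    (if entry b k = 0 then z else c \<and> (if k \<in> R then red_step B (run (b, R) (k - 1)) (run (b, R) k)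
        else black_step B (run (b, R) (k - 1)) (run (b, R) k)))"
proof (cases "entry b k = 0")
  case True
  then have "k \<notin> R" using assms by (auto simp: weak_komposition_def)
  then show ?thesis using True run_step [OF assms] by (simp add: steps_def black_step_def)
next
  case False
  then have "k \<notin> R \<Longrightarrow> run (b, R) (k - 1) < run (b, R) k" using run_step [OF assms] by simp
  then show ?thesis using False by (auto simp: steps_def)
qed

section \<open>Positions of the nonzero entries\<close>

lemma set_nzpos: "set (nzpos a) = {i\<in>{1..length a}. entry a i \<noteq> 0}"
  by (auto simp: nzpos_def)

lemma sorted_nzpos: "sorted (nzpos a)" and distinct_nzpos: "distinct (nzpos a)"
  unfolding nzpos_def by (simp_all add: sorted_wrt_filter del: upt_Suc)

lemma map_entry: "map (entry a) [1..<Suc (length a)] = a"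
  by (rule nth_equalityI) (simp_all add: entry_def del: upt_Suc)

lemma flat_eq: "flat a = map (entry a) (nzpos a)"
  unfolding flat_def nzpos_def
  by (subst (1) map_entry [of a, symmetric]) (simp only: filter_map o_def)

lemma length_nzpos: "length (nzpos a) = length (flat a)"
  by (simp add: flat_eq)

lemma card_nzpos: "card (set (nzpos a)) = length (flat a)"
  by (simp add: distinct_card distinct_nzpos length_nzpos)

lemma strong_flat: "strong_composition (flat a)"
  by (auto simp: strong_composition_def flat_def)

lemma entry_nzpos_in: "j \<in> {1..length (flat a)} \<Longrightarrow> entry (nzpos a) j \<in> set (nzpos a)"
  unfolding entry_def by (rule nth_mem) (auto simp: length_nzpos)

lemma entry_nzpos_range:
  assumes "j \<in> {1..length (flat a)}"
  shows "1 \<le> entry (nzpos a) j" "entry (nzpos a) j \<le> length a"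
  using entry_nzpos_in [OF assms] by (auto simp: set_nzpos)

lemma entry_nzpos_less:
  assumes "1 \<le> i" "i < j" "j \<le> length (flat a)"
  shows "entry (nzpos a) i < entry (nzpos a) j"
  unfolding entry_def using assms sorted_nzpos [of a] distinct_nzpos [of a]
  by (intro sorted_wrt_nth_less [of "(<)"]) (auto simp: strict_sorted_iff length_nzpos)

lemma nbefore_nzpos:
  assumes "j \<in> {1..length (flat a)}"
  shows "nbefore (set (nzpos a)) (entry (nzpos a) j) = j - 1"
proof -
  have "{p\<in>set (nzpos a). p < entry (nzpos a) j} = entry (nzpos a) ` {1..<j}"
  proof (intro equalityI subsetI)
    fix p assume p: "p \<in> {p\<in>set (nzpos a). p < entry (nzpos a) j}"
    then obtain i where i: "i < length (flat a)" "nzpos a ! i = p"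
      by (auto simp: in_set_conv_nth length_nzpos)
    then have e: "entry (nzpos a) (Suc i) = p" by (simp add: entry_def)
    have "Suc i < j"
    proof (rule ccontr)
      assume "\<not> Suc i < j"
      then have "j = Suc i \<or> j < Suc i" by auto
      then show False using entry_nzpos_less [of j "Suc i" a] assms i e p by auto
    qed
    then show "p \<in> entry (nzpos a) ` {1..<j}" using e by force
  next
    fix p assume "p \<in> entry (nzpos a) ` {1..<j}"
    then obtain i where i: "p = entry (nzpos a) i" "1 \<le> i" "i < j" by auto
    then have "entry (nzpos a) i < entry (nzpos a) j" "entry (nzpos a) i \<in> set (nzpos a)"
      using assms by (auto intro: entry_nzpos_less entry_nzpos_in)
    then show "p \<in> {p\<in>set (nzpos a). p < entry (nzpos a) j}" using i by simp
  qed
  moreover have "inj_on (entry (nzpos a)) {1..<j}"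
  proof (rule linorder_inj_onI)
    fix i k assume "i < k" "i \<in> {1..<j}" "k \<in> {1..<j}"
    then have "entry (nzpos a) i < entry (nzpos a) k" using assms by (intro entry_nzpos_less) auto
    then show "entry (nzpos a) i \<noteq> entry (nzpos a) k" by simp
  qed auto
  ultimately show ?thesis by (simp add: nbefore_def card_image)
qed

text \<open>The count is monotone, equals j - 1 at the j-th nonzero position and j just after it.
  Thus the gates express condition (iii).\<close>

lemma nbefore_less_iff:
  assumes "j \<in> {1..length (flat a)}"
  shows "nbefore (set (nzpos a)) m < j \<longleftrightarrow> m \<le> entry (nzpos a) j"
proof -
  have mono: "nbefore (set (nzpos a)) k \<le> nbefore (set (nzpos a)) l" if "k \<le> l" for k l
    unfolding nbefore_def by (rule card_mono) (use that in auto)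
  have S: "nbefore (set (nzpos a)) (Suc (entry (nzpos a) j)) = j"
    using nbefore_Suc [of "set (nzpos a)" "entry (nzpos a) j"] nbefore_nzpos [OF assms]
      entry_nzpos_in [OF assms] assms by simp
  show ?thesis
  proof (cases "m \<le> entry (nzpos a) j")
    case True
    then show ?thesis using mono [OF True] nbefore_nzpos [OF assms] assms by auto
  next
    case False
    then have "Suc (entry (nzpos a) j) \<le> m" by simp
    from mono [OF this] show ?thesis using S False by simp
  qed
qed

lemma psum_flat_step:
  assumes "j \<in> {1..length (flat a)}"
  shows "psum (flat a) j = psum (flat a) (j - 1) + entry a (entry (nzpos a) j)"
proof -
  have "psum (flat a) (Suc (j - 1)) = psum (flat a) (j - 1) + flat a ! (j - 1)"
    by (rule psum_Suc) (use assms in auto)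
  moreover have "flat a ! (j - 1) = entry a (entry (nzpos a) j)"
  proof -
    have "j - 1 < length (nzpos a)" using assms by (auto simp: length_nzpos)
    then show ?thesis by (simp add: flat_eq entry_def [of "nzpos a"])
  qed
  ultimately show ?thesis using assms by simp
qed

section \<open>Block decompositions and local conditions on the states\<close>

lemma block_index:
  fixes I :: "nat \<Rightarrow> nat"
  assumes "I 0 = 0" "1 \<le> k" "k \<le> I l"
  obtains j where "j \<in> {1..l}" "I (j - 1) < k" "k \<le> I j"
proof -
  define j where "j = (LEAST j. k \<le> I j)"
  have "k \<le> I j" unfolding j_def by (rule LeastI [of "\<lambda>j. k \<le> I j", OF assms(3)])
  moreover have "j \<le> l" unfolding j_def by (rule Least_le [of "\<lambda>j. k \<le> I j", OF assms(3)])
  moreover have "1 \<le> j" using assms \<open>k \<le> I j\<close> by (cases j) auto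
  moreover have "I (j - 1) < k"
    using not_less_Least [of "j - 1" "\<lambda>j. k \<le> I j"] \<open>1 \<le> j\<close> unfolding j_def by fastforce
  ultimately show thesis using that by auto
qed

lemma block_steps:
  assumes "psum a (j - 1) \<le> s" "t \<le> psum a j" "1 \<le> j"
  shows "s < t \<Longrightarrow> black_step (bounds a) s t"
    and "psum a (j - 1) < s \<Longrightarrow> s \<le> t \<Longrightarrow> red_step (bounds a) s t"
proof -
  have nb: "\<not> (psum a (j - 1) < b \<and> b < t)" if "b \<in> bounds a" for b
    using no_bounds_between [of t a "j - 1"] assms that by auto
  show "black_step (bounds a) s t" if "s < t"
    unfolding black_step_def using that assms(1) nb by (meson le_less_trans)
  show "red_step (bounds a) s t" if "psum a (j - 1) < s" "s \<le> t"
  proof -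
    have "0 < s" using that(1) by linarith
    then show ?thesis unfolding red_step_def using that nb by (meson less_le_trans)
  qed
qed

text \<open>Condition (ii) makes the states at block ends the partial sums, and (iii) opens the
  gates. By (i) the opening black entry lifts the state above the lower boundary before any red
  entry of the block.\<close>

lemma glide_blocks_facts:
  assumes g: "glide_blocks a (b, R) I" and w: "weak_komposition (b, R)" and len: "length b = length a"
  shows "j \<le> length (flat a) \<Longrightarrow> run (b, R) (I j) = psum (flat a) j"
    and "run (b, R) (length a) = sum_list (flat a)"
    and "\<And>k. k \<in> {1..length a} \<Longrightarrow> entry b k \<noteq> 0 \<Longrightarrow>
      psum (flat a) (nbefore (set (nzpos a)) k) < run (b, R) k \<and>
      (if k \<in> R then red_step (bounds (flat a)) (run (b, R) (k - 1)) (run (b, R) k)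
       else black_step (bounds (flat a)) (run (b, R) (k - 1)) (run (b, R) k))"
proof -
  let ?l = "length (flat a)" and ?T = "run (b, R)" and ?p = "psum (flat a)"
  have I0: "I 0 = 0" and tail: "\<And>m. I ?l < m \<Longrightarrow> m \<le> length a \<Longrightarrow> entry b m = 0"
    using g unfolding glide_blocks_def prod.case Let_def length_nzpos len by blast+
  have blks: "(\<forall>j\<in>{1..?l}. I (j - 1) < I j) \<and> (\<forall>j\<in>{1..?l}.
      (\<exists>m\<in>{I (j - 1)<..I j}. entry b m \<noteq> 0 \<and> (\<forall>k\<in>{I (j - 1)<..I j}. k < m \<longrightarrow> entry b k = 0) \<and> m \<notin> R) \<and>
      int (\<Sum>m\<in>{I (j - 1)<..I j}. entry b m) - int (card (R \<inter> {I (j - 1)<..I j}))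
        = int (entry a (entry (nzpos a) j)) \<and>
      I j \<le> entry (nzpos a) j)"
    using g unfolding glide_blocks_def prod.case Let_def length_nzpos by (elim conjE) (intro conjI)
  have blk: "I (j - 1) < I j"
    "\<exists>m\<in>{I (j - 1)<..I j}. entry b m \<noteq> 0 \<and> (\<forall>k\<in>{I (j - 1)<..I j}. k < m \<longrightarrow> entry b k = 0) \<and> m \<notin> R"
    "int (\<Sum>m\<in>{I (j - 1)<..I j}. entry b m) - int (card (R \<inter> {I (j - 1)<..I j}))
      = int (entry a (entry (nzpos a) j))"
    "I j \<le> entry (nzpos a) j" if "j \<in> {1..?l}" for j
    using blks that by blast+
  have T: "?T (I j) = ?p j" if "j \<le> ?l" for j
    using that
  proof (induction j)
    case (Suc j)
    then have j: "Suc j \<in> {1..?l}" by simp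
    show ?case
      using run_block [OF w, of "I j" "I (Suc j)"] blk(1,3) [OF j] psum_flat_step [OF j] Suc by simp
  qed (simp add: I0)
  then show "j \<le> ?l \<Longrightarrow> ?T (I j) = ?p j" .
  have Il: "I ?l \<le> length a"
  proof (cases "?l = 0")
    case False
    then have l: "?l \<in> {1..?l}" by (simp add: Suc_le_eq)
    show ?thesis using blk(4) [OF l] entry_nzpos_range(2) [OF l] by simp
  qed (simp add: I0)
  have "?T (length a) = ?T (I ?l)" by (rule run_const) (use tail Il in auto)
  then show "?T (length a) = sum_list (flat a)" using T [OF order_refl] by simp
  fix k assume k: "k \<in> {1..length a}" "entry b k \<noteq> 0"
  have "k \<le> I ?l" using tail [of k] k by fastforce
  then obtain j where j: "j \<in> {1..?l}" "I (j - 1) < k" "k \<le> I j"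
    using block_index [where I = I and k = k and l = ?l, OF I0] k by auto
  obtain m where m: "m \<in> {I (j - 1)<..I j}" "entry b m \<noteq> 0" "m \<notin> R"
      "\<And>i. i \<in> {I (j - 1)<..I j} \<Longrightarrow> i < m \<Longrightarrow> entry b i = 0"
    using blk(2) [OF j(1)] by blast
  have mk: "m \<le> k" using m(4) [of k] j k by (meson greaterThanAtMost_iff leI)
  have Tj: "?T (I (j - 1)) = ?p (j - 1)" "?T (I j) = ?p j" using T [of j] T [of "j - 1"] j by auto
  have "?T (m - 1) < ?T m" using run_step [OF w, of m] m by auto
  moreover have "?p (j - 1) \<le> ?T (m - 1)" unfolding Tj(1) [symmetric] by (rule run_mono) (use m in auto)
  ultimately have Tm: "?p (j - 1) < ?T m" by simp
  then have Tk: "?p (j - 1) < ?T k" using run_mono [OF mk, of "(b, R)"] by simp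
  have Tk': "?T k \<le> ?p j" unfolding Tj(2) [symmetric] by (rule run_mono) (rule j)
  have Tk1: "?p (j - 1) \<le> ?T (k - 1)" unfolding Tj(1) [symmetric] by (rule run_mono) (use j in auto)
  have "nbefore (set (nzpos a)) k < j" unfolding nbefore_less_iff [OF j(1)]
    using j(3) blk(4) [OF j(1)] by simp
  then have "?p (nbefore (set (nzpos a)) k) \<le> ?p (j - 1)" by (intro psum_mono) simp
  moreover have "if k \<in> R then red_step (bounds (flat a)) (?T (k - 1)) (?T k)
    else black_step (bounds (flat a)) (?T (k - 1)) (?T k)"
  proof (cases "k \<in> R")
    case True
    \<comment> \<open>A red \<open>k\<close> comes after the opening entry \<open>m\<close>, so the
      state before it is strictly above the lower boundary.\<close>
    then have "m \<le> k - 1" using mk m(3) by (cases "m = k") auto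
    then have "?p (j - 1) < ?T (k - 1)" using Tm run_mono [of m "k - 1" "(b, R)"] by simp
    then show ?thesis using True block_steps(2) [OF Tk1 Tk'] j run_mono [of "k - 1" k "(b, R)"] by simp
  next
    case False
    then have "?T (k - 1) < ?T k" using run_step [OF w, of k] k by simp
    then show ?thesis using False block_steps(1) [OF Tk1 Tk'] j by simp
  qed
  ultimately show "?p (nbefore (set (nzpos a)) k) < ?T k \<and>
      (if k \<in> R then red_step (bounds (flat a)) (?T (k - 1)) (?T k)
        else black_step (bounds (flat a)) (?T (k - 1)) (?T k))"
    using Tk by auto
qed

text \<open>The first nonzero entry of a block starts at a boundary and by \<open>gap\<close> ends
  above it, which no red step does; so it is black, as (i) demands.\<close>

lemma glide_blocksI:
  assumes w: "weak_komposition (b, R)" and len: "length b = length a"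
    and I0: "I 0 = 0" and T: "\<And>j. j \<le> length (flat a) \<Longrightarrow> run (b, R) (I j) = psum (flat a) j"
    and le: "\<And>j. j \<in> {1..length (flat a)} \<Longrightarrow> I j \<le> entry (nzpos a) j"
    and total: "run (b, R) (length a) = sum_list (flat a)"
    and gap: "\<And>j m. j \<le> length (flat a) \<Longrightarrow> I j < m \<Longrightarrow> m \<le> length a \<Longrightarrow> entry b m \<noteq> 0
      \<Longrightarrow> psum (flat a) j < run (b, R) m"
    and step: "\<And>k. k \<in> {1..length a} \<Longrightarrow> k \<in> R \<Longrightarrow> red_step (bounds (flat a)) (run (b, R) (k - 1))
      (run (b, R) k)"
  shows "glide_blocks a (b, R) I"
proof -
  let ?l = "length (flat a)" and ?T = "run (b, R)" and ?p = "psum (flat a)"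
  have tail: "entry b m = 0" if "I ?l < m" "m \<le> length b" for m
    using gap [OF order_refl, of m] that run_mono [of m "length a" "(b, R)"] total len by fastforce
  have "I (j - 1) < I j \<and> (\<exists>m\<in>{I (j - 1)<..I j}. entry b m \<noteq> 0
    \<and> (\<forall>k\<in>{I (j - 1)<..I j}. k < m \<longrightarrow> entry b k = 0) \<and> m \<notin> R) \<and>
    int (\<Sum>m\<in>{I (j - 1)<..I j}. entry b m) - int (card (R \<inter> {I (j - 1)<..I j}))
      = int (entry a (entry (nzpos a) j)) \<and>
    I j \<le> entry (nzpos a) j" if j: "j \<in> {1..?l}" for j
  proof -
    have Tj: "?T (I (j - 1)) = ?p (j - 1)" "?T (I j) = ?p j" using T [of j] T [of "j - 1"] j by auto
    have "?p (j - 1) < ?p j" using j by (intro psum_less strong_flat) auto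
    then have lt: "?T (I (j - 1)) < ?T (I j)" using Tj by simp
    then have I: "I (j - 1) < I j" using run_mono [of "I j" "I (j - 1)" "(b, R)"] by (meson leI leD)
    obtain m where m: "I (j - 1) < m" "m \<le> I j" "entry b m \<noteq> 0" "\<And>k. I (j - 1) < k \<Longrightarrow> k < m
      \<Longrightarrow> entry b k = 0"
      "?T (m - 1) = ?T (I (j - 1))" using first_nonzero [OF lt] by blast
    have mn: "m \<le> length a" using m(2) le [OF j] entry_nzpos_range(2) [OF j] by simp
    have "?p (j - 1) < ?T m" using gap [of "j - 1" m] m mn j by auto
    moreover have "?p (j - 1) \<in> bounds (flat a)" using j by (intro psum_in_bounds) auto
    ultimately have "\<not> red_step (bounds (flat a)) (?T (m - 1)) (?T m)"
      using m(5) Tj(1) by (auto simp: red_step_def)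
    then have "m \<notin> R" using step [of m] mn m(1) by auto
    moreover have "int (\<Sum>m\<in>{I (j - 1)<..I j}. entry b m) - int (card (R \<inter> {I (j - 1)<..I j}))
      = int (entry a (entry (nzpos a) j))"
      using run_block [OF w less_imp_le [OF I]] Tj psum_flat_step [OF j] by simp
    ultimately show ?thesis using I m le [OF j] by auto
  qed
  then show ?thesis using I0 tail unfolding glide_blocks_def prod.case Let_def length_nzpos by blast
qed

definition glide_paths :: "nat list \<Rightarrow> (nat list \<times> nat set) set" where
  "glide_paths a = step_paths (bounds (flat a)) (\<lambda>_. True)
    (\<lambda>m t. psum (flat a) (nbefore (set (nzpos a)) m) < t)
     (length a) (sum_list (flat a))"

definition kaon_paths :: "nat list \<Rightarrow> (nat list \<times> nat set) set" where
  "kaon_paths a = step_paths (bounds (flat a)) (\<lambda>m. m \<notin> set (nzpos a))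
     (\<lambda>m t. if m \<in> set (nzpos a) then t = psum (flat a) (Suc (nbefore (set (nzpos a)) m))
            else psum (flat a) (nbefore (set (nzpos a)) m) < t)
     (length a) (sum_list (flat a))"

lemma glides_eq: "glides a = glide_paths a"
proof (intro equalityI subsetI)
  fix x assume x: "x \<in> glides a"
  obtain b R where bR: "x = (b, R)" by (cases x)
  obtain I where len: "length b = length a" and w: "weak_komposition (b, R)"
    and g: "glide_blocks a (b, R) I"
    using x by (auto simp: glides_def bR)
  note facts = glide_blocks_facts [OF g w len]
  have "(run (b, R) (k - 1), k \<in> R) \<in> steps (bounds (flat a)) True
      (psum (flat a) (nbefore (set (nzpos a)) k) < run (b, R) k) (run (b, R) k)"
        if k: "k \<in> {1..length a}" for k
  proof -
    have "1 \<le> k" using k by simp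
    then show ?thesis unfolding step_iff [OF w \<open>1 \<le> k\<close>] using facts(3) [OF k] by presburger
  qed
  then show "x \<in> glide_paths a"
    using facts(2) len w by (simp add: glide_paths_def step_paths_def bR)
next
  fix x assume x: "x \<in> glide_paths a"
  obtain b R where bR: "x = (b, R)" by (cases x)
  let ?l = "length (flat a)" and ?T = "run (b, R)" and ?p = "psum (flat a)" and ?n = "length a"
  have len: "length b = ?n" and w: "weak_komposition (b, R)" and total: "?T ?n = sum_list (flat a)"
    using x by (auto simp: glide_paths_def step_paths_def bR)
  have st: "?p (nbefore (set (nzpos a)) k) < ?T k \<and>
      (if k \<in> R then red_step (bounds (flat a)) (?T (k - 1)) (?T k)
        else black_step (bounds (flat a)) (?T (k - 1)) (?T k))"
    if "k \<in> {1..?n}" "entry b k \<noteq> 0" for k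
  proof -
    have k: "1 \<le> k" using that by simp
    have "(?T (k - 1), k \<in> R) \<in> steps (bounds (flat a)) True (?p (nbefore (set (nzpos a)) k) < ?T k)
      (?T k)"
      using x that by (simp add: glide_paths_def step_paths_def bR)
    then show ?thesis unfolding step_iff [OF w k] using that by presburger
  qed
  have R: "entry b k \<noteq> 0" if "k \<in> R" for k using w that by (auto simp: weak_komposition_def)
  \<comment> \<open>Blocks are made as long as possible: \<open>I j\<close> is the last nonzero
    position whose state is at most \<open>?p j\<close>, so a red 1 at a boundary stays in the
    completed block. The element 0 is the default if there is no such position.\<close>
  define Q where "Q = (\<lambda>j. {m. m \<le> ?n \<and> (m = 0 \<or> entry b m \<noteq> 0 \<and> ?T m \<le> ?p j)})"
  define I where "I = (\<lambda>j. Max (Q j))"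
  have fin: "finite (Q j)" "0 \<in> Q j" for j by (auto simp: Q_def)
  have IQ: "I j \<in> Q j" for j unfolding I_def using fin [of j] by (intro Max_in) auto
  have gap: "?p j < ?T m" if "I j < m" "m \<le> ?n" "entry b m \<noteq> 0" for j m
  proof (rule ccontr)
    assume "\<not> ?p j < ?T m"
    then have "m \<in> Q j" using that by (simp add: Q_def)
    then have "m \<le> I j" unfolding I_def using fin by (intro Max_ge)
    then show False using that by simp
  qed
  \<comment> \<open>Otherwise the next nonzero entry would cross the boundary
    \<open>?p j\<close>.\<close>
  have T: "?T (I j) = ?p j" if j: "j \<le> ?l" for j
  proof (rule ccontr)
    assume ne: "?T (I j) \<noteq> ?p j"
    have "?T (I j) \<le> ?p j" using IQ [of j] by (auto simp: Q_def)
    then have lt: "?T (I j) < ?p j" using ne by simp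
    also have "?p j \<le> ?T ?n" unfolding total by (rule psum_le_sum_list)
    finally obtain m where m: "I j < m" "m \<le> ?n" "entry b m \<noteq> 0" "?T (m - 1) = ?T (I j)"
      using first_nonzero by blast
    have "?p j < ?T m" using gap m by blast
    then show False using st [of m] m lt psum_in_bounds [OF j]
      by (cases "m \<in> R") (auto simp: red_step_def black_step_def)
  qed
  have "glide_blocks a (b, R) I"
  proof (rule glide_blocksI [OF w len _ T _ total gap])
    \<comment> \<open>No nonzero entry, black or red, ends in state 0.\<close>
    show "I 0 = 0"
    proof (rule ccontr)
      assume n: "I 0 \<noteq> 0"
      then have "entry b (I 0) \<noteq> 0" "?T (I 0) = 0" "I 0 \<le> ?n" using IQ [of 0] by (auto simp: Q_def)
      then show False using st [of "I 0"] n by (auto simp: red_step_def black_step_def)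
    qed
    show "I j \<le> entry (nzpos a) j" if j: "j \<in> {1..?l}" for j
    proof (cases "I j = 0")
      case False
      then have "entry b (I j) \<noteq> 0" "I j \<in> {1..?n}" using IQ [of j] by (auto simp: Q_def)
      then have "?p (nbefore (set (nzpos a)) (I j)) < ?p j" using st [of "I j"] T [of j] j by auto
      then have "nbefore (set (nzpos a)) (I j) < j" using psum_mono by (meson leD leI)
      then show ?thesis by (simp add: nbefore_less_iff [OF j])
    qed simp
    show "red_step (bounds (flat a)) (?T (k - 1)) (?T k)" if "k \<in> {1..?n}" "k \<in> R" for k
      using st [of k] R [of k] that by auto
  qed
  then show "x \<in> glides a" using len w by (auto simp: glides_def bR)
qed

lemma mesonic_glides_eq: "mesonic_glides a = kaon_paths a"
proof (intro equalityI subsetI)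
  fix x assume x: "x \<in> mesonic_glides a"
  obtain b R where bR: "x = (b, R)" by (cases x)
  let ?l = "length (flat a)" and ?T = "run (b, R)" and ?p = "psum (flat a)" and ?n = "length a"
    and ?P = "set (nzpos a)"
  obtain I where len: "length b = ?n" and w: "weak_komposition (b, R)" and g: "glide_blocks a (b, R) I"
    and m: "\<And>j. j \<in> {1..?l} \<Longrightarrow> I j = entry (nzpos a) j \<and> entry b (entry (nzpos a) j) \<noteq> 0"
    using x by (auto simp: mesonic_glides_def bR length_nzpos)
  note facts = glide_blocks_facts [OF g w len]
  \<comment> \<open>A nonzero position of \<open>a\<close> ends its block, where the state is a
    partial sum.\<close>
  have P: "?T k = ?p (Suc (nbefore ?P k)) \<and> entry b k \<noteq> 0" if "k \<in> ?P" for k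
  proof -
    obtain i where i: "i < ?l" "nzpos a ! i = k" using \<open>k \<in> ?P\<close>
      by (auto simp: in_set_conv_nth length_nzpos)
    have j: "Suc i \<in> {1..?l}" using i by auto
    have e: "entry (nzpos a) (Suc i) = k" using i by (simp add: entry_def)
    show ?thesis using m [OF j] facts(1) [of "Suc i"] i nbefore_nzpos [OF j] unfolding e by simp
  qed
  have "(?T (k - 1), k \<in> R) \<in> steps (bounds (flat a)) (k \<notin> ?P)
      (if k \<in> ?P then ?T k = ?p (Suc (nbefore ?P k))
        else ?p (nbefore ?P k) < ?T k) (?T k)" if k: "k \<in> {1..?n}" for k
  proof -
    have "1 \<le> k" using k by simp
    then show ?thesis unfolding step_iff [OF w \<open>1 \<le> k\<close>] using facts(3) [OF k] P [of k] by presburger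
  qed
  then show "x \<in> kaon_paths a"
    using facts(2) len w by (simp add: kaon_paths_def step_paths_def bR)
next
  fix x assume x: "x \<in> kaon_paths a"
  obtain b R where bR: "x = (b, R)" by (cases x)
  let ?l = "length (flat a)" and ?T = "run (b, R)" and ?p = "psum (flat a)" and ?n = "length a"
    and ?P = "set (nzpos a)"
  have len: "length b = ?n" and w: "weak_komposition (b, R)" and total: "?T ?n = sum_list (flat a)"
    using x by (auto simp: kaon_paths_def step_paths_def bR)
  have st: "if entry b k = 0 then k \<notin> ?P else
      (if k \<in> ?P then ?T k = ?p (Suc (nbefore ?P k)) else ?p (nbefore ?P k) < ?T k) \<and>
      (k \<in> R \<longrightarrow> red_step (bounds (flat a)) (?T (k - 1)) (?T k))"
    if "k \<in> {1..?n}" for k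
  proof -
    have k: "1 \<le> k" using that by simp
    have "(?T (k - 1), k \<in> R) \<in> steps (bounds (flat a)) (k \<notin> ?P)
      (if k \<in> ?P then ?T k = ?p (Suc (nbefore ?P k)) else ?p (nbefore ?P k) < ?T k) (?T k)"
      using x that by (simp add: kaon_paths_def step_paths_def bR)
    then show ?thesis unfolding step_iff [OF w k] by presburger
  qed
  have R: "entry b k \<noteq> 0" if "k \<in> R" for k using w that by (auto simp: weak_komposition_def)
  \<comment> \<open>The mesonic condition dictates the ends of the blocks.\<close>
  define I where "I = (\<lambda>j. if j = 0 then 0 else entry (nzpos a) j)"
  have nz: "entry b (entry (nzpos a) j) \<noteq> 0 \<and> ?T (entry (nzpos a) j) = ?p j" if j: "j \<in> {1..?l}" for j
    using st [of "entry (nzpos a) j"] entry_nzpos_range [OF j] entry_nzpos_in [OF j] nbefore_nzpos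
      [OF j] j
    by (auto split: if_splits)
  have "glide_blocks a (b, R) I"
  proof (rule glide_blocksI [OF w len _ _ _ total])
    show "?T (I j) = ?p j" if "j \<le> ?l" for j using nz [of j] that by (auto simp: I_def)
    show "?p j < ?T m" if j: "j \<le> ?l" and m: "I j < m" "m \<le> ?n" "entry b m \<noteq> 0" for j m
    proof -
      \<comment> \<open>For \<open>j > 0\<close> the position \<open>m\<close> lies beyond the j-th
        nonzero position, so its gate or its prescribed target is at least as far as block
        \<open>j\<close> requires.\<close>
      have nb: "j \<le> nbefore ?P m"
      proof (cases "j = 0")
        case False
        then show ?thesis using nbefore_less_iff [of j a m] j m(1)
          by (auto simp: I_def not_less [symmetric])
      qed simp
      have "m \<in> {1..?n}" using m by auto
      show ?thesis
      proof (cases "m \<in> ?P")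
        case True
        have "Suc (nbefore ?P m) \<le> ?l" using nbefore_less_card [OF _ True] card_nzpos [of a] by simp
        then have "?p j < ?p (Suc (nbefore ?P m))" using nb by (intro psum_less strong_flat) auto
        then show ?thesis using st [OF \<open>m \<in> {1..?n}\<close>] m True by simp
      next
        case False
        then show ?thesis using st [OF \<open>m \<in> {1..?n}\<close>] m psum_mono [OF nb, of "flat a"] by simp
      qed
    qed
    show "red_step (bounds (flat a)) (?T (k - 1)) (?T k)" if "k \<in> {1..?n}" "k \<in> R" for k
      using st [of k] R [of k] that by auto
  qed (auto simp: I_def)
  moreover have "\<forall>j\<in>{1..length (nzpos a)}. I j = entry (nzpos a) j
    \<and> entry (fst x) (entry (nzpos a) j) \<noteq> 0"
    using nz by (simp add: I_def bR length_nzpos)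
  ultimately show "x \<in> mesonic_glides a" using len w
    unfolding mesonic_glides_def by (intro CollectI conjI exI [of _ I]) (simp_all add: bR)
qed

section \<open>Evaluation along a reduced word\<close>

definition glide_set_poly :: "nat list \<Rightarrow> nat \<Rightarrow> nat set \<Rightarrow> mpol" where
  "glide_set_poly a n P = glide_path a P n (sum_list a)"

definition kaon_set_poly :: "nat list \<Rightarrow> nat \<Rightarrow> nat set \<Rightarrow> mpol" where
  "kaon_set_poly a n P = kaon_path a P n (sum_list a)"

section \<open>Following a word letter by letter\<close>

lemma tpi_eq: "tpi i f = f + ttheta i f"
  by (simp add: ttheta_def)

lemma permutes_initial_image:
  assumes "u permutes {1..n}" "l \<le> n"
  shows "u ` {1..l} \<subseteq> {1..n}" "card (u ` {1..l}) = l"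
proof -
  have "u ` {1..l} \<subseteq> u ` {1..n}" using assms(2) by (intro image_mono) auto
  then show "u ` {1..l} \<subseteq> {1..n}" by (simp only: permutes_image [OF assms(1)])
  show "card (u ` {1..l}) = l"
    using card_image [OF inj_on_subset [OF permutes_inj [OF assms(1)] subset_UNIV], of "{1..l}"] by simp
qed

lemma permutes_in_image_iff: "u permutes S \<Longrightarrow> k \<in> u ` A \<longleftrightarrow> inv u k \<in> A"
  using permutes_inverses [of u S] image_eqI [of k u "inv u k" A] by auto

text \<open>The positions \<open>P\<close> are the image of {1..l} under the part of the word
  already applied. The places holding the values i and i + 1 form a pair of \<open>D\<close>,
  smaller first, so i + 1 is never occupied without i: each letter moves an element or fixes
  \<open>P\<close>. As \<open>stay\<close> is given the pair, it is vacuous when all pairs of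
  \<open>D\<close> cross \<open>l\<close>.\<close>

lemma foldr_word:
  assumes D: "finite D" "\<And>p q. (p, q) \<in> D \<Longrightarrow> p < q"
    and "set is \<subseteq> {1..<n}" "length is = inversions_in D (word_perm is)"
    and l: "l \<le> n" and base: "f = \<Phi> {1..l}"
    and swap: "\<And>i P. i \<in> {1..<n} \<Longrightarrow> P \<subseteq> {1..n} \<Longrightarrow> card P = l \<Longrightarrow> i \<in> P \<Longrightarrow> Suc i \<notin> P \<Longrightarrow>
       T i (\<Phi> P) = \<Phi> (transpose i (Suc i) ` P)"
    and stay: "\<And>i P p q. i \<in> {1..<n} \<Longrightarrow> P \<subseteq> {1..n} \<Longrightarrow> card P = l \<Longrightarrow> i \<in> P \<longleftrightarrow> Suc i \<in> P \<Longrightarrow>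
       (p, q) \<in> D \<Longrightarrow> \<not> (p \<le> l \<and> l < q) \<Longrightarrow> T i (\<Phi> P) = \<Phi> P"
  shows "foldr T is f = \<Phi> (word_perm is ` {1..l})"
  using assms(3,4)
proof (induction "is")
  case Nil
  then show ?case by (simp add: base)
next
  case (Cons i "is")
  note st = inversions_in_word_step [OF D Cons.prems]
  let ?u = "word_perm is" and ?P = "word_perm is ` {1..l}"
  have u: "?u permutes {1..n}" using Cons.prems by (intro word_perm_permutes) auto
  have i: "i \<in> {1..<n}" using Cons.prems by auto
  have "inv ?u i < inv ?u (Suc i)" using st(2) D(2) by blast
  have iP: "k \<in> ?P \<longleftrightarrow> inv ?u k \<le> l" if "k \<in> {1..n}" for k
  proof -
    have "inv ?u k \<in> {1..n}" using permutes_in_image [OF permutes_inv [OF u]] that by simp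
    moreover have "k \<in> ?P \<longleftrightarrow> inv ?u k \<in> {1..l}" by (rule permutes_in_image_iff [OF u])
    ultimately show ?thesis by auto
  qed
  note P = permutes_initial_image(1) [OF u l] and cP = permutes_initial_image(2) [OF u l]
  have IH: "foldr T is f = \<Phi> ?P" using Cons st(1) by simp
  have img: "word_perm (i # is) ` {1..l} = transpose i (Suc i) ` ?P" by (simp add: image_comp)
  consider "i \<in> ?P" "Suc i \<notin> ?P" | "i \<in> ?P \<longleftrightarrow> Suc i \<in> ?P" "\<not> (inv ?u i \<le> l \<and> l < inv ?u (Suc i))"
  proof -
    have "i \<in> ?P \<longleftrightarrow> inv ?u i \<le> l" "Suc i \<in> ?P \<longleftrightarrow> inv ?u (Suc i) \<le> l"
      using iP [of i] iP [of "Suc i"] i by auto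
    then show thesis using that \<open>inv ?u i < inv ?u (Suc i)\<close> by linarith
  qed
  then show ?case
  proof cases
    case 1
    then show ?thesis unfolding img using swap [OF i P cP] by (simp add: IH)
  next
    case 2
    then have "transpose i (Suc i) ` ?P = ?P" by (simp add: transpose_image_eq)
    then show ?thesis unfolding img using stay [OF i P cP 2(1) st(2) 2(2)] by (simp add: IH)
  qed
qed

lemma tpi_glide_set_poly_swap:
  assumes "i \<in> {1..<n}" "P \<subseteq> {1..n}" "card P = length a" "i \<in> P" "Suc i \<notin> P"
  shows "tpi i (glide_set_poly a n P) = glide_set_poly a n (transpose i (Suc i) ` P)"
  using ttheta_glide_path [of i P a n "sum_list a"] assms finite_subset [of P "{1..n}"]
  by (simp add: tpi_eq glide_set_poly_def)

lemma tpi_glide_set_poly_fix: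
  assumes "i \<in> {1..<n}" "P \<subseteq> {1..n}" "card P = length a" "i \<in> P \<longleftrightarrow> Suc i \<in> P" "strong_composition a"
  shows "tpi i (glide_set_poly a n P) = glide_set_poly a n P"
proof -
  have fin: "finite P" using assms(2) by (rule finite_subset) simp
  have i: "1 \<le> i" "Suc i \<le> n" using assms(1) by auto
  have "ttheta i (glide_path a P n (sum_list a)) = 0"
  proof (cases "i \<in> P")
    case True
    with assms(4) have "Suc i \<in> P" by simp
    then show ?thesis by (rule ttheta_glide_path_in
      [OF i(1) fin assms(3,5) True _ i(2) psum_le_sum_list])
  next
    case False
    with assms(4) have "Suc i \<notin> P" by simp
    then show ?thesis by (rule ttheta_glide_path_out [OF i(1) fin False _ i(2)])
  qed
  then show ?thesis by (simp add: tpi_eq glide_set_poly_def)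
qed

lemma ttheta_kaon_set_poly_swap:
  assumes "i \<in> {1..<n}" "P \<subseteq> {1..n}" "card P = length a" "i \<in> P" "Suc i \<notin> P" "strong_composition a"
  shows "ttheta i (kaon_set_poly a n P) = kaon_set_poly a n (transpose i (Suc i) ` P)"
  using ttheta_kaon_path [of i P a n "sum_list a"] assms finite_subset [of P "{1..n}"]
  by (simp add: kaon_set_poly_def)

text \<open>All pairs are inverted, so a value larger than one in the image comes from an even
  smaller place. The image is thus closed upwards.\<close>

lemma longest_perm_image:
  assumes "l \<le> n"
  shows "longest_perm n ` {1..l} = {n - l<..n}"
proof -
  let ?w = "longest_perm n"
  note w = longest_perm(1) [of n]
  let ?U = "?w ` {1..l}"
  note U = permutes_initial_image(1) [OF w assms] and c = permutes_initial_image(2) [OF w assms]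
  have up: "y \<in> ?U" if x: "x \<in> ?U" and y: "y \<in> {1..n}" "x < y" for x y
  proof -
    obtain p where p: "p \<in> {1..l}" "x = ?w p" using x by auto
    have "y \<in> ?w ` {1..n}" using y by (simp only: permutes_image [OF w])
    then obtain q where q: "q \<in> {1..n}" "y = ?w q" by auto
    have "\<not> p < q" using longest_perm(3) [of p n q] p q y assms by auto
    then show ?thesis using p q by auto
  qed
  show ?thesis
  proof (cases "l = 0")
    case False
    then have ne: "?U \<noteq> {}" by simp
    define x where "x = Min ?U"
    have x: "x \<in> ?U" using ne by (auto simp: x_def intro!: Min_in)
    then have xn: "x \<in> {1..n}" using U by blast
    have "y \<in> {x..n}" if "y \<in> ?U" for y
    proof -
      have "x \<le> y" using that by (simp add: x_def)
      then show ?thesis using U that by auto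
    qed
    moreover have "y \<in> ?U" if "y \<in> {x..n}" for y
      using up [OF x, of y] x xn that by (cases "x = y") auto
    ultimately have Ux: "?U = {x..n}" by blast
    then have "Suc n - x = l" using c by simp
    then have "{x..n} = {n - l<..n}" using xn by auto
    then show ?thesis using Ux by simp
  qed simp
qed

lemma tpi_perm_longest:
  assumes a: "strong_composition a" and l: "length a \<le> n"
  shows "tpi_perm n (longest_perm n) (xpow a)
    = path_poly (bounds a) (\<lambda>_. True) (\<lambda>_ _. True) n (sum_list a)"
proof -
  let ?w = "longest_perm n"
  obtain "is" where w: "reduced_word n ?w is" "op_perm tpi n ?w = foldr tpi is"
    using op_perm_reduced_word [OF longest_perm(1)] by blast
  have "foldr tpi is (xpow a) = glide_set_poly a n (word_perm is ` {1..length a})"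
  proof (rule foldr_word [where D = "upper_pairs n" and n = n])
    show "length is = inversions_in (upper_pairs n) (word_perm is)" "set is \<subseteq> {1..<n}"
      using longest_perm(2) [OF w(1)] w(1) by (simp_all add: reduced_word_def is_word_of_def)
    show "xpow a = glide_set_poly a n {1..length a}"
      using glide_path_initial [OF a l] by (simp add: glide_set_poly_def)
    show "p < q" if "(p, q) \<in> upper_pairs n" for p q using that by (simp add: upper_pairs_def)
    show "tpi i (glide_set_poly a n P) = glide_set_poly a n P"
      if "i \<in> {1..<n}" "P \<subseteq> {1..n}" "card P = length a" "i \<in> P \<longleftrightarrow> Suc i \<in> P" for i P
      using that a by (rule tpi_glide_set_poly_fix)
  qed (rule finite_upper_pairs l tpi_glide_set_poly_swap; assumption)+
  moreover have "word_perm is = ?w" using w(1) by (simp add: reduced_word_def is_word_of_def)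
  ultimately show ?thesis
    using longest_perm_image [OF l] glide_path_final [OF a l] w(2)
    by (simp add: tpi_perm_def glide_set_poly_def)
qed

section \<open>The sorting permutation of a weak composition\<close>

text \<open>The pairs of a nonzero and a zero place in the sorted sequence.\<close>

definition cross_pairs :: "nat \<Rightarrow> nat \<Rightarrow> (nat \<times> nat) set" where
  "cross_pairs l n = {1..l} \<times> {l<..n}"

definition zpos :: "nat list \<Rightarrow> nat list" where
  "zpos a = filter (\<lambda>i. entry a i = 0) [1..<Suc (length a)]"

lemma sorted_zpos: "sorted (zpos a)" and distinct_zpos: "distinct (zpos a)"
  unfolding zpos_def by (simp_all add: sorted_wrt_filter del: upt_Suc)

lemma set_zpos: "set (zpos a) = {i\<in>{1..length a}. entry a i = 0}"
  by (auto simp: zpos_def)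

lemma distinct_positions: "distinct (nzpos a @ zpos a)"
  by (auto simp: distinct_nzpos distinct_zpos set_nzpos set_zpos)

lemma set_positions: "set (nzpos a @ zpos a) = {1..length a}"
  by (auto simp: set_nzpos set_zpos)

lemma length_positions: "length (nzpos a @ zpos a) = length a"
  using distinct_card [OF distinct_positions [of a]] by (simp only: set_positions card_atLeastAtMost)

text \<open>An explicit candidate for the inverse of \<open>flat_perm a\<close>, listing first the
  nonzero and then the zero positions, each in increasing order. It bounds the minimal length from
  above.\<close>

definition sort_perm :: "nat list \<Rightarrow> nat \<Rightarrow> nat" where
  "sort_perm a k = (if k \<in> {1..length a} then (nzpos a @ zpos a) ! (k - 1) else k)"

lemma sort_perm_permutes: "sort_perm a permutes {1..length a}"
proof (rule bij_imp_permutes)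
  have "bij_betw ((!) (nzpos a @ zpos a)) {..<length a} {1..length a}"
    by (rule bij_betw_nth) (use distinct_positions [of a] length_positions [of a] set_positions
      [of a] in simp_all)
  moreover have "bij_betw (\<lambda>k. k - 1) {1..length a} {..<length a}"
    by (rule bij_betw_byWitness [where f' = Suc]) auto
  ultimately have "bij_betw ((!) (nzpos a @ zpos a) \<circ> (\<lambda>k. k - 1)) {1..length a} {1..length a}"
    by (rule bij_betw_trans [rotated])
  then show "bij_betw (sort_perm a) {1..length a} {1..length a}"
    by (rule bij_betw_cong [THEN iffD1, rotated]) (simp add: sort_perm_def)
qed (auto simp: sort_perm_def)

lemma perm_act_sort_perm:
  "perm_act (inv (sort_perm a)) a = flat a @ replicate (length a - length (flat a)) 0"
proof -
  have "inv (inv (sort_perm a)) = sort_perm a"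
    by (rule permutes_inv_inv [OF sort_perm_permutes])
  then have "perm_act (inv (sort_perm a)) a = map (entry a) (map (sort_perm a) [1..<Suc (length a)])"
    by (simp add: perm_act_def del: upt_Suc)
  also have "map (sort_perm a) [1..<Suc (length a)] = nzpos a @ zpos a"
    by (rule nth_equalityI) (simp_all add: length_positions sort_perm_def del: upt_Suc length_append)
  also have "map (entry a) (zpos a) = replicate (length (zpos a)) 0"
    by (rule replicate_eqI) (auto simp: set_zpos)
  then have "map (entry a) (nzpos a @ zpos a) = flat a @ replicate (length (zpos a)) 0"
    by (simp add: flat_eq)
  also have "length (zpos a) = length a - length (flat a)"
    using length_positions [of a] by (simp add: length_nzpos)
  finally show ?thesis .
qed

section \<open>Length of the sorting permutation\<close>

lemma length_flat_le: "length (flat a) \<le> length a"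
  by (simp add: flat_def)

text \<open>Nonzero positions keep their order and so do zero positions, so inversions occur only
  between the two kinds.\<close>

lemma inversions_sort_perm:
  "inversions_in (upper_pairs (length a)) (sort_perm a)
    = inversions_in (cross_pairs (length (flat a)) (length a)) (sort_perm a)"
proof -
  let ?l = "length (flat a)" and ?n = "length a" and ?u = "sort_perm a"
  have "?u p < ?u q" if pq: "1 \<le> p" "p < q" "q \<le> ?n" and "q \<le> ?l \<or> ?l < p" for p q
  proof (cases "q \<le> ?l")
    case True
    have "nzpos a ! (p - 1) < nzpos a ! (q - 1)"
      using sorted_nzpos [of a] distinct_nzpos [of a] pq True
      by (intro sorted_wrt_nth_less [of "(<)"]) (auto simp: strict_sorted_iff length_nzpos)
    moreover have "p - 1 < ?l" "q - 1 < ?l" using pq True by auto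
    ultimately show ?thesis using pq True length_nzpos [of a] by (simp add: sort_perm_def nth_append)
  next
    case False
    then have l: "?l < p" using that by simp
    have "length (zpos a) = ?n - ?l" using length_positions [of a] by (simp add: length_nzpos)
    then have "zpos a ! (p - 1 - ?l) < zpos a ! (q - 1 - ?l)"
      using sorted_zpos [of a] distinct_zpos [of a] pq l
      by (intro sorted_wrt_nth_less [of "(<)"]) (auto simp: strict_sorted_iff)
    moreover have "\<not> p - 1 < ?l" "\<not> q - 1 < ?l" using pq l by auto
    ultimately show ?thesis using pq l length_nzpos [of a] by (simp add: sort_perm_def nth_append)
  qed
  then have "{(p, q)\<in>upper_pairs ?n. ?u q < ?u p} = {(p, q)\<in>cross_pairs ?l ?n. ?u q < ?u p}"
    using length_flat_le [of a] by (fastforce simp: upper_pairs_def cross_pairs_def)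
  then show ?thesis by (simp only: inversions_in_def)
qed

text \<open>Passing from places to values shows that the count depends on \<open>u\<close> only
  through the image \<open>P\<close>.\<close>

lemma inversions_cross_pairs:
  assumes u: "u permutes {1..n}" and l: "l \<le> n" and P: "u ` {1..l} = P"
  shows "inversions_in (cross_pairs l n) u = card {(x, y)\<in>P \<times> ({1..n} - P). y < x}"
proof -
  have "{l<..n} = {1..n} - {1..l}" by auto
  then have "u ` {l<..n} = u ` {1..n} - u ` {1..l}"
    using permutes_inj [OF u] by (simp add: image_set_diff)
  then have Q: "u ` {l<..n} = {1..n} - P" using permutes_image [OF u] P by simp
  have "bij_betw (map_prod u u) {(p, q)\<in>cross_pairs l n. u q < u p} {(x, y)\<in>P \<times> ({1..n} - P). y < x}"
    unfolding bij_betw_def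
  proof
    show "inj_on (map_prod u u) {(p, q)\<in>cross_pairs l n. u q < u p}"
      using permutes_inj [OF u] by (auto simp: inj_on_def)
    show "map_prod u u ` {(p, q)\<in>cross_pairs l n. u q < u p} = {(x, y)\<in>P \<times> ({1..n} - P). y < x}"
      unfolding P [symmetric] Q [unfolded P [symmetric], symmetric] cross_pairs_def by force
  qed
  then show ?thesis unfolding inversions_in_def by (rule bij_betw_same_card)
qed

lemma inv_image_nzpos:
  assumes w: "w permutes {1..length a}"
    and act: "perm_act w a = flat a @ replicate (length a - length (flat a)) 0"
  shows "inv w ` {1..length (flat a)} = set (nzpos a)"
proof (rule card_subset_eq)
  let ?l = "length (flat a)"
  have v: "inv w permutes {1..length a}" using w by (rule permutes_inv)
  have "inv w i \<in> set (nzpos a)" if i: "i \<in> {1..?l}" for i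
  proof -
    have il: "i - 1 < ?l" "i \<in> {1..length a}" using i length_flat_le [of a] by auto
    have "entry a (inv w i) = perm_act w a ! (i - 1)"
      using il by (cases i) (auto simp: perm_act_def simp del: upt_Suc)
    also have "\<dots> = flat a ! (i - 1)" using il by (simp add: act nth_append)
    finally have "entry a (inv w i) \<noteq> 0" using nth_mem [OF il(1)] by (auto simp: flat_def)
    moreover have "inv w i \<in> {1..length a}" using il permutes_in_image [OF v] by blast
    ultimately show ?thesis by (simp add: set_nzpos)
  qed
  then show "inv w ` {1..?l} \<subseteq> set (nzpos a)" by blast
  show "card (inv w ` {1..?l}) = card (set (nzpos a))"
    using card_image [OF inj_on_subset [OF permutes_inj [OF v] subset_UNIV], of "{1..?l}"]
      card_nzpos [of a] by simp
qed simp

lemma inv_flat_perm: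
  defines "v \<equiv> \<lambda>a. inv (flat_perm a)"
  shows "v a permutes {1..length a}" "v a ` {1..length (flat a)} = set (nzpos a)"
    and "reduced_word (length a) (v a) is \<Longrightarrow>
      length is = inversions_in (cross_pairs (length (flat a)) (length a)) (v a)"
proof -
  let ?n = "length a" and ?l = "length (flat a)"
  let ?Q = "\<lambda>w. w permutes {1..?n} \<and> perm_act w a = flat a @ replicate (?n - ?l) 0"
  let ?u = "sort_perm a" and ?D = "cross_pairs ?l ?n"
  have Q: "?Q (inv ?u)" using permutes_inv [OF sort_perm_permutes] perm_act_sort_perm by blast
  have fp: "?Q (flat_perm a) \<and> (\<forall>w. ?Q w \<longrightarrow> perm_length ?n (flat_perm a) \<le> perm_length ?n w)"
    unfolding flat_perm_def by (rule arg_min_nat_lemma [where P = ?Q, OF Q])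
  then show v: "v a permutes {1..?n}" and im: "v a ` {1..?l} = set (nzpos a)"
    unfolding v_def using permutes_inv inv_image_nzpos by blast+
  have im': "?u ` {1..?l} = set (nzpos a)"
    using inv_image_nzpos [of "inv ?u" a] Q permutes_inv_inv [OF sort_perm_permutes [of a]] by simp
  have D: "finite ?D" "\<And>p q. (p, q) \<in> ?D \<Longrightarrow> p < q" by (auto simp: cross_pairs_def)
  obtain js where js: "is_word_of ?n ?u js" "length js \<le> inversions_in (upper_pairs ?n) ?u"
    using ex_word_le_inversions [OF sort_perm_permutes] by blast
  \<comment> \<open>The length is squeezed: minimality and \<open>sort_perm\<close> bound it by the
    cross inversions of \<open>?u\<close>, which agree with those of \<open>v a\<close> because both
    images of {1..l} are the nonzero positions; the lower bound is
    \<open>perm_length_ge\<close>.\<close>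
  have "perm_length ?n (v a) \<le> perm_length ?n (flat_perm a)"
    unfolding v_def using fp perm_length_inv by blast
  also have "\<dots> \<le> perm_length ?n (inv ?u)" using fp Q by blast
  also have "\<dots> \<le> perm_length ?n ?u" by (rule perm_length_inv [OF sort_perm_permutes])
  also have "\<dots> \<le> length js" by (rule perm_length_le [OF js(1)])
  also have "\<dots> \<le> inversions_in ?D ?u" using js(2) inversions_sort_perm by simp
  also have "\<dots> = inversions_in ?D (v a)"
    using inversions_cross_pairs [OF v length_flat_le im]
      inversions_cross_pairs [OF sort_perm_permutes length_flat_le im'] by simp
  finally have "perm_length ?n (v a) \<le> inversions_in ?D (v a)" .
  moreover have "inversions_in ?D (v a) \<le> perm_length ?n (v a)" by (rule perm_length_ge [OF D v])
  ultimately show "length is = inversions_in ?D (v a)" if "reduced_word ?n (v a) is"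
    using that by (simp add: reduced_word_def)
qed

text \<open>Only the initial value and the move of one position enter, so the argument serves both
  pi on glides and theta on kaons.\<close>

lemma op_perm_inv_flat_perm:
  assumes base: "\<Phi> {1..length (flat a)} = f"
    and swap: "\<And>i P. i \<in> {1..<length a} \<Longrightarrow> P \<subseteq> {1..length a} \<Longrightarrow> card P = length (flat a) \<Longrightarrow> i \<in> P \<Longrightarrow>
      Suc i \<notin> P \<Longrightarrow> T i (\<Phi> P) = \<Phi> (transpose i (Suc i) ` P)"
  shows "op_perm T (length a) (inv (flat_perm a)) f = \<Phi> (set (nzpos a))"
proof -
  let ?n = "length a" and ?l = "length (flat a)" and ?v = "inv (flat_perm a)"
  obtain "is" where w: "reduced_word ?n ?v is" "op_perm T ?n ?v = foldr T is"
    using op_perm_reduced_word [OF inv_flat_perm(1)] by blast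
  have is_w: "set is \<subseteq> {1..<?n}" "word_perm is = ?v"
    using w(1) by (simp_all add: reduced_word_def is_word_of_def)
  have "foldr T is f = \<Phi> (word_perm is ` {1..?l})"
  proof (rule foldr_word [where D = "cross_pairs ?l ?n" and n = ?n])
    show "length is = inversions_in (cross_pairs ?l ?n) (word_perm is)"
      using inv_flat_perm(3) [OF w(1)] by (simp add: is_w)
    show "finite (cross_pairs ?l ?n)" by (simp add: cross_pairs_def)
    show "p < q" if "(p, q) \<in> cross_pairs ?l ?n" for p q using that by (auto simp: cross_pairs_def)
    \<comment> \<open>All pairs cross \<open>?l\<close>, so every letter moves a position and this
      case is contradictory.\<close>
    show "T i (\<Phi> P) = \<Phi> P" if "(p, q) \<in> cross_pairs ?l ?n" "\<not> (p \<le> ?l \<and> ?l < q)" for i P p q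
      using that by (auto simp: cross_pairs_def)
  qed (use base swap is_w(1) length_flat_le in auto)
  then show ?thesis using w(2) inv_flat_perm(2) [of a] by (simp add: is_w)
qed

lemma tpi_perm_inv_flat_perm:
  "tpi_perm (length a) (inv (flat_perm a)) (xpow (flat a)) = fund_glide a"
proof -
  have "tpi_perm (length a) (inv (flat_perm a)) (xpow (flat a))
    = glide_set_poly (flat a) (length a) (set (nzpos a))"
    unfolding tpi_perm_def
  proof (rule op_perm_inv_flat_perm)
    show "glide_set_poly (flat a) (length a) {1..length (flat a)} = xpow (flat a)"
      unfolding glide_set_poly_def by (rule glide_path_initial [OF strong_flat length_flat_le])
  qed (rule tpi_glide_set_poly_swap)
  then show ?thesis
    by (simp add: fund_glide_def glides_eq glide_paths_def sum_step_paths glide_set_poly_def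
      glide_path_def)
qed

lemma ttheta_perm_inv_flat_perm:
  "ttheta_perm (length a) (inv (flat_perm a)) (xpow (flat a)) = kaon a"
proof -
  have "ttheta_perm (length a) (inv (flat_perm a)) (xpow (flat a))
    = kaon_set_poly (flat a) (length a) (set (nzpos a))"
    unfolding ttheta_perm_def
  proof (rule op_perm_inv_flat_perm)
    show "kaon_set_poly (flat a) (length a) {1..length (flat a)} = xpow (flat a)"
      unfolding kaon_set_poly_def by (rule kaon_path_initial [OF strong_flat length_flat_le])
  qed (rule ttheta_kaon_set_poly_swap strong_flat | assumption)+
  then show ?thesis
    by (simp add: kaon_def mesonic_glides_eq kaon_paths_def sum_step_paths kaon_set_poly_def
      kaon_path_def)
qed

theorem theorem1p4:
  fixes n :: nat
  assumes "n \<ge> 1"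
  shows "(\<forall>a. strong_composition a \<and> length a \<le> n \<longrightarrow>
            tpi_perm n (longest_perm n) (xpow a) = multifund a n) \<and>
         (\<forall>a. length a = n \<longrightarrow>
            tpi_perm n (inv (flat_perm a)) (xpow (flat a)) = fund_glide a) \<and>
         (\<forall>a. length a = n \<longrightarrow>
            ttheta_perm n (inv (flat_perm a)) (xpow (flat a)) = kaon a)"
  using tpi_perm_longest multifund_eq_path_poly tpi_perm_inv_flat_perm ttheta_perm_inv_flat_perm
  by auto

end
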